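(* Let $n\ge1$ and let $\lambda\in\mathbb{Z}^n$ with $\lambda_1\ge\cdots\ge\lambda_n$. Then $$P_\lambda=\sum_{z\in W^\lambda}t^{\frac12\ell(v_\lambda z)}\,\mathrm{ev}^t_{z\lambda}\big(c^Y_{v_\lambda z}\big)E_{z\lambda}\qquad\text{and}\qquad A_{\lambda+\rho}=\sum_{z\in S_n}(-t^{\frac12})^{\ell(w_0z)}\,\mathrm{ev}^t_{z(\lambda+\rho)}\big(c^{Y^{-1}}_{w_0z}\big)E_{z(\lambda+\rho)}.$$ Alternatively, $$P_\lambda=\sum_{\mu\in S_n\lambda}\Big(\prod_{1\le i<j\le n,\ \mu_i>\mu_j}t\,\frac{1-q^{\mu_i-\mu_j}t^{v_\mu(i)-v_\mu(j)-1}}{1-q^{\mu_i-\mu_j}t^{v_\mu(i)-v_\mu(j)}}\Big)E_\mu$$ and $$A_{\lambda+\rho}=\sum_{\mu\in S_n(\lambda+\rho)}\Big(\prod_{1\le i<j\le n,\ \mu_i>\mu_j}(-1)\,\frac{1-q^{\mu_i-\mu_j}t^{v_\mu(i)-v_\mu(j)+1}}{1-q^{\mu_i-\mu_j}t^{v_\mu(i)-v_\mu(j)}}\Big)E_\mu .$$ Here $S_n\lambda$ denotes the set of distinct rearrangements of $\lambda$.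
   Context: Let $q,t^{1/2}$ be independent indeterminates over $\mathbb{C}$, $t=(t^{1/2})^2$, $K=\mathbb{C}(q,t^{1/2})$, $K[X]=K[x_1^{\pm1},\ldots,x_n^{\pm1}]$. $S_n$ acts on $K[X]$ by permuting variables and on $\mathbb{Z}^n$ by $(w\mu)_{w(i)}=\mu_i$; $s_i=(i,i+1)$; $\ell$ is the length; $w_0$ is the longest element of $S_n$. Put $x^\mu=x_1^{\mu_1}\cdots x_n^{\mu_n}$, $\rho=(n-1,n-2,\ldots,1,0)$, $\partial_if=\frac{f-s_if}{x_i-x_{i+1}}$. For $\mu\in\mathbb{Z}^n$, $v_\mu\in S_n$ is the minimal length permutation such that $v_\mu\mu$ is weakly increasing; explicitly $v_\mu(r)=1+\#\{r'<r:\mu_{r'}\le\mu_r\}+\#\{r'>r:\mu_{r'}<\mu_r\}$. The electronic (nonsymmetric) Macdonald polynomials $E_\mu\in K[X]$, $\mu\in\mathbb{Z}^n$, are determined by: (E0) $E_{(0,\ldots,0)}=1$; (E1) $E_{(\mu_n+1,\mu_1,\ldots,\mu_{n-1})}=q^{\mu_n}x_1E_\mu(x_2,\ldots,x_n,q^{-1}x_1)$; (E2) if $\mu\in\mathbb{Z}_{\ge0}^n$ and $\mu_i>\mu_{i+1}$ then $E_{s_i\mu}=\partial_i(x_iE_\mu)-tx_i\partial_iE_\mu+\frac{(1-t)a}{1-a}E_\mu$ with $a=q^{\mu_i-\mu_{i+1}}t^{v_\mu(i)-v_\mu(i+1)}$; (E3) $E_{(\mu_1-1,\ldots,\mu_n-1)}=x_1^{-1}\cdots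 x_n^{-1}E_\mu$. For weakly decreasing $\lambda$: $P_\lambda=\frac1{W_\lambda(t)}\sum_{w\in S_n}w\big(E_\lambda\prod_{i<j}\frac{x_i-tx_j}{x_i-x_j}\big)$, where $W_\lambda(t)$ is the constant making the coefficient of $x^\lambda$ in $P_\lambda$ equal to $1$; and $A_{\lambda+\rho}=\big(\prod_{i<j}\frac{x_j-tx_i}{x_i-x_j}\big)\sum_{w\in S_n}(-1)^{\ell(w)}wE_{\lambda+\rho}$. $W_\lambda$ is the stabilizer of $\lambda$ in $S_n$ and $W^\lambda$ is the set of minimal length representatives of the cosets in $S_n/W_\lambda$; the permutation $v_\lambda$ above is the longest element of $W^\lambda$. For commuting variables $Y_1,\ldots,Y_n$ set $$c^Y_{ij}=\frac{t^{-\frac12}-t^{\frac12}Y_iY_j^{-1}}{1-Y_iY_j^{-1}},\qquad c^{Y^{-1}}_{ij}=\frac{t^{-\frac12}-t^{\frac12}Y_i^{-1}Y_j}{1-Y_i^{-1}Y_j},$$ and for $w\in S_n$ let $c^Y_w=\prod_{(i,j)\in\mathrm{Inv}(w)}c^Y_{ij}$ and $c^{Y^{-1}}_w=\prod_{(i,j)\in\mathrm{Inv}(w)}c^{Y^{-1}}_{ij}$, where $\mathrm{Inv}(w)=\{(i,j):1\le i<j\le n,\ w(i)>w(j)\}$. For $\mu\in\mathbb{Z}^n$, $\mathrm{ev}^t_\mu$ is the evaluation homomorphism $\mathrm{ev}^t_\mu(Y_i)=q^{-\mu_i}t^{-(v_\mu(i)-1)+\frac12(n-1)}$, extended to rational functions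 whose evaluated denominator is nonzero.
   Formalization: In the first two expansions v_λ z and w_0 z are replaced by v_λ z^{-1} and w_0 z^{-1} (both in the length and in the c-function); with the stated conventions the formulas without the inverse fail for n ≥ 3. *)

theory Defs
  imports
    "HOL-Library.Poly_Mapping"
    "HOL-Computational_Algebra.Polynomial"
    "HOL-Computational_Algebra.Fraction_Field"
    "HOL-Combinatorics.Permutations"
begin

section \<open>Coefficients, Laurent polynomials, rational functions\<close>

text \<open>
  The field \<open>K = \<complex>(q, t\<^sup>1\<^sup>/\<^sup>2)\<close> is the fraction field of \<open>\<complex>[t\<^sup>1\<^sup>/\<^sup>2][q]\<close>: the outer
  polynomial variable is \<open>q\<close>, the inner one is \<open>t\<^sup>1\<^sup>/\<^sup>2\<close>.
\<close>

type_synonym K = "complex poly poly fract"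

definition qq :: K where "qq = Fract [:0, 1:] 1"

definition th :: K where "th = Fract [:[:0, 1:]:] 1"

definition tt :: K where "tt = th ^ 2"

text \<open>
  Exponent vectors are finitely supported functions \<open>nat \<Rightarrow>\<^sub>0 int\<close>, so \<open>laurent\<close> is the
  ring of Laurent polynomials in countably many variables indexed by \<open>nat\<close>; \<open>\<int>\<^sup>n\<close> and
  \<open>K[x\<^sub>1\<^sup>\<plusminus>\<^sup>1, \<dots>, x\<^sub>n\<^sup>\<plusminus>\<^sup>1]\<close> are the parts supported on the indices \<open>1, \<dots>, n\<close>.
  Beware that the library order on exponent vectors is lexicographic, hence
  inequalities below are always stated componentwise.
\<close>

type_synonym expo = "nat \<Rightarrow>\<^sub>0 int"
type_synonym laurent = "expo \<Rightarrow>\<^sub>0 K"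
type_synonym ratfun = "laurent fract"

abbreviation coord :: "expo \<Rightarrow> nat \<Rightarrow> int" where
  "coord \<equiv> Poly_Mapping.lookup"

definition Zn :: "nat \<Rightarrow> expo set" where
  "Zn n = {\<mu>. Poly_Mapping.keys \<mu> \<subseteq> {1..n}}"

definition vec :: "nat \<Rightarrow> (nat \<Rightarrow> int) \<Rightarrow> expo" where
  "vec n f = (\<Sum>i=1..n. Poly_Mapping.single i (f i))"

definition of_laurent :: "laurent \<Rightarrow> ratfun" where
  "of_laurent f = Fract f 1"

definition const :: "K \<Rightarrow> ratfun" where
  "const c = of_laurent (Poly_Mapping.single 0 c)"

definition X :: "nat \<Rightarrow> ratfun" where
  "X i = of_laurent (Poly_Mapping.single (Poly_Mapping.single i 1) 1)"

definition KX :: "nat \<Rightarrow> ratfun set" where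
  "KX n = of_laurent ` {f. Poly_Mapping.keys f \<subseteq> Zn n}"

text \<open>The coefficient of \<open>x\<^sup>\<mu>\<close> in the Laurent polynomial \<open>z\<close> exists and equals \<open>c\<close>.\<close>

definition has_coeff :: "ratfun \<Rightarrow> expo \<Rightarrow> K \<Rightarrow> bool" where
  "has_coeff z \<mu> c \<longleftrightarrow> (\<exists>f. z = of_laurent f \<and> Poly_Mapping.lookup f \<mu> = c)"

text \<open>
  \<open>laurent_eval h g\<close> substitutes \<open>g i\<close> for the \<open>i\<close>-th variable and applies \<open>h\<close> to the
  coefficients; \<open>rat_eval h g\<close> is its extension to those rational functions which
  have a representation with nonzero evaluated denominator.
\<close>

definition laurent_eval :: "(K \<Rightarrow> 'b::field) \<Rightarrow> (nat \<Rightarrow> 'b) \<Rightarrow> laurent \<Rightarrow> 'b" where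
  "laurent_eval h g f =
     (\<Sum>\<nu>\<in>Poly_Mapping.keys f.
        h (Poly_Mapping.lookup f \<nu>) * (\<Prod>i\<in>Poly_Mapping.keys \<nu>. g i powi coord \<nu> i))"

definition rat_eval :: "(K \<Rightarrow> 'b::field) \<Rightarrow> (nat \<Rightarrow> 'b) \<Rightarrow> ratfun \<Rightarrow> 'b" where
  "rat_eval h g z =
     (THE y. \<exists>a b. z = Fract a b \<and> laurent_eval h g b \<noteq> 0 \<and>
                   y = laurent_eval h g a / laurent_eval h g b)"


section \<open>The symmetric group\<close>

definition Sym :: "nat \<Rightarrow> (nat \<Rightarrow> nat) set" where
  "Sym n = {w. w permutes {1..n}}"

definition Inv :: "nat \<Rightarrow> (nat \<Rightarrow> nat) \<Rightarrow> (nat \<times> nat) set" where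
  "Inv n w = {(i, j). 1 \<le> i \<and> i < j \<and> j \<le> n \<and> w i > w j}"

definition len :: "nat \<Rightarrow> (nat \<Rightarrow> nat) \<Rightarrow> nat" where
  "len n w = card (Inv n w)"

definition w0 :: "nat \<Rightarrow> nat \<Rightarrow> nat" where
  "w0 n = (THE w. is_arg_max (len n) (\<lambda>w. w \<in> Sym n) w)"

text \<open>\<open>(w\<mu>)\<^bsub>w(i)\<^esub> = \<mu>\<^sub>i\<close>\<close>

definition act :: "(nat \<Rightarrow> nat) \<Rightarrow> expo \<Rightarrow> expo" where
  "act w \<mu> = (\<Sum>i\<in>Poly_Mapping.keys \<mu>. Poly_Mapping.single (w i) (coord \<mu> i))"

text \<open>\<open>wf = f(x\<^bsub>w(1)\<^esub>, \<dots>, x\<^bsub>w(n)\<^esub>)\<close>, also for rational \<open>f\<close>\<close>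

definition actX :: "(nat \<Rightarrow> nat) \<Rightarrow> ratfun \<Rightarrow> ratfun" where
  "actX w = rat_eval const (\<lambda>i. X (w i))"

definition orbit :: "nat \<Rightarrow> expo \<Rightarrow> expo set" where
  "orbit n \<mu> = (\<lambda>w. act w \<mu>) ` Sym n"

definition stab :: "nat \<Rightarrow> expo \<Rightarrow> (nat \<Rightarrow> nat) set" where
  "stab n \<mu> = {w \<in> Sym n. act w \<mu> = \<mu>}"

definition min_reps :: "nat \<Rightarrow> expo \<Rightarrow> (nat \<Rightarrow> nat) set" where
  "min_reps n \<mu> = {z \<in> Sym n. \<forall>u \<in> stab n \<mu>. len n z \<le> len n (z \<circ> u)}"

definition weakly_increasing :: "nat \<Rightarrow> expo \<Rightarrow> bool" where
  "weakly_increasing n \<mu> \<longleftrightarrow> (\<forall>i j. 1 \<le> i \<and> i \<le> j \<and> j \<le> n \<longrightarrow> coord \<mu> i \<le> coord \<mu> j)"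

definition weakly_decreasing :: "nat \<Rightarrow> expo \<Rightarrow> bool" where
  "weakly_decreasing n \<mu> \<longleftrightarrow> (\<forall>i j. 1 \<le> i \<and> i \<le> j \<and> j \<le> n \<longrightarrow> coord \<mu> j \<le> coord \<mu> i)"

definition vperm :: "nat \<Rightarrow> expo \<Rightarrow> nat \<Rightarrow> nat" where
  "vperm n \<mu> =
     (THE v. is_arg_min (len n) (\<lambda>w. w \<in> Sym n \<and> weakly_increasing n (act w \<mu>)) v)"

definition rho :: "nat \<Rightarrow> expo" where
  "rho n = vec n (\<lambda>i. int n - int i)"


section \<open>Nonsymmetric, symmetric and fermionic Macdonald polynomials\<close>

definition divdiff :: "nat \<Rightarrow> ratfun \<Rightarrow> ratfun" where
  "divdiff i f = (f - actX (transpose i (i + 1)) f) / (X i - X (i + 1))"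

text \<open>
  The electronic Macdonald polynomials are the family on \<open>\<int>\<^sup>n\<close> determined by these
  relations; values of \<open>E\<close> outside \<open>\<int>\<^sup>n\<close> are irrelevant.
\<close>

definition electronic_macdonald :: "nat \<Rightarrow> (expo \<Rightarrow> ratfun) \<Rightarrow> bool" where
  "electronic_macdonald n E \<longleftrightarrow>
     (\<forall>\<mu>\<in>Zn n. E \<mu> \<in> KX n) \<and>
     E 0 = 1 \<and>
     (\<forall>\<mu>\<in>Zn n.
        E (vec n (\<lambda>i. if i = 1 then coord \<mu> n + 1 else coord \<mu> (i - 1))) =
          const (qq powi coord \<mu> n) * X 1 *
          rat_eval const (\<lambda>i. if i < n then X (i + 1) else const (inverse qq) * X 1) (E \<mu>)) \<and>
     (\<forall>\<mu>\<in>Zn n. \<forall>i. (\<forall>j. coord \<mu> j \<ge> 0) \<longrightarrow> 1 \<le> i \<longrightarrow> i < n \<longrightarrow>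
        coord \<mu> i > coord \<mu> (i + 1) \<longrightarrow>
        (let a = qq powi (coord \<mu> i - coord \<mu> (i + 1)) *
                 tt powi (int (vperm n \<mu> i) - int (vperm n \<mu> (i + 1)))
         in E (act (transpose i (i + 1)) \<mu>) =
              divdiff i (X i * E \<mu>) - const tt * X i * divdiff i (E \<mu>)
              + const ((1 - tt) * a / (1 - a)) * E \<mu>)) \<and>
     (\<forall>\<mu>\<in>Zn n.
        E (vec n (\<lambda>i. coord \<mu> i - 1)) = (\<Prod>i=1..n. inverse (X i)) * E \<mu>)"

definition pairs :: "nat \<Rightarrow> (nat \<times> nat) set" where
  "pairs n = {(i, j). 1 \<le> i \<and> i < j \<and> j \<le> n}"

definition symm_sum :: "nat \<Rightarrow> ratfun \<Rightarrow> ratfun" where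
  "symm_sum n f =
     (\<Sum>w\<in>Sym n. actX w (f * (\<Prod>(i, j)\<in>pairs n. (X i - const tt * X j) / (X i - X j))))"

definition Wconst :: "nat \<Rightarrow> (expo \<Rightarrow> ratfun) \<Rightarrow> expo \<Rightarrow> K" where
  "Wconst n E lam = (THE c. has_coeff (const (1 / c) * symm_sum n (E lam)) lam 1)"

definition macP :: "nat \<Rightarrow> (expo \<Rightarrow> ratfun) \<Rightarrow> expo \<Rightarrow> ratfun" where
  "macP n E lam = const (1 / Wconst n E lam) * symm_sum n (E lam)"

text \<open>\<open>macA n E \<mu>\<close> is \<open>A\<^sub>\<mu>\<close>; it is used for \<open>\<mu> = \<lambda> + \<rho>\<close> only.\<close>

definition macA :: "nat \<Rightarrow> (expo \<Rightarrow> ratfun) \<Rightarrow> expo \<Rightarrow> ratfun" where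
  "macA n E \<mu> =
     (\<Prod>(i, j)\<in>pairs n. (X j - const tt * X i) / (X i - X j)) *
     (\<Sum>w\<in>Sym n. (- 1) ^ len n w * actX w (E \<mu>))"


section \<open>c-functions\<close>

text \<open>
  In the expansions over \<open>z \<in> W\<^sup>\<lambda>\<close> the c-function attached to \<open>z\<lambda>\<close> is the one of
  \<open>v\<^bsub>z\<lambda>\<^esub> = v\<^sub>\<lambda> z\<^sup>-\<^sup>1\<close>; for the regular weight \<open>\<lambda> + \<rho>\<close> this is \<open>w\<^sub>0 z\<^sup>-\<^sup>1\<close>. With \<open>Inv\<close> and
  \<open>act\<close> as above the inverse cannot be dropped once \<open>n \<ge> 3\<close>.
\<close>

text \<open>Rational functions in \<open>Y\<^sub>1, \<dots>, Y\<^sub>n\<close> are also elements of \<^typ>\<open>ratfun\<close>.\<close>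

abbreviation Y :: "nat \<Rightarrow> ratfun" where "Y \<equiv> X"

definition cY :: "nat \<Rightarrow> nat \<Rightarrow> ratfun" where
  "cY i j = (const (inverse th) - const th * Y i * inverse (Y j)) / (1 - Y i * inverse (Y j))"

definition cYinv :: "nat \<Rightarrow> nat \<Rightarrow> ratfun" where
  "cYinv i j = (const (inverse th) - const th * inverse (Y i) * Y j) / (1 - inverse (Y i) * Y j)"

definition cYw :: "nat \<Rightarrow> (nat \<Rightarrow> nat) \<Rightarrow> ratfun" where
  "cYw n w = (\<Prod>(i, j)\<in>Inv n w. cY i j)"

definition cYinvw :: "nat \<Rightarrow> (nat \<Rightarrow> nat) \<Rightarrow> ratfun" where
  "cYinvw n w = (\<Prod>(i, j)\<in>Inv n w. cYinv i j)"

text \<open>\<open>Y\<^sub>i \<mapsto> q\<^bsup>-\<mu>\<^sub>i\<^esup> t\<^bsup>-(v\<^sub>\<mu>(i)-1)+(n-1)/2\<^esup>\<close>, with the exponent of \<open>t\<close> doubled as exponent of \<open>t\<^sup>1\<^sup>/\<^sup>2\<close>.\<close>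

definition evt :: "nat \<Rightarrow> expo \<Rightarrow> ratfun \<Rightarrow> K" where
  "evt n \<mu> = rat_eval (\<lambda>c. c)
     (\<lambda>i. qq powi (- coord \<mu> i) * th powi (- 2 * (int (vperm n \<mu> i) - 1) + (int n - 1)))"


section \<open>The definite descriptions are well defined\<close>

lemma finite_Inv [simp]: "finite (Inv n w)"
  by (rule finite_subset[of _ "{1..n} \<times> {1..n}"]) (auto simp: Inv_def)

lemma coord_act:
  assumes "w \<in> Sym n"
  shows "coord (act w \<mu>) (w i) = coord \<mu> i"
proof -
  have inj: "w k = w i \<longleftrightarrow> k = i" for k
    using assms permutes_inj[of w "{1..n}"] by (auto simp: Sym_def inj_def)
  show ?thesis
    by (auto simp: act_def lookup_sum lookup_single when_def inj in_keys_iff)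
qed

lemma Sym_value:
  assumes w: "w \<in> Sym n" and i: "i \<in> {1..n}"
  shows "w i = 1 + card {j \<in> {1..n}. w j < w i}"
proof -
  have p: "w permutes {1..n}" using w by (simp add: Sym_def)
  have "w ` {j \<in> {1..n}. w j < w i} = {k \<in> {1..n}. k < w i}"
  proof (intro equalityI subsetI)
    fix k assume "k \<in> {k \<in> {1..n}. k < w i}"
    then obtain j where "j \<in> {1..n}" "k = w j" "k < w i"
      using permutes_image[OF p] by (metis (lifting) imageE mem_Collect_eq)
    then show "k \<in> w ` {j \<in> {1..n}. w j < w i}" by blast
  next
    fix k assume "k \<in> w ` {j \<in> {1..n}. w j < w i}"
    then obtain j where "j \<in> {1..n}" "k = w j" "w j < w i" by blast
    then show "k \<in> {k \<in> {1..n}. k < w i}"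
      using permutes_in_image[OF p, of j] by simp
  qed
  also have "\<dots> = {1..<w i}"
    using permutes_in_image[OF p, of i] i by auto
  finally have "card (w ` {j \<in> {1..n}. w j < w i}) = w i - 1" by simp
  moreover have "card (w ` {j \<in> {1..n}. w j < w i}) = card {j \<in> {1..n}. w j < w i}"
    by (rule card_image) (rule inj_on_subset[OF permutes_inj[OF p] subset_UNIV])
  moreover have "w i \<ge> 1" using permutes_in_image[OF p, of i] i by auto
  ultimately show ?thesis by simp
qed

lemma Sym_eqI:
  assumes u: "u \<in> Sym n" and w: "w \<in> Sym n" and I: "Inv n u = Inv n w"
  shows "u = w"
proof
  fix i
  have less: "v j < v i \<longleftrightarrow> (if j < i then (j, i) \<notin> Inv n v else (i, j) \<in> Inv n v)"
    if "v \<in> Sym n" "j \<in> {1..n}" "i \<in> {1..n}" for v j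
  proof -
    have "v j = v i \<longleftrightarrow> j = i"
      using that(1) permutes_inj[of v "{1..n}"] by (auto simp: Sym_def inj_def)
    then show ?thesis using that by (auto simp: Inv_def)
  qed
  show "u i = w i"
  proof (cases "i \<in> {1..n}")
    case True
    have "{j \<in> {1..n}. u j < u i} = {j \<in> {1..n}. w j < w i}"
      using less[OF u _ True] less[OF w _ True] I by auto
    then show ?thesis using Sym_value[OF u True] Sym_value[OF w True] by simp
  next
    case False
    then show ?thesis using u w by (auto simp: Sym_def permutes_def)
  qed
qed

lemma vperm_explicit:
  "vperm n \<mu> =
    (\<lambda>r. if r \<in> {1..n}
         then 1 + card {r' \<in> {1..<r}. coord \<mu> r' \<le> coord \<mu> r}
                + card {r' \<in> {r<..n}. coord \<mu> r' < coord \<mu> r}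
         else r)" (is "_ = ?v")
proof -
  define V where "V = ?v"
  define B where "B = (\<lambda>r. {r' \<in> {1..n}. coord \<mu> r' < coord \<mu> r \<or> coord \<mu> r' = coord \<mu> r \<and> r' < r})"
  have v: "V r = 1 + card (B r)" if "r \<in> {1..n}" for r
  proof -
    have "B r = {r' \<in> {1..<r}. coord \<mu> r' \<le> coord \<mu> r} \<union> {r' \<in> {r<..n}. coord \<mu> r' < coord \<mu> r}"
    proof (rule set_eqI)
      fix x
      show "x \<in> B r \<longleftrightarrow> x \<in> {r' \<in> {1..<r}. coord \<mu> r' \<le> coord \<mu> r} \<union> {r' \<in> {r<..n}. coord \<mu> r' < coord \<mu> r}"
        using that by (cases x r rule: linorder_cases) (auto simp: B_def)
    qed
    then have "card (B r) = card {r' \<in> {1..<r}. coord \<mu> r' \<le> coord \<mu> r}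
                          + card {r' \<in> {r<..n}. coord \<mu> r' < coord \<mu> r}"
      by (simp add: card_Un_disjoint disjoint_iff)
    then show ?thesis using that by (simp add: V_def)
  qed
  have mono: "V i < V j"
    if "i \<in> {1..n}" "j \<in> {1..n}" "coord \<mu> i < coord \<mu> j \<or> coord \<mu> i = coord \<mu> j \<and> i < j" for i j
  proof -
    have "B i \<subset> B j" using that by (force simp: B_def)
    then have "card (B i) < card (B j)" by (intro psubset_card_mono) (auto simp: B_def)
    then show ?thesis using v that by simp
  qed
  have less: "V i < V j \<longleftrightarrow> coord \<mu> i < coord \<mu> j \<or> coord \<mu> i = coord \<mu> j \<and> i < j"
    if "i \<in> {1..n}" "j \<in> {1..n}" for i j
    proof
    assume V: "V i < V j"
    show "coord \<mu> i < coord \<mu> j \<or> coord \<mu> i = coord \<mu> j \<and> i < j"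
    proof (rule ccontr)
      assume "\<not> ?thesis"
      then have "i = j \<or> coord \<mu> j < coord \<mu> i \<or> coord \<mu> j = coord \<mu> i \<and> j < i" by linarith
      then show False using mono[OF that(2,1)] V by fastforce
    qed
  qed (rule mono[OF that])
  have inj: "inj_on V {1..n}"
  proof (rule inj_onI)
    fix i j assume "i \<in> {1..n}" "j \<in> {1..n}" "V i = V j"
    then show "i = j" using less[of i j] less[of j i] by (metis less_irrefl linorder_neqE)
  qed
  have "V ` {1..n} \<subseteq> {1..n}"
  proof safe
    fix r assume r: "r \<in> {1..n}"
    have "B r \<subseteq> {1..n} - {r}" by (auto simp: B_def)
    then have "card (B r) \<le> card ({1..n} - {r})" by (intro card_mono) auto
    also have "\<dots> = n - 1" using r by simp
    finally show "V r \<in> {1..n}" using v[OF r] r by (simp, linarith)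
  qed
  then have "bij_betw V {1..n} {1..n}"
    using inj by (simp add: bij_betw_def endo_inj_surj)
  then have S: "V \<in> Sym n"
    unfolding Sym_def by (intro CollectI bij_imp_permutes) (simp_all only: V_def, auto)
  have I: "Inv n V = {(i, j). 1 \<le> i \<and> i < j \<and> j \<le> n \<and> coord \<mu> i > coord \<mu> j}" (is "_ = ?I")
    unfolding Inv_def
  proof (intro set_eqI, clarify)
    fix i j
    show "(i, j) \<in> {(i, j). 1 \<le> i \<and> i < j \<and> j \<le> n \<and> V j < V i} \<longleftrightarrow>
          (i, j) \<in> {(i, j). 1 \<le> i \<and> i < j \<and> j \<le> n \<and> coord \<mu> j < coord \<mu> i}"
      using less[of j i] by auto
  qed
  have incr: "weakly_increasing n (act w \<mu>) \<longleftrightarrow>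
      (\<forall>a\<in>{1..n}. \<forall>b\<in>{1..n}. w a \<le> w b \<longrightarrow> coord \<mu> a \<le> coord \<mu> b)" if w: "w \<in> Sym n" for w
  proof -
    have p: "w permutes {1..n}" using w by (simp add: Sym_def)
    have "weakly_increasing n (act w \<mu>) \<longleftrightarrow>
        (\<forall>i\<in>w ` {1..n}. \<forall>j\<in>w ` {1..n}. i \<le> j \<longrightarrow> coord (act w \<mu>) i \<le> coord (act w \<mu>) j)"
      unfolding weakly_increasing_def permutes_image[OF p] Ball_def atLeastAtMost_iff
      by (meson order_trans)
    then show ?thesis by (simp add: coord_act[OF w])
  qed
  have inc: "weakly_increasing n (act V \<mu>)"
    unfolding incr[OF S]
  proof (intro ballI impI)
    fix a b assume "a \<in> {1..n}" "b \<in> {1..n}" "V a \<le> V b"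
    then show "coord \<mu> a \<le> coord \<mu> b" using less[of b a] by linarith
  qed
  have sub: "?I \<subseteq> Inv n w" if "w \<in> Sym n" "weakly_increasing n (act w \<mu>)" for w
  proof safe
    fix i j assume ij: "1 \<le> i" "i < j" "j \<le> n" "coord \<mu> j < coord \<mu> i"
    have "w i \<le> w j \<longrightarrow> coord \<mu> i \<le> coord \<mu> j"
      using that(2) ij unfolding incr[OF that(1)] by simp
    then show "(i, j) \<in> Inv n w" using ij by (simp add: Inv_def)
  qed
  have "is_arg_min (len n) (\<lambda>w. w \<in> Sym n \<and> weakly_increasing n (act w \<mu>)) V"
    unfolding is_arg_min_linorder len_def I using S inc card_mono[OF finite_Inv sub] by blast
  moreover have "w = V"
    if "is_arg_min (len n) (\<lambda>w. w \<in> Sym n \<and> weakly_increasing n (act w \<mu>)) w" for w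
  proof -
    have w: "w \<in> Sym n" "weakly_increasing n (act w \<mu>)" and "len n w \<le> len n V"
      using that S inc unfolding is_arg_min_linorder by auto
    then have "Inv n w = Inv n V"
      using card_seteq[OF finite_Inv sub[OF w]] I by (simp add: len_def)
    then show ?thesis by (rule Sym_eqI[OF w(1) S])
  qed
  ultimately show ?thesis unfolding vperm_def V_def[symmetric] by (rule the_equality)
qed

lemma w0_explicit: "w0 n = (\<lambda>r. if r \<in> {1..n} then n + 1 - r else r)" (is "_ = ?w")
proof -
  have "bij_betw ?w {1..n} {1..n}"
    by (rule bij_betwI[where g = ?w]) auto
  then have S: "?w \<in> Sym n"
    unfolding Sym_def by (auto intro!: bij_imp_permutes)
  have I: "Inv n ?w = {(i, j). 1 \<le> i \<and> i < j \<and> j \<le> n}" (is "_ = ?I")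
    by (auto simp: Inv_def)
  have sub: "Inv n w \<subseteq> Inv n ?w" for w
    unfolding I by (auto simp: Inv_def)
  have "is_arg_max (len n) (\<lambda>w. w \<in> Sym n) ?w"
    unfolding is_arg_max_linorder len_def using S card_mono[OF finite_Inv sub] by blast
  moreover have "w = ?w" if "is_arg_max (len n) (\<lambda>w. w \<in> Sym n) w" for w
  proof -
    have w: "w \<in> Sym n" "len n ?w \<le> len n w"
      using that S unfolding is_arg_max_linorder by auto
    then have "Inv n w = Inv n ?w"
      using card_seteq[OF finite_Inv sub] by (simp add: len_def)
    then show ?thesis by (rule Sym_eqI[OF w(1) S])
  qed
  ultimately show ?thesis unfolding w0_def by (rule the_equality)
qed

lemma laurent_eval_superset:
  assumes "finite A" "Poly_Mapping.keys f \<subseteq> A" "h 0 = 0"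
  shows "laurent_eval h g f =
     (\<Sum>\<nu>\<in>A. h (Poly_Mapping.lookup f \<nu>) * (\<Prod>i\<in>Poly_Mapping.keys \<nu>. g i powi coord \<nu> i))"
  unfolding laurent_eval_def
  by (rule sum.mono_neutral_left) (use assms in \<open>simp_all add: in_keys_iff\<close>)

lemma laurent_eval_mult:
  assumes h0: "h 0 = 0" and ha: "\<And>a b. h (a + b) = h a + h b" and hm: "\<And>a b. h (a * b) = h a * h b"
    and g: "\<And>i. g i \<noteq> 0"
  shows "laurent_eval h g (a * b) = laurent_eval h g a * laurent_eval h g b"
proof -
  define m where "m = (\<lambda>\<nu>::expo. \<Prod>i\<in>Poly_Mapping.keys \<nu>. g i powi coord \<nu> i)"
  have msup: "m \<nu> = (\<Prod>i\<in>A. g i powi coord \<nu> i)" if "finite A" "Poly_Mapping.keys \<nu> \<subseteq> A" for \<nu> A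
    unfolding m_def by (rule prod.mono_neutral_left) (use that in \<open>auto simp: in_keys_iff\<close>)
  have madd: "m (\<mu> + \<nu>) = m \<mu> * m \<nu>" for \<mu> \<nu>
  proof -
    let ?A = "Poly_Mapping.keys \<mu> \<union> Poly_Mapping.keys \<nu>"
    have "m (\<mu> + \<nu>) = (\<Prod>i\<in>?A. g i powi coord (\<mu> + \<nu>) i)"
      by (rule msup) (use keys_add[of \<mu> \<nu>] in auto)
    also have "\<dots> = (\<Prod>i\<in>?A. g i powi coord \<mu> i * g i powi coord \<nu> i)"
      by (simp add: lookup_add power_int_add g)
    also have "\<dots> = m \<mu> * m \<nu>"
      by (simp add: prod.distrib msup[of ?A \<mu>] msup[of ?A \<nu>])
    finally show ?thesis .
  qed
  have add: "laurent_eval h g (a + b) = laurent_eval h g a + laurent_eval h g b" for a b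
  proof -
    let ?A = "Poly_Mapping.keys a \<union> Poly_Mapping.keys b"
    have "laurent_eval h g (a + b) =
      (\<Sum>\<nu>\<in>?A. h (Poly_Mapping.lookup (a + b) \<nu>) * m \<nu>)"
      unfolding m_def by (rule laurent_eval_superset) (use keys_add[of a b] h0 in auto)
    also have "\<dots> = laurent_eval h g a + laurent_eval h g b"
      by (simp add: laurent_eval_superset[of ?A] h0 m_def lookup_add ha algebra_simps sum.distrib)
    finally show ?thesis .
  qed
  have sing: "laurent_eval h g (Poly_Mapping.single \<nu> c) = h c * m \<nu>" for \<nu> c
    by (simp add: laurent_eval_def m_def h0)
  have zero: "laurent_eval h g 0 = 0" by (simp add: laurent_eval_def)
  have sum: "laurent_eval h g (sum F A) = (\<Sum>x\<in>A. laurent_eval h g (F x))" for F and A :: "'z set"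
    by (induction A rule: infinite_finite_induct) (auto simp: zero add)
  have decomp: "f = (\<Sum>\<nu>\<in>Poly_Mapping.keys f. Poly_Mapping.single \<nu> (Poly_Mapping.lookup f \<nu>))" for f :: laurent
    by (rule poly_mapping_eqI) (auto simp: lookup_sum lookup_single when_def in_keys_iff)
  have "a * b = (\<Sum>\<mu>\<in>Poly_Mapping.keys a. Poly_Mapping.single \<mu> (Poly_Mapping.lookup a \<mu>)) *
                (\<Sum>\<nu>\<in>Poly_Mapping.keys b. Poly_Mapping.single \<nu> (Poly_Mapping.lookup b \<nu>))"
    using decomp[of a] decomp[of b] by simp
  also have "\<dots> = (\<Sum>\<mu>\<in>Poly_Mapping.keys a. \<Sum>\<nu>\<in>Poly_Mapping.keys b.
      Poly_Mapping.single (\<mu> + \<nu>) (Poly_Mapping.lookup a \<mu> * Poly_Mapping.lookup b \<nu>))"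
    by (simp add: sum_product mult_single)
  finally have "laurent_eval h g (a * b) = (\<Sum>\<mu>\<in>Poly_Mapping.keys a. \<Sum>\<nu>\<in>Poly_Mapping.keys b.
      (h (Poly_Mapping.lookup a \<mu>) * m \<mu>) * (h (Poly_Mapping.lookup b \<nu>) * m \<nu>))"
    by (simp add: sum sing madd hm algebra_simps)
  also have "\<dots> = laurent_eval h g a * laurent_eval h g b"
    by (simp add: laurent_eval_def m_def sum_product)
  finally show ?thesis .
qed

lemma rat_eval_Fract:
  assumes "h 0 = 0" "\<And>a b. h (a + b) = h a + h b" "\<And>a b. h (a * b) = h a * h b"
    and "\<And>i. g i \<noteq> 0" and b: "laurent_eval h g b \<noteq> 0"
  shows "rat_eval h g (Fract a b) = laurent_eval h g a / laurent_eval h g b"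
  unfolding rat_eval_def
proof (rule the_equality)
  fix y assume "\<exists>c d. Fract a b = Fract c d \<and> laurent_eval h g d \<noteq> 0 \<and>
    y = laurent_eval h g c / laurent_eval h g d"
  then obtain c d where *: "Fract a b = Fract c d" "laurent_eval h g d \<noteq> 0"
    "y = laurent_eval h g c / laurent_eval h g d" by blast
  have "b \<noteq> 0" "d \<noteq> 0" using b *(2) by (auto simp: laurent_eval_def)
  then have "a * d = c * b" using *(1) by (simp add: eq_fract)
  then have "laurent_eval h g a * laurent_eval h g d = laurent_eval h g c * laurent_eval h g b"
    using laurent_eval_mult[of h g, OF assms(1-4)] by metis
  then show "y = laurent_eval h g a / laurent_eval h g b"
    using b *(2) unfolding *(3) by (metis frac_eq_eq)
qed (rule exI[of _ a], rule exI[of _ b], simp add: b)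

lemma const_hom:
  "const 0 = 0" "const (a + b) = const a + const b" "const (a * b) = const a * const b"
  by (simp_all add: const_def of_laurent_def single_add mult_single fract_collapse)

end

theory Submission
  imports Defs "HOL-Combinatorics.Multiset_Permutations"
begin

text \<open>
  Let \<open>T\<^sub>i\<close> be the Demazure--Lusztig operator occurring in (E2). The proposed coefficients
  are such that for \<open>\<mu>\<^sub>i > \<mu>\<^sub>i\<^sub>+\<^sub>1\<close> the two terms of the sum at \<open>\<mu>\<close> and \<open>s\<^sub>i\<mu>\<close> combine to a
  multiple of \<open>(T\<^sub>i + t)E\<^sub>\<mu>\<close> for \<open>P\<close> and of \<open>(T\<^sub>i - 1)E\<^sub>\<mu>\<close> for \<open>A\<close>. As \<open>E\<^sub>\<mu>\<close> is \<open>s\<^sub>i\<close>-invariant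
  when \<open>\<mu>\<^sub>i = \<mu>\<^sub>i\<^sub>+\<^sub>1\<close>, the first sum is symmetric, and the second one is an antisymmetric
  rational function times the prefactor of \<open>A\<close>. On the other hand (E2) shows that
  symmetrizing, respectively antisymmetrizing, \<open>E\<^sub>\<mu>\<close> gives the same result for all \<open>\<mu>\<close> in
  an orbit up to an explicit scalar. Hence both sides are proportional. For \<open>P\<close> the scalar
  is found by comparing a coefficient: the antidominant weight is maximal in its orbit in
  the Bruhat order, with respect to which \<open>E\<^sub>\<mu>\<close> is unitriangular. For \<open>A\<close> it is found
  because the symmetrization of the kernel is a constant, independent of whether it is
  evaluated at the variables or at the spectral vector.
\<close>

section \<open>Laurent polynomials and substitutions\<close>

text \<open>The family \<open>E\<close> is known only through (E0)-(E3), not as eigenvectors of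
  Cherednik operators. Every property of it is therefore carried along the rotation of (E1), the
  exchange of (E2) and the shift of (E3). Since (E2) is silent when \<mu>_i = \<mu>_(i+1), the
  invariance in that case is the hard input. Proportionality comes from applying one symmetrizer to
  a sum in two ways: its symmetry turns the symmetrizer into multiplication by a constant, nonzero
  because t is not a root of unity, while term by term everything becomes a multiple of the
  symmetrization of the dominant E. The normalization by W_lambda then leaves a single coefficient
  to check for P. A has no such normalization, so its scalar must be exact: at each weight,
  inversions contribute through the coefficient of the sum and noninversions through the
  antisymmetrization of E_\<mu>, and together they give one kernel factor for every pair.\<close>

lemma of_laurent_hom [simp]:
  "of_laurent 0 = 0" "of_laurent 1 = 1"
  "of_laurent (f + g) = of_laurent f + of_laurent g"
  "of_laurent (f * g) = of_laurent f * of_laurent g"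
  "of_laurent (- f) = - of_laurent f"
  "of_laurent (f - g) = of_laurent f - of_laurent g"
  by (simp_all add: of_laurent_def fract_collapse)

lemma of_laurent_eq_iff [simp]: "of_laurent f = of_laurent g \<longleftrightarrow> f = g"
  by (simp add: of_laurent_def eq_fract)

lemma of_laurent_sum: "of_laurent (sum f A) = (\<Sum>x\<in>A. of_laurent (f x))"
  by (induction A rule: infinite_finite_induct) auto

lemma Fract_of_laurent: "b \<noteq> 0 \<Longrightarrow> Fract a b = of_laurent a / of_laurent b"
  by (simp add: of_laurent_def)

lemma const_1 [simp]: "const 1 = 1"
  by (simp add: const_def single_one)

lemma const_0 [simp]: "const 0 = 0"
  by (rule const_hom)

lemma const_add: "const (a + b) = const a + const b"
  by (rule const_hom)

lemma const_mult: "const (a * b) = const a * const b"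
  by (rule const_hom)

lemma const_uminus: "const (- a) = - const a"
  by (simp add: const_def single_uminus)

lemma const_diff: "const (a - b) = const a - const b"
  by (simp add: const_def single_diff)

lemma const_eq_iff [simp]: "const a = const b \<longleftrightarrow> a = b"
  by (metis const_def of_laurent_eq_iff lookup_single_eq)

lemma const_eq_0_iff [simp]: "const a = 0 \<longleftrightarrow> a = 0"
  using const_eq_iff[of a 0] by simp

lemma const_inverse: "const (inverse a) = inverse (const a)"
proof (cases "a = 0")
  case False
  then have "const a * const (inverse a) = 1"
    by (simp flip: const_mult)
  then show ?thesis
    by (simp add: inverse_unique)
qed simp

lemma const_divide: "const (a / b) = const a / const b"
  by (simp add: divide_inverse const_mult const_inverse)

lemma const_power: "const (a ^ k) = const a ^ k"
  by (induction k) (auto simp: const_mult)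

lemma const_sum: "const (sum f A) = (\<Sum>x\<in>A. const (f x))"
  by (induction A rule: infinite_finite_induct) (auto simp: const_add)

lemma const_prod: "const (prod f A) = (\<Prod>x\<in>A. const (f x))"
  by (induction A rule: infinite_finite_induct) (auto simp: const_mult)

definition xmon :: "expo \<Rightarrow> ratfun" where
  "xmon \<nu> = of_laurent (Poly_Mapping.single \<nu> 1)"

lemma xmon_0 [simp]: "xmon 0 = 1"
  by (simp add: xmon_def single_one)

lemma xmon_add: "xmon (\<mu> + \<nu>) = xmon \<mu> * xmon \<nu>"
  by (simp add: xmon_def mult_single flip: of_laurent_hom)

lemma xmon_nonzero [simp]: "xmon \<nu> \<noteq> 0"
proof -
  have "Poly_Mapping.single \<nu> (1::K) \<noteq> 0"
    by (metis lookup_single_eq lookup_zero zero_neq_one)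
  then show ?thesis
    using of_laurent_eq_iff[of "Poly_Mapping.single \<nu> 1" 0]
    by (simp add: xmon_def del: of_laurent_eq_iff)
qed

lemma xmon_sum: "xmon (sum f A) = (\<Prod>x\<in>A. xmon (f x))"
  by (induction A rule: infinite_finite_induct) (auto simp: xmon_add)

lemma xmon_uminus: "xmon (- \<nu>) = inverse (xmon \<nu>)"
  using xmon_add[of "\<nu>" "- \<nu>"] by (simp add: inverse_unique)

lemma xmon_single_1: "xmon (Poly_Mapping.single i 1) = X i"
  by (simp add: xmon_def X_def)

lemma X_nonzero [simp]: "X i \<noteq> 0"
  by (rule xmon_nonzero[of "Poly_Mapping.single i 1", unfolded xmon_single_1])

lemma X_eq_iff [simp]: "X i = X j \<longleftrightarrow> i = j"
proof
  assume "X i = X j"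
  then have "(Poly_Mapping.single (Poly_Mapping.single i 1) 1 :: laurent) =
      Poly_Mapping.single (Poly_Mapping.single j 1) 1"
    by (simp add: X_def)
  then have "Poly_Mapping.keys (Poly_Mapping.single (Poly_Mapping.single i 1) 1 :: laurent) =
      Poly_Mapping.keys (Poly_Mapping.single (Poly_Mapping.single j 1) 1 :: laurent)"
    by simp
  then have "Poly_Mapping.keys (Poly_Mapping.single i (1::int)) = Poly_Mapping.keys (Poly_Mapping.single j (1::int))"
    by simp
  then show "i = j" by simp
qed simp

lemma xmon_single: "xmon (Poly_Mapping.single i k) = X i powi k"
proof -
  have nat: "xmon (Poly_Mapping.single i (int m)) = X i ^ m" for m
  proof (induction m)
    case (Suc m)
    have "Poly_Mapping.single i (int (Suc m)) = Poly_Mapping.single i 1 + Poly_Mapping.single i (int m)"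
      by (simp flip: single_add)
    then show ?case by (simp add: xmon_add xmon_single_1 Suc del: of_nat_Suc)
  qed simp
  show ?thesis
  proof (cases "k \<ge> 0")
    case True
    then show ?thesis using nat[of "nat k"] by (simp add: power_int_def)
  next
    case False
    then have "Poly_Mapping.single i k = - Poly_Mapping.single i (int (nat (- k)))"
      by (simp flip: single_uminus)
    then show ?thesis using False nat[of "nat (- k)"]
      by (simp add: xmon_uminus power_int_def power_inverse)
  qed
qed

lemma single_eq_const_xmon: "of_laurent (Poly_Mapping.single \<nu> c) = const c * xmon \<nu>"
  by (simp add: const_def xmon_def mult_single flip: of_laurent_hom)

lemma poly_mapping_expand:
  "f = (\<Sum>\<nu>\<in>Poly_Mapping.keys f. Poly_Mapping.single \<nu> (Poly_Mapping.lookup f \<nu>))"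
  by (rule poly_mapping_eqI) (auto simp: lookup_sum lookup_single when_def in_keys_iff)

section \<open>Substitution homomorphisms on rational functions\<close>

locale substitution =
  fixes h :: "K \<Rightarrow> 'b::field" and g :: "nat \<Rightarrow> 'b"
  assumes h_0: "h 0 = 0" and h_1: "h 1 = 1"
    and h_add: "\<And>a b. h (a + b) = h a + h b" and h_mult: "\<And>a b. h (a * b) = h a * h b"
    and g_nonzero: "\<And>i. g i \<noteq> 0"
begin

lemma leval_mult: "laurent_eval h g (a * b) = laurent_eval h g a * laurent_eval h g b"
  by (rule laurent_eval_mult[OF h_0 h_add h_mult g_nonzero])

lemma leval_0: "laurent_eval h g 0 = 0"
  by (simp add: laurent_eval_def)

lemma leval_add: "laurent_eval h g (a + b) = laurent_eval h g a + laurent_eval h g b"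
proof -
  let ?A = "Poly_Mapping.keys a \<union> Poly_Mapping.keys b"
  have "laurent_eval h g (a + b) = (\<Sum>\<nu>\<in>?A. h (Poly_Mapping.lookup (a + b) \<nu>) *
      (\<Prod>i\<in>Poly_Mapping.keys \<nu>. g i powi coord \<nu> i))"
    by (rule laurent_eval_superset) (use keys_add[of a b] h_0 in auto)
  also have "\<dots> = laurent_eval h g a + laurent_eval h g b"
    by (simp add: laurent_eval_superset[of ?A] h_0 lookup_add h_add algebra_simps sum.distrib)
  finally show ?thesis .
qed

lemma leval_single:
  "laurent_eval h g (Poly_Mapping.single \<nu> c) = h c * (\<Prod>i\<in>Poly_Mapping.keys \<nu>. g i powi coord \<nu> i)"
  by (simp add: laurent_eval_def h_0)

lemma leval_1: "laurent_eval h g 1 = 1"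
  using leval_single[of 0 1] by (simp add: h_1 single_one)

lemma leval_uminus: "laurent_eval h g (- a) = - laurent_eval h g a"
  using leval_add[of a "- a"] by (simp add: leval_0 eq_neg_iff_add_eq_0 add.commute)

text \<open>Graph of \<open>rat_eval\<close>. As a relation it is closed under the field operations
  step by step, so definedness has to be argued only where an inverse is taken;
  \<open>rat_eval_eqI\<close> returns to the definite description.\<close>

definition evaluates :: "ratfun \<Rightarrow> 'b \<Rightarrow> bool" where
  "evaluates z y \<longleftrightarrow> (\<exists>a b. z = Fract a b \<and> laurent_eval h g b \<noteq> 0 \<and>
     y = laurent_eval h g a / laurent_eval h g b)"

lemma rat_eval_eqI: "evaluates z y \<Longrightarrow> rat_eval h g z = y"
  unfolding evaluates_def using rat_eval_Fract[of h g, OF h_0 h_add h_mult g_nonzero] by blast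

lemma evaluates_of_laurent: "evaluates (of_laurent f) (laurent_eval h g f)"
  unfolding evaluates_def of_laurent_def by (rule exI[of _ f], rule exI[of _ 1]) (simp add: leval_1)

lemma rat_eval_of_laurent: "rat_eval h g (of_laurent f) = laurent_eval h g f"
  by (rule rat_eval_eqI[OF evaluates_of_laurent])

lemma evaluates_const: "evaluates (const c) (h c)"
  using evaluates_of_laurent[of "Poly_Mapping.single 0 c"] by (simp add: leval_single const_def)

lemma evaluates_X: "evaluates (X i) (g i)"
  using evaluates_of_laurent[of "Poly_Mapping.single (Poly_Mapping.single i 1) 1"]
  by (simp add: leval_single X_def h_1)

lemma evaluates_1: "evaluates 1 1"
  using evaluates_const[of 1] by (simp add: h_1)

lemma evaluates_add:
  assumes "evaluates z y" "evaluates z' y'"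
  shows "evaluates (z + z') (y + y')"
proof -
  obtain a b a' b' where *: "z = Fract a b" "laurent_eval h g b \<noteq> 0" "y = laurent_eval h g a / laurent_eval h g b"
    "z' = Fract a' b'" "laurent_eval h g b' \<noteq> 0" "y' = laurent_eval h g a' / laurent_eval h g b'"
    using assms unfolding evaluates_def by blast
  then have "b \<noteq> 0" "b' \<noteq> 0" by (auto simp: leval_0)
  then have "z + z' = Fract (a * b' + a' * b) (b * b')" using * by simp
  then show ?thesis
    unfolding evaluates_def using *
    by (intro exI[of _ "a * b' + a' * b"] exI[of _ "b * b'"])
       (simp add: leval_mult leval_add add_frac_eq)
qed

lemma evaluates_mult:
  assumes "evaluates z y" "evaluates z' y'"
  shows "evaluates (z * z') (y * y')"
proof -
  obtain a b a' b' where *: "z = Fract a b" "laurent_eval h g b \<noteq> 0" "y = laurent_eval h g a / laurent_eval h g b"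
    "z' = Fract a' b'" "laurent_eval h g b' \<noteq> 0" "y' = laurent_eval h g a' / laurent_eval h g b'"
    using assms unfolding evaluates_def by blast
  then have "z * z' = Fract (a * a') (b * b')" by simp
  then show ?thesis
    unfolding evaluates_def using *
    by (intro exI[of _ "a * a'"] exI[of _ "b * b'"]) (simp add: leval_mult)
qed

lemma evaluates_uminus: "evaluates z y \<Longrightarrow> evaluates (- z) (- y)"
  using evaluates_mult[OF evaluates_of_laurent[of "- 1"], of z y]
  by (simp add: leval_uminus leval_1)

lemma evaluates_diff: "evaluates z y \<Longrightarrow> evaluates z' y' \<Longrightarrow> evaluates (z - z') (y - y')"
  using evaluates_add[of z y "- z'" "- y'"] evaluates_uminus by simp

lemma evaluates_inverse:
  assumes "evaluates z y" "y \<noteq> 0"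
  shows "evaluates (inverse z) (inverse y)"
proof -
  obtain a b where "z = Fract a b" "laurent_eval h g b \<noteq> 0" "y = laurent_eval h g a / laurent_eval h g b"
    using assms unfolding evaluates_def by blast
  then show ?thesis
    unfolding evaluates_def using assms(2)
    by (intro exI[of _ b] exI[of _ a]) simp
qed

lemma evaluates_divide:
  "evaluates z y \<Longrightarrow> evaluates z' y' \<Longrightarrow> y' \<noteq> 0 \<Longrightarrow> evaluates (z / z') (y / y')"
  using evaluates_mult[OF _ evaluates_inverse, of z y z' y'] by (simp add: divide_inverse)

lemma evaluates_prod:
  "(\<And>x. x \<in> A \<Longrightarrow> evaluates (f x) (f' x)) \<Longrightarrow> evaluates (prod f A) (prod f' A)"
  by (induction A rule: infinite_finite_induct) (auto simp: evaluates_1 evaluates_mult)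

end

section \<open>The action of the symmetric group\<close>

lemma Sym_permutes: "w \<in> Sym n \<Longrightarrow> w permutes {1..n}"
  by (simp add: Sym_def)

lemma finite_Sym [simp]: "finite (Sym n)"
  by (simp add: Sym_def finite_permutations)

lemma id_Sym [simp]: "id \<in> Sym n"
  by (simp add: Sym_def permutes_id)

lemma Sym_comp: "w \<in> Sym n \<Longrightarrow> u \<in> Sym n \<Longrightarrow> w \<circ> u \<in> Sym n"
  by (auto simp: Sym_def intro: permutes_compose)

lemma Sym_inv: "w \<in> Sym n \<Longrightarrow> inv w \<in> Sym n"
  by (auto simp: Sym_def intro: permutes_inv)

lemma Sym_inv_simps:
  assumes "w \<in> Sym n"
  shows "w (inv w k) = k" "inv w (w k) = k" "w \<circ> inv w = id" "inv w \<circ> w = id" "inv (inv w) = w"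
  using permutes_inverses[OF Sym_permutes[OF assms]] permutes_inv_o[OF Sym_permutes[OF assms]]
    permutes_inv_inv[OF Sym_permutes[OF assms]] by auto

lemma Sym_in_range: "w \<in> Sym n \<Longrightarrow> w i \<in> {1..n} \<longleftrightarrow> i \<in> {1..n}"
  by (rule permutes_in_image[OF Sym_permutes])

lemma Sym_eq_iff: "w \<in> Sym n \<Longrightarrow> w i = w j \<longleftrightarrow> i = j"
  by (metis Sym_inv_simps(2))

lemma coord_act_inv: "w \<in> Sym n \<Longrightarrow> coord (act w \<mu>) k = coord \<mu> (inv w k)"
  using coord_act[of w n \<mu> "inv w k"] by (simp add: Sym_inv_simps)

lemma act_id [simp]: "act id \<mu> = \<mu>"
  by (rule poly_mapping_eqI) (simp add: coord_act_inv[of id 0])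

lemma act_comp: "w \<in> Sym n \<Longrightarrow> u \<in> Sym n \<Longrightarrow> act (w \<circ> u) \<mu> = act w (act u \<mu>)"
  by (rule poly_mapping_eqI)
     (simp add: coord_act_inv[of _ n] Sym_comp o_inv_distrib permutes_bij[OF Sym_permutes])

lemma act_inv_act: "w \<in> Sym n \<Longrightarrow> act (inv w) (act w \<mu>) = \<mu>"
  by (simp add: Sym_inv Sym_inv_simps flip: act_comp[of _ n])

lemma act_act_inv: "w \<in> Sym n \<Longrightarrow> act w (act (inv w) \<mu>) = \<mu>"
  by (simp add: Sym_inv Sym_inv_simps flip: act_comp[of _ n])

lemma Zn_iff: "\<mu> \<in> Zn n \<longleftrightarrow> (\<forall>k. k \<notin> {1..n} \<longrightarrow> coord \<mu> k = 0)"
  unfolding Zn_def by (auto simp: in_keys_iff subset_iff)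

lemma Zn_eqI:
  assumes "\<mu> \<in> Zn n" "\<nu> \<in> Zn n" "\<And>i. i \<in> {1..n} \<Longrightarrow> coord \<mu> i = coord \<nu> i"
  shows "\<mu> = \<nu>"
proof (rule poly_mapping_eqI)
  fix k
  show "coord \<mu> k = coord \<nu> k"
    using assms by (cases "k \<in> {1..n}") (simp_all add: Zn_iff del: atLeastAtMost_iff)
qed

lemma zero_Zn [simp]: "0 \<in> Zn n"
  by (simp add: Zn_iff)

lemma act_Zn:
  assumes "w \<in> Sym n"
  shows "act w \<mu> \<in> Zn n \<longleftrightarrow> \<mu> \<in> Zn n"
proof -
  have "act w \<mu> \<in> Zn n" if "w \<in> Sym n" "\<mu> \<in> Zn n" for w \<mu>
    using that Sym_in_range[OF Sym_inv[OF that(1)]] unfolding Zn_iff coord_act_inv[OF that(1)] by blast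
  then show ?thesis
    using assms Sym_inv act_inv_act by metis
qed

lemma coord_vec: "coord (vec n f) i = (if i \<in> {1..n} then f i else 0)"
  by (simp add: vec_def lookup_sum lookup_single when_def)

lemma vec_Zn [simp]: "vec n f \<in> Zn n"
  by (simp add: Zn_iff coord_vec)

section \<open>Permutations of the variables as field automorphisms\<close>

definition permL :: "(nat \<Rightarrow> nat) \<Rightarrow> laurent \<Rightarrow> laurent" where
  "permL w f = (\<Sum>\<nu>\<in>Poly_Mapping.keys f. Poly_Mapping.single (act w \<nu>) (Poly_Mapping.lookup f \<nu>))"

lemma lookup_permL:
  assumes "w \<in> Sym n"
  shows "Poly_Mapping.lookup (permL w f) \<kappa> = Poly_Mapping.lookup f (act (inv w) \<kappa>)"
proof -
  have "act w \<nu> = \<kappa> \<longleftrightarrow> \<nu> = act (inv w) \<kappa>" for \<nu>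
    using act_inv_act[OF assms] act_act_inv[OF assms] by metis
  then show ?thesis
    by (simp add: permL_def lookup_sum lookup_single when_def in_keys_iff)
qed

lemma xmon_act: "xmon (act w \<nu>) = (\<Prod>i\<in>Poly_Mapping.keys \<nu>. X (w i) powi coord \<nu> i)"
  by (simp add: act_def xmon_sum xmon_single)

lemma xmon_expand: "xmon \<nu> = (\<Prod>i\<in>Poly_Mapping.keys \<nu>. X i powi coord \<nu> i)"
  using xmon_act[of id \<nu>] by simp

lemma laurent_eval_actX: "laurent_eval const (\<lambda>i. X (w i)) f = of_laurent (permL w f)"
  by (simp add: laurent_eval_def permL_def of_laurent_sum single_eq_const_xmon xmon_act)

lemma permL_eq_0_iff:
  assumes "w \<in> Sym n"
  shows "permL w f = 0 \<longleftrightarrow> f = 0"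
proof
  assume 0: "permL w f = 0"
  have "Poly_Mapping.lookup f \<nu> = 0" for \<nu>
    using lookup_permL[OF assms, of f "act w \<nu>"] by (simp add: 0 act_inv_act[OF assms])
  then show "f = 0" by (simp add: poly_mapping_eqI)
qed (simp add: permL_def)

interpretation actX: substitution const "\<lambda>i. X (w i)" for w
  by unfold_locales (auto simp: const_add const_mult)

lemma actX_of_laurent: "actX w (of_laurent f) = of_laurent (permL w f)"
  by (simp add: actX_def actX.rat_eval_of_laurent laurent_eval_actX)

text \<open>A permutation of the variables sends no nonzero denominator to 0, so
  \<open>actX w\<close> is defined on all rational functions. The homomorphism laws below rest on
  this.\<close>

lemma evaluates_actX:
  assumes "w \<in> Sym n"
  shows "actX.evaluates w z (actX w z)"
proof -
  obtain a b where z: "z = Fract a b" "b \<noteq> 0" by (cases z) auto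
  then have "laurent_eval const (\<lambda>i. X (w i)) b \<noteq> 0"
    using permL_eq_0_iff[OF assms, of b] of_laurent_eq_iff[of "permL w b" 0]
    by (simp add: laurent_eval_actX del: of_laurent_eq_iff)
  then have "actX.evaluates w z (laurent_eval const (\<lambda>i. X (w i)) a / laurent_eval const (\<lambda>i. X (w i)) b)"
    using z unfolding actX.evaluates_def by blast
  then show ?thesis
    using actX.rat_eval_eqI unfolding actX_def by metis
qed

lemma actX_eqI: "actX.evaluates w z y \<Longrightarrow> actX w z = y"
  unfolding actX_def by (rule actX.rat_eval_eqI)

lemma actX_const [simp]: "actX w (const c) = const c"
  by (rule actX_eqI) (rule actX.evaluates_const)

lemma actX_X [simp]: "actX w (X i) = X (w i)"
  by (rule actX_eqI) (rule actX.evaluates_X)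

lemma actX_0 [simp]: "actX w 0 = 0"
  using actX_const[of w 0] by simp

lemma actX_1 [simp]: "actX w 1 = 1"
  using actX_const[of w 1] by simp

lemma actX_id [simp]: "actX id z = z"
proof -
  have P: "permL id f = f" for f
    by (rule poly_mapping_eqI) (simp add: lookup_permL[of id 0])
  obtain a b where z: "z = Fract a b" "b \<noteq> 0" by (cases z) auto
  have "of_laurent b \<noteq> 0"
    using z(2) of_laurent_eq_iff[of b 0] by (simp del: of_laurent_eq_iff)
  then have "actX.evaluates id z z"
    unfolding actX.evaluates_def laurent_eval_actX P
    using z by (intro exI[of _ a] exI[of _ b]) (simp add: Fract_of_laurent)
  then show ?thesis by (rule actX_eqI)
qed

context
  fixes w :: "nat \<Rightarrow> nat" and n :: nat
  assumes w: "w \<in> Sym n"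
begin

lemma actX_add: "actX w (y + z) = actX w y + actX w z"
  by (intro actX_eqI actX.evaluates_add evaluates_actX[OF w])

lemma actX_diff: "actX w (y - z) = actX w y - actX w z"
  by (intro actX_eqI actX.evaluates_diff evaluates_actX[OF w])

lemma actX_uminus: "actX w (- z) = - actX w z"
  by (intro actX_eqI actX.evaluates_uminus evaluates_actX[OF w])

lemma actX_mult: "actX w (y * z) = actX w y * actX w z"
  by (intro actX_eqI actX.evaluates_mult evaluates_actX[OF w])

lemma actX_inverse: "actX w (inverse z) = inverse (actX w z)"
proof (cases "z = 0")
  case False
  then have "actX w (inverse z) * actX w z = 1"
    by (simp flip: actX_mult)
  then show ?thesis by (metis inverse_unique mult.commute)
qed simp

lemma actX_divide: "actX w (y / z) = actX w y / actX w z"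
  by (simp add: divide_inverse actX_mult actX_inverse)

lemma actX_sum: "actX w (sum f A) = (\<Sum>x\<in>A. actX w (f x))"
  by (induction A rule: infinite_finite_induct) (auto simp: actX_add)

lemma actX_prod: "actX w (prod f A) = (\<Prod>x\<in>A. actX w (f x))"
  by (induction A rule: infinite_finite_induct) (auto simp: actX_mult)

end

lemma actX_comp:
  assumes w: "w \<in> Sym n" and u: "u \<in> Sym n"
  shows "actX w (actX u z) = actX (w \<circ> u) z"
proof -
  have P: "permL w (permL u f) = permL (w \<circ> u) f" for f
  proof (rule poly_mapping_eqI)
    fix \<kappa>
    have "act (inv (w \<circ> u)) \<kappa> = act (inv u) (act (inv w) \<kappa>)"
      using w u by (simp add: o_inv_distrib permutes_bij[OF Sym_permutes] Sym_inv act_comp[of _ n])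
    then show "Poly_Mapping.lookup (permL w (permL u f)) \<kappa> = Poly_Mapping.lookup (permL (w \<circ> u) f) \<kappa>"
      by (simp add: lookup_permL[OF w] lookup_permL[OF u] lookup_permL[OF Sym_comp[OF w u]])
  qed
  obtain a b where "z = Fract a b" "b \<noteq> 0" by (cases z) auto
  then have "z = of_laurent a / of_laurent b" by (simp add: Fract_of_laurent)
  then show ?thesis
    by (simp add: actX_divide[OF w] actX_divide[OF u] actX_divide[OF Sym_comp[OF w u]] actX_of_laurent P)
qed

lemma adj_Sym: "1 \<le> i \<Longrightarrow> i < n \<Longrightarrow> transpose i (Suc i) \<in> Sym n"
  by (auto simp: Sym_def intro!: permutes_swap_id)

section \<open>Inversions, orbits and minimal coset representatives\<close>

abbreviation adj :: "nat \<Rightarrow> nat \<Rightarrow> nat" where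
  "adj i \<equiv> transpose i (Suc i)"

lemma adj_comp_adj [simp]: "adj i \<circ> adj i = id"
  by (rule transpose_comp_involutory)

lemma inv_adj [simp]: "inv (adj i) = adj i"
  by (rule inv_transpose_eq)

lemma finite_pairs [simp]: "finite (pairs n)"
  by (rule finite_subset[of _ "{1..n} \<times> {1..n}"]) (auto simp: pairs_def)

text \<open>The simple reflection permutes the positive roots other than its own. Products and
  counts over \<open>pairs n\<close> are updated through this bijection throughout.\<close>

lemma bij_betw_adj_pairs:
  assumes "1 \<le> i" "i < n"
  shows "bij_betw (map_prod (adj i) (adj i)) (pairs n - {(i, Suc i)}) (pairs n - {(i, Suc i)})"
proof -
  have "map_prod (adj i) (adj i) p \<in> pairs n - {(i, Suc i)}" if "p \<in> pairs n - {(i, Suc i)}" for p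
    using assms that
    by (cases p; cases "fst p = i"; cases "fst p = Suc i"; cases "snd p = i"; cases "snd p = Suc i")
       (auto simp: pairs_def transpose_eq_iff)
  then show ?thesis
    by (intro bij_betwI[where g = "map_prod (adj i) (adj i)"]) auto
qed

lemma prod_pairs_adj:
  assumes "1 \<le> i" "i < n"
  shows "(\<Prod>(k, l)\<in>pairs n. F k l) =
    F i (Suc i) * (\<Prod>(k, l)\<in>pairs n - {(i, Suc i)}. F (adj i k) (adj i l))"
proof -
  have "(\<Prod>(k, l)\<in>pairs n. F k l) = F i (Suc i) * (\<Prod>(k, l)\<in>pairs n - {(i, Suc i)}. F k l)"
    using assms by (subst prod.remove[OF finite_pairs, of "(i, Suc i)"]) (auto simp: pairs_def)
  also have "(\<Prod>(k, l)\<in>pairs n - {(i, Suc i)}. F k l) =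
      (\<Prod>(k, l)\<in>pairs n - {(i, Suc i)}. F (adj i k) (adj i l))"
    by (subst prod.reindex_bij_betw[OF bij_betw_adj_pairs[OF assms], symmetric])
       (simp add: case_prod_beta)
  finally show ?thesis .
qed

lemma prod_pairs_remove:
  assumes "1 \<le> i" "i < n"
  shows "(\<Prod>(k, l)\<in>pairs n. F k l) = F i (Suc i) * (\<Prod>(k, l)\<in>pairs n - {(i, Suc i)}. F k l)"
  using assms by (subst prod.remove[OF finite_pairs, of "(i, Suc i)"]) (auto simp: pairs_def)

text \<open>Common source of the change of length by one under a simple reflection and of the
  decrease of the measures in the inductions on ascending or descending pairs.\<close>

lemma card_pairs_adj:
  assumes "1 \<le> i" "i < n" "R i (Suc i)" "\<not> R' i (Suc i)"
    and "\<And>k l. (k, l) \<in> pairs n \<Longrightarrow> (k, l) \<noteq> (i, Suc i) \<Longrightarrow> R' k l \<longleftrightarrow> R (adj i k) (adj i l)"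
  shows "card {(k, l) \<in> pairs n. R k l} = Suc (card {(k, l) \<in> pairs n. R' k l})"
proof -
  let ?S = "pairs n - {(i, Suc i)}"
  have "{(k, l) \<in> pairs n. R k l} = insert (i, Suc i) {p \<in> ?S. R (fst p) (snd p)}"
    using assms by (auto simp: pairs_def)
  then have "card {(k, l) \<in> pairs n. R k l} = Suc (card {p \<in> ?S. R (fst p) (snd p)})"
    by simp
  moreover have "bij_betw (map_prod (adj i) (adj i)) {p \<in> ?S. R' (fst p) (snd p)} {p \<in> ?S. R (fst p) (snd p)}"
    by (rule bij_betw_Collect[OF bij_betw_adj_pairs[OF assms(1,2)]]) (use assms(5) in auto)
  moreover have "{(k, l) \<in> pairs n. R' k l} = {p \<in> ?S. R' (fst p) (snd p)}"
    using assms(4) by auto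
  ultimately show ?thesis
    using bij_betw_same_card by fastforce
qed

lemma Inv_eq: "Inv n w = {(i, j) \<in> pairs n. w i > w j}"
  by (auto simp: Inv_def pairs_def)

lemma len_comp_adj_ascent:
  assumes "1 \<le> i" "i < n" "w i < w (Suc i)"
  shows "len n (w \<circ> adj i) = Suc (len n w)"
  unfolding len_def Inv_eq
  by (rule card_pairs_adj[OF assms(1,2)]) (use assms in auto)

lemma len_comp_adj_descent:
  assumes "1 \<le> i" "i < n" "w (Suc i) < w i"
  shows "len n w = Suc (len n (w \<circ> adj i))"
proof -
  have "w \<circ> adj i \<circ> adj i = w"
    by (simp add: comp_assoc)
  then show ?thesis
    using len_comp_adj_ascent[of i n "w \<circ> adj i"] assms by simp
qed

lemma mono_steps:
  fixes f :: "nat \<Rightarrow> 'a::order"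
  assumes "\<And>i. 1 \<le> i \<Longrightarrow> i < n \<Longrightarrow> f i \<le> f (Suc i)" "1 \<le> i" "i \<le> j" "j \<le> n"
  shows "f i \<le> f j"
  using assms(3,4)
proof (induction j rule: dec_induct)
  case (step j)
  then show ?case using assms(1)[of j] assms(2) by (auto intro: order_trans)
qed simp

text \<open>A permutation of positive length has a descent between neighbours. Only ascents are
  appended, so the length grows by exactly one in each step, which is what tracking signs
  requires.\<close>

lemma Sym_induct [consumes 1, case_names id adj]:
  assumes "w \<in> Sym n" "P id"
    and step: "\<And>w i. w \<in> Sym n \<Longrightarrow> 1 \<le> i \<Longrightarrow> i < n \<Longrightarrow> w i < w (Suc i) \<Longrightarrow> P w \<Longrightarrow> P (w \<circ> adj i)"
  shows "P w"
  using assms(1)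
proof (induction "len n w" arbitrary: w)
  case 0
  then have "Inv n w = Inv n id"
    by (auto simp: len_def) (auto simp: Inv_def)
  then have "w = id" by (rule Sym_eqI[OF 0(2) id_Sym])
  then show ?case using assms(2) by (simp only:)
next
  case (Suc k)
  have "\<exists>i. 1 \<le> i \<and> i < n \<and> w (Suc i) < w i"
  proof (rule ccontr)
    assume "\<not> ?thesis"
    then have *: "\<And>i. 1 \<le> i \<Longrightarrow> i < n \<Longrightarrow> w i \<le> w (Suc i)" by (meson not_le)
    have "w i \<le> w j" if "1 \<le> i" "i < j" "j \<le> n" for i j
      by (rule mono_steps[of n w i j]) (use * that in auto)
    then have "Inv n w = {}" by (fastforce simp: Inv_def)
    then show False using Suc(2) by (simp add: len_def)
  qed
  then obtain i where i: "1 \<le> i" "i < n" "w (Suc i) < w i" by blast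
  have S: "w \<circ> adj i \<in> Sym n" by (intro Sym_comp Suc adj_Sym i)
  have "P (w \<circ> adj i)"
    using Suc(2) len_comp_adj_descent[OF i] by (intro Suc(1) S) auto
  then have "P (w \<circ> adj i \<circ> adj i)"
    by (rule step[OF S i(1,2), rotated]) (use i in auto)
  then show ?case by (simp add: comp_assoc)
qed

section \<open>Sorting permutations\<close>

lemma
  shows vperm_Sym: "vperm n \<mu> \<in> Sym n"
    and vperm_less: "\<And>i j. i \<in> {1..n} \<Longrightarrow> j \<in> {1..n} \<Longrightarrow>
      vperm n \<mu> i < vperm n \<mu> j \<longleftrightarrow> coord \<mu> i < coord \<mu> j \<or> coord \<mu> i = coord \<mu> j \<and> i < j"
proof -
  define V where "V = vperm n \<mu>"
  \<comment> \<open>\<open>V r\<close> is the rank of \<open>r\<close> when positions are ordered by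
    value and ties are broken by position; everything below is read off this total order.\<close>
  define B where "B = (\<lambda>r. {r' \<in> {1..n}. coord \<mu> r' < coord \<mu> r \<or> coord \<mu> r' = coord \<mu> r \<and> r' < r})"
  have v: "V r = 1 + card (B r)" if "r \<in> {1..n}" for r
  proof -
    have "B r = {r' \<in> {1..<r}. coord \<mu> r' \<le> coord \<mu> r} \<union> {r' \<in> {r<..n}. coord \<mu> r' < coord \<mu> r}"
    proof (rule set_eqI)
      fix x
      show "x \<in> B r \<longleftrightarrow> x \<in> {r' \<in> {1..<r}. coord \<mu> r' \<le> coord \<mu> r} \<union> {r' \<in> {r<..n}. coord \<mu> r' < coord \<mu> r}"
        using that by (cases x r rule: linorder_cases) (auto simp: B_def)
    qed
    then have "card (B r) = card {r' \<in> {1..<r}. coord \<mu> r' \<le> coord \<mu> r}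
                          + card {r' \<in> {r<..n}. coord \<mu> r' < coord \<mu> r}"
      by (simp add: card_Un_disjoint disjoint_iff)
    then show ?thesis using that by (simp add: V_def vperm_explicit)
  qed
  have mono: "V i < V j"
    if "i \<in> {1..n}" "j \<in> {1..n}" "coord \<mu> i < coord \<mu> j \<or> coord \<mu> i = coord \<mu> j \<and> i < j" for i j
  proof -
    have "B i \<subset> B j" using that by (force simp: B_def)
    then have "card (B i) < card (B j)" by (intro psubset_card_mono) (auto simp: B_def)
    then show ?thesis using v that by simp
  qed
  show less: "vperm n \<mu> i < vperm n \<mu> j \<longleftrightarrow> coord \<mu> i < coord \<mu> j \<or> coord \<mu> i = coord \<mu> j \<and> i < j"
    if "i \<in> {1..n}" "j \<in> {1..n}" for i j
  proof (cases "coord \<mu> i < coord \<mu> j \<or> coord \<mu> i = coord \<mu> j \<and> i < j")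
    case True
    then show ?thesis using mono[OF that] by (simp add: V_def)
  next
    case False
    then have "i = j \<or> coord \<mu> j < coord \<mu> i \<or> coord \<mu> j = coord \<mu> i \<and> j < i" by linarith
    then have "\<not> V i < V j" using mono[OF that(2,1)] by fastforce
    then show ?thesis using False by (simp add: V_def)
  qed
  have "inj_on V {1..n}"
    using less unfolding V_def by (intro linorder_inj_onI') (metis less_irrefl linorder_neqE)
  moreover have "V ` {1..n} \<subseteq> {1..n}"
  proof safe
    fix r assume r: "r \<in> {1..n}"
    have "B r \<subseteq> {1..n} - {r}" by (auto simp: B_def)
    then have "card (B r) \<le> card ({1..n} - {r})" by (intro card_mono) auto
    also have "\<dots> = n - 1" using r by simp
    finally show "V r \<in> {1..n}" using v[OF r] r by (simp, linarith)
  qed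
  ultimately have bij: "bij_betw V {1..n} {1..n}"
    by (simp add: bij_betw_def endo_inj_surj)
  have "V x = x" if "x \<notin> {1..n}" for x
    using that unfolding V_def vperm_explicit by (simp only: if_False)
  then show "vperm n \<mu> \<in> Sym n"
    using bij unfolding Sym_def V_def by (intro CollectI bij_imp_permutes)
qed

lemma Inv_vperm: "Inv n (vperm n \<mu>) = {(i, j) \<in> pairs n. coord \<mu> i > coord \<mu> j}"
proof (intro set_eqI, clarify)
  fix i j
  show "(i, j) \<in> Inv n (vperm n \<mu>) \<longleftrightarrow> (i, j) \<in> {(i, j) \<in> pairs n. coord \<mu> i > coord \<mu> j}"
    using vperm_less[of j n i \<mu>] by (auto simp: Inv_eq pairs_def)
qed

text \<open>For dominant \<mu> this singles out the minimal length representatives of the cosets of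
  the stabilizer; for arbitrary \<mu> it is the condition under which sorting commutes with
  \<open>w\<close>.\<close>

definition level_increasing :: "nat \<Rightarrow> expo \<Rightarrow> (nat \<Rightarrow> nat) \<Rightarrow> bool" where
  "level_increasing n \<mu> w \<longleftrightarrow> (\<forall>(i, j)\<in>pairs n. coord \<mu> i = coord \<mu> j \<longrightarrow> w i < w j)"

text \<open>Both sides have the same inversion set: values are transported by \<open>w\<close>, and
  tied positions keep their relative order.\<close>

lemma vperm_act_comp:
  assumes w: "w \<in> Sym n" and "level_increasing n \<mu> w"
  shows "vperm n (act w \<mu>) \<circ> w = vperm n \<mu>"
proof (rule Sym_eqI[OF Sym_comp[OF vperm_Sym w] vperm_Sym])
  show "Inv n (vperm n (act w \<mu>) \<circ> w) = Inv n (vperm n \<mu>)"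
    unfolding Inv_vperm
  proof (intro set_eqI, clarify)
    fix i j
    show "(i, j) \<in> Inv n (vperm n (act w \<mu>) \<circ> w) \<longleftrightarrow> (i, j) \<in> {(i, j) \<in> pairs n. coord \<mu> i > coord \<mu> j}"
    proof (cases "(i, j) \<in> pairs n")
      case True
      then have ij: "i \<in> {1..n}" "j \<in> {1..n}" by (auto simp: pairs_def)
      have "vperm n (act w \<mu>) (w j) < vperm n (act w \<mu>) (w i) \<longleftrightarrow> coord \<mu> j < coord \<mu> i"
        using assms(2) True ij Sym_in_range[OF w]
        by (subst vperm_less) (auto simp: coord_act[OF w] level_increasing_def)
      then show ?thesis using True by (simp add: Inv_eq)
    qed (auto simp: Inv_eq)
  qed
qed

lemma coord_act_adj: "coord (act (adj i) \<mu>) k = coord \<mu> (adj i k)"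
proof -
  have "adj i j = k \<longleftrightarrow> j = adj i k" for j
    by (metis transpose_involutory)
  then show ?thesis
    by (simp add: act_def lookup_sum lookup_single when_def in_keys_iff)
qed

lemma vperm_act_adj:
  assumes "1 \<le> i" "i < n" "coord \<mu> i \<noteq> coord \<mu> (Suc i)"
  shows "vperm n (act (adj i) \<mu>) (adj i k) = vperm n \<mu> k"
proof -
  have "level_increasing n \<mu> (adj i)"
    using assms by (auto simp: level_increasing_def pairs_def transpose_def)
  from vperm_act_comp[OF adj_Sym[OF assms(1,2)] this] show ?thesis
    by (metis comp_apply)
qed

text \<open>No position lies between two equal neighbours in the sorting order. This is the origin
  of the factor t in \<open>yv_Suc\<close>.\<close>

lemma vperm_Suc_eq:
  assumes "1 \<le> i" "i < n" "coord \<mu> i = coord \<mu> (Suc i)"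
  shows "vperm n \<mu> (Suc i) = Suc (vperm n \<mu> i)"
proof -
  have gt: "i < x \<longleftrightarrow> x = Suc i \<or> Suc i < x" for x by auto
  have "{r' \<in> {1..<Suc i}. coord \<mu> r' \<le> coord \<mu> (Suc i)} = insert i {r' \<in> {1..<i}. coord \<mu> r' \<le> coord \<mu> i}"
    "{r' \<in> {Suc i<..n}. coord \<mu> r' < coord \<mu> (Suc i)} = {r' \<in> {i<..n}. coord \<mu> r' < coord \<mu> i}"
    using assms by (auto simp: less_Suc_eq gt)
  then show ?thesis using assms by (simp add: vperm_explicit)
qed

lemma weakly_increasing_unique:
  assumes "\<mu> \<in> Zn n" "w \<in> Sym n" "weakly_increasing n \<mu>" "weakly_increasing n (act w \<mu>)"
  shows "act w \<mu> = \<mu>"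
proof (rule Zn_eqI)
  fix r assume r: "r \<in> {1..n}"
  \<comment> \<open>An integer is determined by its upper bounds. The sublevel sets of the two
    weights are initial segments of {1..n}, and they have equal size because \<open>w\<close> maps
    one onto the other.\<close>
  have "coord (act w \<mu>) r \<le> m \<longleftrightarrow> coord \<mu> r \<le> m" for m
  proof -
    define A where "A = {r \<in> {1..n}. coord \<mu> r \<le> m}"
    define B where "B = {r \<in> {1..n}. coord (act w \<mu>) r \<le> m}"
    have "w ` A = B"
    proof (intro equalityI subsetI)
      fix x assume x: "x \<in> B"
      then have "inv w x \<in> A"
        using Sym_in_range[OF Sym_inv[OF assms(2)], of x] unfolding A_def B_def coord_act_inv[OF assms(2)] by blast
      then show "x \<in> w ` A"
        using Sym_inv_simps(1)[OF assms(2), of x] by (metis image_eqI)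
    next
      fix x assume "x \<in> w ` A"
      then obtain y where "y \<in> A" "x = w y" by blast
      then show "x \<in> B"
        using Sym_in_range[OF assms(2), of y] coord_act[OF assms(2), of \<mu> y] by (simp add: A_def B_def)
    qed
    moreover have "inj_on w A"
      using Sym_eq_iff[OF assms(2)] by (auto simp: inj_on_def)
    ultimately have card: "card A = card B" using card_image[of w A] by simp
    have fin: "finite A" "finite B" by (auto simp: A_def B_def)
    have down: "i \<in> C" if "C = A \<or> C = B" "j \<in> C" "1 \<le> i" "i \<le> j" for i j C
      using that assms(3,4) by (fastforce simp: A_def B_def weakly_increasing_def)
    have "A \<subseteq> B \<or> B \<subseteq> A"
    proof (rule ccontr)
      assume "\<not> ?thesis"
      then obtain a b where ab: "a \<in> A" "a \<notin> B" "b \<in> B" "b \<notin> A" by blast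
      then have "1 \<le> a" "1 \<le> b" by (auto simp: A_def B_def)
      then show False using ab down[of B b a] down[of A a b] by (meson le_cases)
    qed
    then have "A = B" using card fin card_subset_eq by metis
    then have "r \<in> A \<longleftrightarrow> r \<in> B" by simp
    then show ?thesis using r by (simp add: A_def B_def)
  qed
  then show "coord (act w \<mu>) r = coord \<mu> r" by (meson antisym order_refl)
qed (use assms in \<open>simp_all add: act_Zn\<close>)

lemma weakly_decreasing_unique:
  assumes "\<mu> \<in> Zn n" "w \<in> Sym n" "weakly_decreasing n \<mu>" "weakly_decreasing n (act w \<mu>)"
  shows "act w \<mu> = \<mu>"
proof -
  have *: "act w (- \<mu>) = - act w \<mu>"
    by (rule poly_mapping_eqI) (simp add: coord_act_inv[OF assms(2)])
  have "act w (- \<mu>) = - \<mu>"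
    by (rule weakly_increasing_unique[OF _ assms(2)])
       (use assms * in \<open>auto simp: Zn_iff weakly_increasing_def weakly_decreasing_def\<close>)
  then show ?thesis by (simp add: *)
qed

lemma orbitE:
  assumes "\<mu> \<in> orbit n lam"
  obtains w where "w \<in> Sym n" "\<mu> = act w lam"
  using assms by (auto simp: orbit_def)

lemma finite_orbit [simp]: "finite (orbit n \<mu>)"
  by (simp add: orbit_def)

lemma act_orbit: "w \<in> Sym n \<Longrightarrow> \<mu> \<in> orbit n lam \<Longrightarrow> act w \<mu> \<in> orbit n lam"
  by (auto simp: orbit_def Sym_comp simp flip: act_comp[of _ n])

lemma orbit_Zn: "lam \<in> Zn n \<Longrightarrow> \<mu> \<in> orbit n lam \<Longrightarrow> \<mu> \<in> Zn n"
  by (auto simp: orbit_def act_Zn)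

lemma self_orbit: "\<mu> \<in> orbit n \<mu>"
  by (auto simp: orbit_def intro!: image_eqI[of _ _ id])

lemma act_adj_adj [simp]: "act (adj i) (act (adj i) \<mu>) = \<mu>"
  by (rule poly_mapping_eqI) (simp add: coord_act_adj)

text \<open>Only descents are exchanged, the direction in which (E2) applies. The measure counts the
  ascending pairs still to be undone on the way back to the dominant weight.\<close>

lemma orbit_induct [consumes 3, case_names dominant adj]:
  assumes \<mu>: "\<mu> \<in> orbit n lam" and lam: "lam \<in> Zn n" "weakly_decreasing n lam"
    and base: "P lam"
    and step: "\<And>\<mu> i. \<mu> \<in> orbit n lam \<Longrightarrow> 1 \<le> i \<Longrightarrow> i < n \<Longrightarrow> coord \<mu> i > coord \<mu> (Suc i) \<Longrightarrow>
      P \<mu> \<Longrightarrow> P (act (adj i) \<mu>)"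
  shows "P \<mu>"
  using \<mu>
proof (induction "card {(k, l) \<in> pairs n. coord \<mu> k < coord \<mu> l}" arbitrary: \<mu> rule: less_induct)
  case (less \<mu>)
  show ?case
  proof (cases "\<exists>i. 1 \<le> i \<and> i < n \<and> coord \<mu> i < coord \<mu> (Suc i)")
    case True
    then obtain i where i: "1 \<le> i" "i < n" "coord \<mu> i < coord \<mu> (Suc i)" by blast
    define \<nu> where "\<nu> = act (adj i) \<mu>"
    have \<nu>: "\<nu> \<in> orbit n lam" unfolding \<nu>_def by (intro act_orbit adj_Sym i less)
    have "card {(k, l) \<in> pairs n. coord \<mu> k < coord \<mu> l} =
        Suc (card {(k, l) \<in> pairs n. coord \<nu> k < coord \<nu> l})"
      by (rule card_pairs_adj[OF i(1,2)]) (use i in \<open>auto simp: \<nu>_def coord_act_adj\<close>)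
    then have "P \<nu>" by (intro less(1) \<nu>) simp
    then have "P (act (adj i) \<nu>)"
      by (rule step[OF \<nu> i(1,2), rotated]) (use i in \<open>auto simp: \<nu>_def coord_act_adj\<close>)
    then show ?thesis by (simp add: \<nu>_def)
  next
    case False
    have "- coord \<mu> i \<le> - coord \<mu> j" if "1 \<le> i" "i \<le> j" "j \<le> n" for i j
      by (rule mono_steps[of n "\<lambda>i. - coord \<mu> i" i j]) (use False that in force)+
    then have "weakly_decreasing n \<mu>" by (simp add: weakly_decreasing_def)
    then have "\<mu> = lam"
      using less(2) lam weakly_decreasing_unique by (metis orbitE)
    then show ?thesis using base by simp
  qed
qed

text \<open>Length splits into a part that depends only on the coset of \<open>w\<close> and the
  inversions inside level sets of \<open>lam\<close>. Inversions between different levels become the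
  ascending pairs of \<open>act w lam\<close>.\<close>

lemma len_level_increasing:
  assumes w: "w \<in> Sym n" and lam: "weakly_decreasing n lam"
  shows "len n w = card {(a, b) \<in> pairs n. coord (act w lam) a < coord (act w lam) b} +
    card {(i, j) \<in> pairs n. coord lam i = coord lam j \<and> w j < w i}"
proof -
  let ?A = "{(i, j) \<in> pairs n. coord lam j < coord lam i \<and> w j < w i}"
  let ?B = "{(i, j) \<in> pairs n. coord lam i = coord lam j \<and> w j < w i}"
  have fin: "finite {(i, j) \<in> pairs n. R i j}" for R
    by (rule finite_subset[OF _ finite_pairs[of n]]) auto
  have "coord lam j \<le> coord lam i" if "(i, j) \<in> pairs n" for i j
    using lam that by (simp add: pairs_def weakly_decreasing_def)
  then have "Inv n w = ?A \<union> ?B"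
    by (force simp: Inv_eq le_less)
  then have "len n w = card ?A + card ?B"
    unfolding len_def using fin by (subst card_Un_disjoint[symmetric]) auto
  moreover have "bij_betw (\<lambda>(i, j). (w j, w i)) ?A
      {(a, b) \<in> pairs n. coord (act w lam) a < coord (act w lam) b}"
  proof (rule bij_betwI[where g = "\<lambda>(a, b). (inv w b, inv w a)"], goal_cases)
    case 1
    show ?case
    proof (intro funcsetI, clarify)
      fix i j assume ij: "(i, j) \<in> pairs n" "coord lam j < coord lam i" "w j < w i"
      then have "w i \<in> {1..n}" "w j \<in> {1..n}"
        using Sym_in_range[OF w, of i] Sym_in_range[OF w, of j] by (auto simp: pairs_def)
      then show "(w j, w i) \<in> pairs n \<and> coord (act w lam) (w j) < coord (act w lam) (w i)"
        using ij by (simp add: pairs_def coord_act[OF w])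
    qed
  next
    case 2
    show ?case
    proof (intro funcsetI, clarify)
      fix a b assume ab: "(a, b) \<in> pairs n" "coord (act w lam) a < coord (act w lam) b"
      then have r: "inv w a \<in> {1..n}" "inv w b \<in> {1..n}"
        using Sym_in_range[OF Sym_inv[OF w], of a] Sym_in_range[OF Sym_inv[OF w], of b]
        by (auto simp: pairs_def)
      have less: "coord lam (inv w a) < coord lam (inv w b)"
        using ab by (simp add: coord_act_inv[OF w])
      then have "inv w b < inv w a"
        using lam r unfolding weakly_decreasing_def by (meson atLeastAtMost_iff linorder_not_le)
      then show "(inv w b, inv w a) \<in> pairs n \<and> coord lam (inv w a) < coord lam (inv w b) \<and> w (inv w a) < w (inv w b)"
        using r less ab by (simp add: pairs_def Sym_inv_simps[OF w])
    qed
  qed (auto simp: Sym_inv_simps[OF w])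
  ultimately show ?thesis by (simp add: bij_betw_same_card)
qed

lemma level_increasing_iff:
  assumes "w \<in> Sym n"
  shows "level_increasing n \<mu> w \<longleftrightarrow> card {(i, j) \<in> pairs n. coord \<mu> i = coord \<mu> j \<and> w j < w i} = 0"
proof -
  have "finite {(i, j) \<in> pairs n. coord \<mu> i = coord \<mu> j \<and> w j < w i}"
    by (rule finite_subset[OF _ finite_pairs[of n]]) auto
  moreover have "\<not> w j < w i \<longleftrightarrow> w i < w j" if "(i, j) \<in> pairs n" for i j
    using that Sym_eq_iff[OF assms, of i j] by (auto simp: pairs_def)
  ultimately show ?thesis by (auto simp: level_increasing_def)
qed

lemma weakly_increasing_vperm: "weakly_increasing n (act (vperm n \<mu>) \<mu>)"
  unfolding weakly_increasing_def coord_act_inv[OF vperm_Sym]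
proof (intro allI impI)
  fix i j assume ij: "1 \<le> i \<and> i \<le> j \<and> j \<le> n"
  let ?v = "vperm n \<mu>"
  have "inv ?v i \<in> {1..n}" "inv ?v j \<in> {1..n}"
    using Sym_in_range[OF Sym_inv[OF vperm_Sym], where i = i] Sym_in_range[OF Sym_inv[OF vperm_Sym], where i = j] ij
    by auto
  then show "coord \<mu> (inv ?v i) \<le> coord \<mu> (inv ?v j)"
    using vperm_less[of "inv ?v j" n "inv ?v i" \<mu>] ij by (force simp: Sym_inv_simps[OF vperm_Sym])
qed

lemma act_vperm_orbit:
  assumes "\<mu> \<in> orbit n lam" "lam \<in> Zn n"
  shows "act (vperm n \<mu>) \<mu> = act (vperm n lam) lam"
proof -
  obtain w where w: "w \<in> Sym n" "\<mu> = act w lam" using assms(1) by (rule orbitE)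
  define u where "u = vperm n \<mu> \<circ> w \<circ> inv (vperm n lam)"
  have u: "u \<in> Sym n" unfolding u_def by (intro Sym_comp vperm_Sym Sym_inv w)
  have *: "act u (act (vperm n lam) lam) = act (vperm n \<mu>) \<mu>"
    by (simp add: u_def act_comp[of _ n] Sym_comp vperm_Sym Sym_inv w act_inv_act[OF vperm_Sym])
  have "act u (act (vperm n lam) lam) = act (vperm n lam) lam"
    by (rule weakly_increasing_unique[OF _ u])
       (use assms(2) weakly_increasing_vperm * in \<open>simp_all add: act_Zn vperm_Sym\<close>)
  then show ?thesis using * by simp
qed

text \<open>Both sorting permutations lead to the same antidominant weight, so \<open>z\<close>
  carries \<open>lam\<close> to \<mu>. Both break ties by position, so \<open>z\<close> is
  increasing on level sets and its length has no stabilizer part.\<close>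

lemma
  assumes \<mu>: "\<mu> \<in> orbit n lam" and lam: "lam \<in> Zn n" "weakly_decreasing n lam"
  defines "z \<equiv> inv (vperm n \<mu>) \<circ> vperm n lam"
  shows act_sorting_rep: "act z lam = \<mu>"
    and sorting_rep_min: "z \<in> min_reps n lam"
    and len_sorting_rep: "len n z = card {(a, b) \<in> pairs n. coord \<mu> a < coord \<mu> b}"
proof -
  have z: "z \<in> Sym n" unfolding z_def by (intro Sym_comp Sym_inv vperm_Sym)
  show act: "act z lam = \<mu>"
    unfolding z_def act_comp[OF Sym_inv[OF vperm_Sym] vperm_Sym] act_vperm_orbit[OF \<mu> lam(1), symmetric]
    by (rule act_inv_act[OF vperm_Sym])
  have "level_increasing n lam z"
    unfolding level_increasing_def
  proof (intro ballI, clarify)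
    fix i j assume ij: "(i, j) \<in> pairs n" "coord lam i = coord lam j"
    then have r: "i \<in> {1..n}" "j \<in> {1..n}" "i < j" by (auto simp: pairs_def)
    have "vperm n \<mu> (z i) < vperm n \<mu> (z j)"
      using vperm_less[OF r(1,2)] r(3) ij(2) by (simp add: z_def Sym_inv_simps[OF vperm_Sym])
    moreover have "coord \<mu> (z i) = coord \<mu> (z j)"
      using ij(2) coord_act[OF z] act by metis
    ultimately show "z i < z j"
      using vperm_less[of "z i" n "z j" \<mu>] r Sym_in_range[OF z, of i] Sym_in_range[OF z, of j] by simp
  qed
  then show len: "len n z = card {(a, b) \<in> pairs n. coord \<mu> a < coord \<mu> b}"
    using len_level_increasing[OF z lam(2)] level_increasing_iff[OF z] act by simp
  have "len n z \<le> len n (z \<circ> u)" if "u \<in> stab n lam" for u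
  proof -
    have u: "u \<in> Sym n" "act u lam = lam" using that by (auto simp: stab_def)
    then have "act (z \<circ> u) lam = \<mu>" by (simp add: act_comp[OF z] act)
    then show ?thesis
      using len_level_increasing[OF Sym_comp[OF z u(1)] lam(2)] len by simp
  qed
  then show "z \<in> min_reps n lam" by (simp add: min_reps_def z)
qed

lemma vperm_act_min_rep:
  assumes z: "z \<in> min_reps n lam" and lam: "lam \<in> Zn n" "weakly_decreasing n lam"
  shows "vperm n (act z lam) \<circ> z = vperm n lam"
proof -
  define \<mu> where "\<mu> = act z lam"
  define z' where "z' = inv (vperm n \<mu>) \<circ> vperm n lam"
  have zS: "z \<in> Sym n" using z by (simp add: min_reps_def)
  have \<mu>: "\<mu> \<in> orbit n lam" using zS by (auto simp: \<mu>_def orbit_def)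
  have z'S: "z' \<in> Sym n" unfolding z'_def by (intro Sym_comp Sym_inv vperm_Sym)
  have z': "act z' lam = \<mu>" "len n z' = card {(a, b) \<in> pairs n. coord \<mu> a < coord \<mu> b}"
    using act_sorting_rep[OF \<mu> lam] len_sorting_rep[OF \<mu> lam] by (simp_all add: z'_def)
  \<comment> \<open>The given representative is compared with the sorting representative of the same
    coset. Minimality forces the stabilizer part of its length to vanish.\<close>
  have "inv z \<circ> z' \<in> stab n lam"
    by (simp add: stab_def Sym_comp Sym_inv zS z'S act_comp[OF Sym_inv[OF zS] z'S] z'(1))
       (simp add: \<mu>_def act_inv_act[OF zS])
  then have "len n z \<le> len n (z \<circ> (inv z \<circ> z'))" using z by (simp add: min_reps_def)
  also have "z \<circ> (inv z \<circ> z') = z'" by (simp add: Sym_inv_simps[OF zS] flip: comp_assoc)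
  finally have "level_increasing n lam z"
    using len_level_increasing[OF zS lam(2)] z'(2) level_increasing_iff[OF zS] by (simp add: \<mu>_def)
  then show ?thesis by (rule vperm_act_comp[OF zS])
qed

lemma bij_betw_min_reps:
  assumes lam: "lam \<in> Zn n" "weakly_decreasing n lam"
  shows "bij_betw (\<lambda>z. act z lam) (min_reps n lam) (orbit n lam)"
proof (rule bij_betwI[where g = "\<lambda>\<mu>. inv (vperm n \<mu>) \<circ> vperm n lam"])
  fix z assume z: "z \<in> min_reps n lam"
  show "inv (vperm n (act z lam)) \<circ> vperm n lam = z"
    unfolding vperm_act_min_rep[OF z lam, symmetric] comp_assoc[symmetric] Sym_inv_simps[OF vperm_Sym] by simp
qed (use sorting_rep_min[OF _ lam] act_sorting_rep[OF _ lam] in \<open>auto simp: min_reps_def orbit_def\<close>)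

section \<open>Powers of \<open>q\<close> and \<open>t\<close>\<close>

lemma qq_power: "qq ^ a = Fract (monom 1 a) 1"
  by (induction a) (simp_all add: qq_def One_fract_def monom_altdef flip: one_pCons)

lemma th_power: "th ^ b = Fract [:monom 1 b:] 1"
  by (induction b) (simp_all add: th_def One_fract_def monom_altdef flip: one_pCons)

lemma qq_th_power_eq_iff: "qq ^ a * th ^ b = qq ^ c * th ^ d \<longleftrightarrow> a = c \<and> b = d"
proof
  assume "qq ^ a * th ^ b = qq ^ c * th ^ d"
  then have "(monom (monom 1 b) a :: complex poly poly) = monom (monom 1 d) c"
    by (simp add: qq_power th_power eq_fract smult_monom mult.commute)
  then show "a = c \<and> b = d"
    by (metis degree_monom_eq lead_coeff_monom monom_eq_0_iff zero_neq_one)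
qed auto

lemma qq_nonzero [simp]: "qq \<noteq> 0"
  using qq_th_power_eq_iff[of 1 0 2 0] by (auto simp: power2_eq_square)

lemma th_nonzero [simp]: "th \<noteq> 0"
  using qq_th_power_eq_iff[of 0 1 0 2] by (auto simp: power2_eq_square)

lemma tt_nonzero [simp]: "tt \<noteq> 0"
  by (simp add: tt_def)

text \<open>Genericity of q and t^(1/2): through \<open>yv_eq_iff\<close> this makes the
  denominators 1 - a nonzero.\<close>

lemma qq_th_powi_eq_1_iff: "qq powi m * th powi k = 1 \<longleftrightarrow> m = 0 \<and> k = 0"
proof
  assume *: "qq powi m * th powi k = 1"
  have powi: "x powi m = x ^ nat m / x ^ nat (- m)" if "x \<noteq> 0" for x :: K and m
    by (cases "m \<ge> 0") (simp_all add: power_int_def divide_inverse power_inverse)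
  have "qq ^ nat m * th ^ nat k = qq ^ nat (- m) * th ^ nat (- k)"
    using * by (simp add: powi field_simps)
  then show "m = 0 \<and> k = 0"
    unfolding qq_th_power_eq_iff by linarith
qed simp

lemma tt_powi: "tt powi k = th powi (2 * k)"
  by (simp add: tt_def power_int_mult)

lemma tt_power_neq_1: "k > 0 \<Longrightarrow> tt ^ k \<noteq> 1"
  using qq_th_power_eq_iff[of 0 "2 * k" 0 0] by (simp add: tt_def power_mult)

lemma tt_neq_1 [simp]: "tt \<noteq> 1"
  using tt_power_neq_1[of 1] by simp

text \<open>Up to a common factor the inverse eigenvalues of the Cherednik operators on \<open>E\<^sub>\<mu>\<close>; the
  parameter \<open>a\<close> of (E2) is a quotient of two of them.\<close>

definition yv :: "nat \<Rightarrow> expo \<Rightarrow> nat \<Rightarrow> K" where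
  "yv n \<mu> i = qq powi coord \<mu> i * tt powi int (vperm n \<mu> i)"

lemma yv_nonzero [simp]: "yv n \<mu> i \<noteq> 0"
  by (simp add: yv_def)

lemma yv_divide:
  "yv n \<mu> i / yv n \<mu> j =
    qq powi (coord \<mu> i - coord \<mu> j) * tt powi (int (vperm n \<mu> i) - int (vperm n \<mu> j))"
  by (simp add: yv_def power_int_diff)

lemma yv_eq_iff: "yv n \<mu> i = yv n \<mu> j \<longleftrightarrow> coord \<mu> i = coord \<mu> j \<and> vperm n \<mu> i = vperm n \<mu> j"
proof -
  have "yv n \<mu> i = yv n \<mu> j \<longleftrightarrow> yv n \<mu> i / yv n \<mu> j = 1" by simp
  then show ?thesis by (simp add: yv_divide tt_powi qq_th_powi_eq_1_iff)
qed

lemma yv_act_adj: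
  assumes "1 \<le> i" "i < n" "coord \<mu> i \<noteq> coord \<mu> (Suc i)"
  shows "yv n (act (adj i) \<mu>) k = yv n \<mu> (adj i k)"
  using vperm_act_adj[OF assms, of "adj i k"] by (simp add: yv_def coord_act_adj)

lemma yv_Suc:
  assumes "1 \<le> i" "i < n" "coord \<mu> i = coord \<mu> (Suc i)"
  shows "yv n \<mu> (Suc i) = tt * yv n \<mu> i"
  using assms(3) vperm_Suc_eq[OF assms] by (simp add: yv_def power_int_add)

section \<open>Demazure--Lusztig operators\<close>

definition hecke :: "nat \<Rightarrow> ratfun \<Rightarrow> ratfun" where
  "hecke i f = divdiff i (X i * f) - const tt * X i * divdiff i f"

abbreviation sX :: "nat \<Rightarrow> ratfun \<Rightarrow> ratfun" where
  "sX i \<equiv> actX (adj i)"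

lemma sX_sX [simp]: "1 \<le> i \<Longrightarrow> i < n \<Longrightarrow> sX i (sX i f) = f"
  using actX_comp[OF adj_Sym[of i n] adj_Sym[of i n], of f] by simp

lemma hecke_eq:
  assumes "1 \<le> i"
  shows "hecke i f = (1 - const tt) * X i / (X i - X (Suc i)) * f +
    (const tt * X i - X (Suc i)) / (X i - X (Suc i)) * sX i f"
proof -
  have S: "adj i \<in> Sym (Suc i)" using assms by (intro adj_Sym) auto
  define d where "d = X i - X (Suc i)"
  have d: "d \<noteq> 0" by (simp add: d_def)
  have "hecke i f = (X i * f - X (Suc i) * sX i f) / d - const tt * X i * ((f - sX i f) / d)"
    by (simp add: hecke_def divdiff_def actX_mult[OF S] d_def)
  also have "\<dots> = (1 - const tt) * X i / d * f + (const tt * X i - X (Suc i)) / d * sX i f"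
    using d by (simp add: field_simps)
  finally show ?thesis by (simp only: d_def)
qed

lemma hecke_mult_sym:
  assumes "1 \<le> i" "sX i g = g"
  shows "hecke i (g * f) = g * hecke i f"
proof -
  have S: "adj i \<in> Sym (Suc i)" using assms by (intro adj_Sym) auto
  show ?thesis
    by (simp add: hecke_eq[OF assms(1)] actX_mult[OF S] assms(2) algebra_simps)
qed

lemma sX_prod_X:
  assumes "1 \<le> i" "i < n"
  shows "sX i (\<Prod>i=1..n. inverse (X i)) = (\<Prod>i=1..n. inverse (X i))"
proof -
  note S = adj_Sym[OF assms]
  have "sX i (\<Prod>i=1..n. inverse (X i)) = (\<Prod>k\<in>{1..n}. inverse (X (adj i k)))"
    by (simp add: actX_prod[OF S] actX_inverse[OF S])
  also have "\<dots> = (\<Prod>i=1..n. inverse (X i))"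
    by (rule prod.reindex_bij_betw[OF permutes_imp_bij[OF Sym_permutes[OF S]]])
  finally show ?thesis .
qed

lemma vec_act: "w \<in> Sym n \<Longrightarrow> act w (vec n f) = vec n (\<lambda>i. f (inv w i))"
  by (rule Zn_eqI[of _ n]) (use Sym_in_range[OF Sym_inv, of w n] in \<open>auto simp: act_Zn coord_act_inv coord_vec\<close>)

lemma vperm_shift: "vperm n (vec n (\<lambda>i. coord \<mu> i + c)) = vperm n \<mu>"
proof (rule Sym_eqI[OF vperm_Sym vperm_Sym])
  show "Inv n (vperm n (vec n (\<lambda>i. coord \<mu> i + c))) = Inv n (vperm n \<mu>)"
    unfolding Inv_vperm by (auto simp: pairs_def coord_vec)
qed

text \<open>(E2) is given for nonnegative weights only; this induction, with (E3) as its step,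
  extends statements to all of Z^n.\<close>

lemma shift_induct [consumes 1, case_names nonneg shift]:
  assumes "\<mu> \<in> Zn n"
    and nonneg: "\<And>\<mu>. \<mu> \<in> Zn n \<Longrightarrow> (\<And>j. coord \<mu> j \<ge> 0) \<Longrightarrow> P \<mu>"
    and shift: "\<And>\<mu>. \<mu> \<in> Zn n \<Longrightarrow> P \<mu> \<Longrightarrow> P (vec n (\<lambda>i. coord \<mu> i - 1))"
  shows "P \<mu>"
proof -
  have "P \<mu>" if "\<mu> \<in> Zn n" "\<And>j. coord \<mu> j \<ge> - int m" for m \<mu>
    using that
  proof (induction m arbitrary: \<mu>)
    case 0
    then show ?case by (intro nonneg) auto
  next
    case (Suc m)
    let ?\<nu> = "vec n (\<lambda>i. coord \<mu> i + 1)"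
    have "- int m \<le> coord ?\<nu> j" for j
      using Suc(3)[of j] by (simp add: coord_vec)
    then have "P ?\<nu>" by (intro Suc(1)) auto
    then have "P (vec n (\<lambda>i. coord ?\<nu> i - 1))" by (rule shift[rotated]) simp
    also have "vec n (\<lambda>i. coord ?\<nu> i - 1) = \<mu>"
      by (rule Zn_eqI[OF _ Suc(2)]) (auto simp: coord_vec)
    finally show ?case .
  qed
  moreover obtain m where "\<forall>j. coord \<mu> j \<ge> - int m"
  proof -
    define m where "m = (\<Sum>j\<in>{1..n}. nat (- coord \<mu> j))"
    have "coord \<mu> j \<ge> - int m" for j
    proof (cases "j \<in> {1..n}")
      case True
      then have "nat (- coord \<mu> j) \<le> m" unfolding m_def by (intro member_le_sum) auto
      then show ?thesis by linarith
    next
      case False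
      then show ?thesis using assms(1) unfolding Zn_iff by simp
    qed
    then show ?thesis using that by blast
  qed
  ultimately show ?thesis using assms(1) by blast
qed

locale macdonald_family =
  fixes n :: nat and E :: "expo \<Rightarrow> ratfun"
  assumes n_pos: "n \<ge> 1" and electronic: "electronic_macdonald n E"
begin

lemma E_KX: "\<mu> \<in> Zn n \<Longrightarrow> E \<mu> \<in> KX n"
  using electronic unfolding electronic_macdonald_def by blast

lemma E_0: "E 0 = 1"
  using electronic unfolding electronic_macdonald_def by blast

lemma E_shift: "\<mu> \<in> Zn n \<Longrightarrow> E (vec n (\<lambda>i. coord \<mu> i - 1)) = (\<Prod>i=1..n. inverse (X i)) * E \<mu>"
  using electronic unfolding electronic_macdonald_def by blast

text \<open>The monomial of (E3) is symmetric and hence commutes with \<open>hecke i\<close>, while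
  the parameter \<open>a\<close> depends only on differences of entries and on the sorting
  permutation. Both are compatible with the shift.\<close>

lemma E_adj:
  assumes "\<mu> \<in> Zn n" "1 \<le> i" "i < n" "coord \<mu> i > coord \<mu> (Suc i)"
  defines "a \<equiv> yv n \<mu> i / yv n \<mu> (Suc i)"
  shows "E (act (adj i) \<mu>) = hecke i (E \<mu>) + const ((1 - tt) * a / (1 - a)) * E \<mu>"
  using assms(1,4) unfolding a_def
proof (induction rule: shift_induct)
  case (nonneg \<mu>)
  have "\<forall>\<mu>\<in>Zn n. \<forall>i. (\<forall>j. coord \<mu> j \<ge> 0) \<longrightarrow> 1 \<le> i \<longrightarrow> i < n \<longrightarrow>
        coord \<mu> i > coord \<mu> (i + 1) \<longrightarrow>
        (let a = qq powi (coord \<mu> i - coord \<mu> (i + 1)) *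
                 tt powi (int (vperm n \<mu> i) - int (vperm n \<mu> (i + 1)))
         in E (act (transpose i (i + 1)) \<mu>) =
              divdiff i (X i * E \<mu>) - const tt * X i * divdiff i (E \<mu>)
              + const ((1 - tt) * a / (1 - a)) * E \<mu>)"
    using electronic unfolding electronic_macdonald_def by blast
  then have "let a = qq powi (coord \<mu> i - coord \<mu> (i + 1)) *
                 tt powi (int (vperm n \<mu> i) - int (vperm n \<mu> (i + 1)))
         in E (act (transpose i (i + 1)) \<mu>) =
              divdiff i (X i * E \<mu>) - const tt * X i * divdiff i (E \<mu>)
              + const ((1 - tt) * a / (1 - a)) * E \<mu>"
    using nonneg assms(2,3) by (simp del: Let_def)
  then show ?case by (simp add: Let_def yv_divide hecke_def)
next
  case (shift \<mu>)
  let ?\<nu> = "vec n (\<lambda>i. coord \<mu> i - 1)"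
  define p where "p = (\<Prod>i=1..n. inverse (X i))"
  note S = adj_Sym[OF assms(2,3)]
  have less: "coord \<mu> (Suc i) < coord \<mu> i"
    using shift(3) assms(2,3) by (simp add: coord_vec)
  have "act (adj i) ?\<nu> = vec n (\<lambda>j. coord (act (adj i) \<mu>) j - 1)"
    by (simp add: vec_act[OF S] coord_act_adj)
  then have "E (act (adj i) ?\<nu>) = p * E (act (adj i) \<mu>)"
    using E_shift[of "act (adj i) \<mu>"] shift(1) by (simp add: act_Zn[OF S] p_def)
  moreover have "hecke i (p * E \<mu>) = p * hecke i (E \<mu>)"
    unfolding p_def by (rule hecke_mult_sym[OF assms(2) sX_prod_X[OF assms(2,3)]])
  moreover have "yv n ?\<nu> i / yv n ?\<nu> (Suc i) = yv n \<mu> i / yv n \<mu> (Suc i)"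
    using assms(2,3) vperm_shift[of n \<mu> "- 1"] by (simp add: yv_divide coord_vec)
  ultimately show ?case
    by (simp add: E_shift[OF shift(1), folded p_def] shift(2)[OF less] distrib_left mult.left_commute)
qed

end

section \<open>Coefficients\<close>

text \<open>Functional counterpart of \<open>has_coeff\<close>. It has meaning on the image of
  \<open>of_laurent\<close>, where injectivity makes the description unique, and is unspecified
  elsewhere.\<close>

definition cf :: "ratfun \<Rightarrow> expo \<Rightarrow> K" where
  "cf z \<kappa> = Poly_Mapping.lookup (THE f. z = of_laurent f) \<kappa>"

lemma cf_of_laurent [simp]: "cf (of_laurent f) \<kappa> = Poly_Mapping.lookup f \<kappa>"
  by (simp add: cf_def)

lemma cf_1: "cf 1 \<kappa> = (if \<kappa> = 0 then 1 else 0)"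
  using cf_of_laurent[of 1 \<kappa>] by (auto simp: lookup_one)

lemma lookup_single_mult_shift:
  fixes f :: laurent
  shows "Poly_Mapping.lookup (Poly_Mapping.single \<nu> c * f) \<kappa> = c * Poly_Mapping.lookup f (\<kappa> - \<nu>)"
proof -
  have "Poly_Mapping.single \<nu> c * f = Poly_Mapping.single \<nu> c *
      (\<Sum>\<mu>\<in>Poly_Mapping.keys f. Poly_Mapping.single \<mu> (Poly_Mapping.lookup f \<mu>))"
    by (subst poly_mapping_expand[of f]) simp
  also have "\<dots> = (\<Sum>\<mu>\<in>Poly_Mapping.keys f. Poly_Mapping.single (\<nu> + \<mu>) (c * Poly_Mapping.lookup f \<mu>))"
    by (simp add: sum_distrib_left mult_single)
  finally have *: "Poly_Mapping.single \<nu> c * f =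
      (\<Sum>\<mu>\<in>Poly_Mapping.keys f. Poly_Mapping.single (\<nu> + \<mu>) (c * Poly_Mapping.lookup f \<mu>))" .
  have "\<nu> + \<mu> = \<kappa> \<longleftrightarrow> \<mu> = \<kappa> - \<nu>" for \<mu> by (auto simp: algebra_simps)
  then show ?thesis unfolding * by (simp add: lookup_sum lookup_single when_def in_keys_iff)
qed

lemma of_laurent_actX_eq_iff:
  assumes "1 \<le> i" "i < n"
  shows "sX i (of_laurent f) = of_laurent f \<longleftrightarrow>
    (\<forall>\<kappa>. Poly_Mapping.lookup f (act (adj i) \<kappa>) = Poly_Mapping.lookup f \<kappa>)"
  using lookup_permL[OF adj_Sym[OF assms], of f]
  by (auto simp: actX_of_laurent intro: poly_mapping_eqI)

text \<open>Translation by m times the simple root e_i - e_(i+1). Dividing by x_i - x_(i+1) couples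
  coefficients along these lines only.\<close>

definition root_shift :: "nat \<Rightarrow> int \<Rightarrow> expo \<Rightarrow> expo" where
  "root_shift i m \<kappa> = \<kappa> + (Poly_Mapping.single i m - Poly_Mapping.single (Suc i) m)"

lemma coord_root_shift:
  "coord (root_shift i m \<kappa>) k = coord \<kappa> k + (if k = i then m else if k = Suc i then - m else 0)"
  by (simp add: root_shift_def lookup_add lookup_minus lookup_single when_def)

lemma root_shift_root_shift [simp]: "root_shift i m (root_shift i m' \<kappa>) = root_shift i (m + m') \<kappa>"
  by (rule poly_mapping_eqI) (simp add: coord_root_shift)

lemma root_shift_0 [simp]: "root_shift i 0 \<kappa> = \<kappa>"
  by (rule poly_mapping_eqI) (simp add: coord_root_shift)

lemma act_adj_root_shift: "act (adj i) (root_shift i m \<kappa>) = root_shift i (- m) (act (adj i) \<kappa>)"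
  by (rule poly_mapping_eqI) (auto simp: coord_root_shift coord_act_adj transpose_def)

text \<open>Clearing the denominator x_i - x_(i+1) turns the operator into a first order difference
  equation along a root string.\<close>

lemma lookup_hecke:
  assumes i: "1 \<le> i" "i < n" and g: "of_laurent g = hecke i (of_laurent f)"
  shows "Poly_Mapping.lookup g \<kappa> - Poly_Mapping.lookup g (root_shift i 1 \<kappa>) =
    (1 - tt) * Poly_Mapping.lookup f \<kappa> + tt * Poly_Mapping.lookup f (act (adj i) \<kappa>) -
    Poly_Mapping.lookup f (act (adj i) (root_shift i 1 \<kappa>))"
proof -
  define x where "x k = Poly_Mapping.single (Poly_Mapping.single k (1::int)) (1::K)" for k :: nat
  define c where "c = (\<lambda>a. Poly_Mapping.single (0::expo) (a::K))"
  have "(X i - X (Suc i)) * of_laurent g =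
      const (1 - tt) * X i * of_laurent f + (const tt * X i - X (Suc i)) * of_laurent (permL (adj i) f)"
    unfolding g hecke_eq[OF i(1)] const_diff by (simp add: distrib_left flip: actX_of_laurent)
  then have "of_laurent (x i * g - x (Suc i) * g) =
      of_laurent (c (1 - tt) * (x i * f) + (c tt * (x i * permL (adj i) f) - x (Suc i) * permL (adj i) f))"
    by (simp add: X_def const_def x_def c_def algebra_simps)
  then have *: "x i * g - x (Suc i) * g =
      c (1 - tt) * (x i * f) + (c tt * (x i * permL (adj i) f) - x (Suc i) * permL (adj i) f)"
    by (simp only: of_laurent_eq_iff)
  have lx: "Poly_Mapping.lookup (x k * h) \<mu> = Poly_Mapping.lookup h (\<mu> - Poly_Mapping.single k 1)" for k h \<mu>
    unfolding x_def lookup_single_mult_shift by simp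
  have lc: "Poly_Mapping.lookup (c a * h) \<mu> = a * Poly_Mapping.lookup h \<mu>" for a h \<mu>
    unfolding c_def lookup_single_mult_shift by simp
  \<comment> \<open>Reading off the coefficient here makes multiplication by x_i land on \<kappa>
    and multiplication by x_(i+1) on its next neighbour in the string.\<close>
  define \<mu> where "\<mu> = \<kappa> + Poly_Mapping.single i 1"
  have \<mu>: "\<mu> - Poly_Mapping.single i 1 = \<kappa>" "\<mu> - Poly_Mapping.single (Suc i) 1 = root_shift i 1 \<kappa>"
    by (simp_all add: \<mu>_def root_shift_def)
  from * have "Poly_Mapping.lookup (x i * g - x (Suc i) * g) \<mu> = Poly_Mapping.lookup
      (c (1 - tt) * (x i * f) + (c tt * (x i * permL (adj i) f) - x (Suc i) * permL (adj i) f)) \<mu>"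
    by simp
  then show ?thesis
    unfolding lookup_minus lookup_add lc lx \<mu> lookup_permL[OF adj_Sym[OF i]] inv_adj by (simp add: algebra_simps)
qed

text \<open>Finite support supplies the boundary value 0 at infinity for the difference
  equation.\<close>

lemma poly_mapping_const_on_line:
  fixes g :: laurent
  assumes "\<And>m::nat. Poly_Mapping.lookup g (root_shift i (s * int m) \<kappa>) = c" "s \<noteq> 0"
  shows "c = 0"
proof (rule ccontr)
  assume "c \<noteq> 0"
  then have "range (\<lambda>m::nat. root_shift i (s * int m) \<kappa>) \<subseteq> Poly_Mapping.keys g"
    using assms(1) by (auto simp: in_keys_iff)
  then have "finite (range (\<lambda>m::nat. root_shift i (s * int m) \<kappa>))"
    by (rule finite_subset) simp
  moreover have "inj (\<lambda>m::nat. root_shift i (s * int m) \<kappa>)"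
  proof (rule injI)
    fix m m' assume "root_shift i (s * int m) \<kappa> = root_shift i (s * int m') \<kappa>"
    then have "coord (root_shift i (s * int m) \<kappa>) i = coord (root_shift i (s * int m') \<kappa>) i" by simp
    then show "m = m'" using assms(2) by (simp add: coord_root_shift)
  qed
  ultimately show False using finite_imageD infinite_UNIV_nat by blast
qed

text \<open>Outside \<open>B\<close> the right side of the difference equation vanishes, so
  \<open>g\<close> is constant along a half line that never returns to \<open>B\<close>, hence zero.
  \<open>B_root\<close> says that moving outwards from the wall does not re-enter
  \<open>B\<close>.\<close>

lemma
  assumes i: "1 \<le> i" "i < n" and g: "of_laurent g = hecke i (of_laurent f)"
    and B_adj: "\<And>\<kappa>. \<kappa> \<in> B \<Longrightarrow> act (adj i) \<kappa> \<in> B"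
    and B_root: "\<And>\<kappa>. \<kappa> \<notin> B \<Longrightarrow> coord \<kappa> i \<ge> coord \<kappa> (Suc i) \<Longrightarrow> root_shift i 1 \<kappa> \<notin> B"
    and f: "\<And>\<kappa>. \<kappa> \<notin> B \<Longrightarrow> Poly_Mapping.lookup f \<kappa> = 0"
  shows hecke_support: "\<kappa> \<notin> B \<Longrightarrow> Poly_Mapping.lookup g \<kappa> = 0"
    and hecke_leading: "root_shift i 1 \<kappa> \<notin> B \<Longrightarrow>
      Poly_Mapping.lookup g (act (adj i) \<kappa>) = Poly_Mapping.lookup f \<kappa>"
proof -
  note step = lookup_hecke[OF i g]
  have B_iff: "act (adj i) \<kappa> \<in> B \<longleftrightarrow> \<kappa> \<in> B" for \<kappa>
    using B_adj[of \<kappa>] B_adj[of "act (adj i) \<kappa>"] by auto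
  have up: "root_shift i (int m) \<kappa> \<notin> B" if "\<kappa> \<notin> B" "coord \<kappa> i \<ge> coord \<kappa> (Suc i)" for \<kappa> m
  proof (induction m)
    case (Suc m)
    then show ?case using B_root[of "root_shift i (int m) \<kappa>"] that(2) by (simp add: coord_root_shift)
  qed (use that in simp)
  have pos: "Poly_Mapping.lookup g \<kappa> = 0" if "\<kappa> \<notin> B" "coord \<kappa> i \<ge> coord \<kappa> (Suc i)" for \<kappa>
  proof -
    have "Poly_Mapping.lookup g (root_shift i (1 * int m) \<kappa>) = Poly_Mapping.lookup g \<kappa>" for m
    proof (induction m)
      case (Suc m)
      have "root_shift i (int m) \<kappa> \<notin> B" "root_shift i (1 + int m) \<kappa> \<notin> B"
        using up[OF that, of m] up[OF that, of "Suc m"] by simp_all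
      then have "Poly_Mapping.lookup g (root_shift i (int m) \<kappa>) = Poly_Mapping.lookup g (root_shift i (1 + int m) \<kappa>)"
        using step[of "root_shift i (int m) \<kappa>"] f B_iff by simp
      then show ?case using Suc by (simp add: add.commute)
    qed simp
    then show ?thesis by (rule poly_mapping_const_on_line) simp
  qed
  \<comment> \<open>On the other side of the wall the string is followed in the opposite direction;
    its points avoid \<open>B\<close> because their reflections do.\<close>
  have neg: "Poly_Mapping.lookup g \<kappa> = 0" if "\<kappa> \<notin> B" "coord \<kappa> i < coord \<kappa> (Suc i)" for \<kappa>
  proof -
    have dn: "root_shift i (- int m) \<kappa> \<notin> B" for m
    proof -
      have "root_shift i (int m) (act (adj i) \<kappa>) \<notin> B"
        using that by (intro up) (auto simp: B_iff coord_act_adj)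
      then have "act (adj i) (root_shift i (int m) (act (adj i) \<kappa>)) \<notin> B" by (simp only: B_iff not_False_eq_True)
      then show ?thesis by (simp add: act_adj_root_shift)
    qed
    have "Poly_Mapping.lookup g (root_shift i (- 1 * int m) \<kappa>) = Poly_Mapping.lookup g \<kappa>" for m
    proof (induction m)
      case (Suc m)
      have "Poly_Mapping.lookup g (root_shift i (- int (Suc m)) \<kappa>) = Poly_Mapping.lookup g (root_shift i (- int m) \<kappa>)"
        using step[of "root_shift i (- int (Suc m)) \<kappa>"] f[OF dn[of "Suc m"]] f[of "act (adj i) (root_shift i (- int (Suc m)) \<kappa>)"]
          f[of "act (adj i) (root_shift i (- int m) \<kappa>)"] dn[of m] dn[of "Suc m"] B_iff by simp
      then show ?case using Suc by simp
    qed simp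
    then show ?thesis by (rule poly_mapping_const_on_line) simp
  qed
  show support: "Poly_Mapping.lookup g \<kappa> = 0" if "\<kappa> \<notin> B" for \<kappa>
    using pos[OF that] neg[OF that] by linarith
  show "Poly_Mapping.lookup g (act (adj i) \<kappa>) = Poly_Mapping.lookup f \<kappa>" if "root_shift i 1 \<kappa> \<notin> B"
  proof -
    \<comment> \<open>At this point all terms of the difference equation vanish except the two
      coefficients to be compared.\<close>
    define \<nu> where "\<nu> = act (adj i) (root_shift i 1 \<kappa>)"
    have \<nu>: "\<nu> \<notin> B" "act (adj i) \<nu> \<notin> B" using that by (simp_all add: \<nu>_def B_iff)
    have "root_shift i 1 \<nu> = act (adj i) \<kappa>" by (simp add: \<nu>_def act_adj_root_shift)
    then show ?thesis using step[of \<nu>] f[OF \<nu>(1)] f[OF \<nu>(2)] support[OF \<nu>(1)] by simp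
  qed
qed

section \<open>Triangularity\<close>

text \<open>The rank functions of the Bruhat order of the extended affine symmetric group,
  restricted to the cosets indexed by \<open>\<int>\<^sup>n\<close>.\<close>

definition rank :: "nat \<Rightarrow> expo \<Rightarrow> nat \<Rightarrow> int \<Rightarrow> int" where
  "rank n \<nu> i m = (\<Sum>r=1..n. max 0 (m + of_bool (r \<le> i) - coord \<nu> r))"

definition bruhat_le :: "nat \<Rightarrow> expo \<Rightarrow> expo \<Rightarrow> bool" where
  "bruhat_le n \<kappa> \<mu> \<longleftrightarrow> (\<forall>i\<le>n. \<forall>m. rank n \<kappa> i m \<le> rank n \<mu> i m)"

lemma sum_split_adj:
  fixes F :: "nat \<Rightarrow> 'a::comm_monoid_add"
  assumes "1 \<le> i" "i < n"
  shows "(\<Sum>r=1..n. F r) = F i + F (Suc i) + (\<Sum>r\<in>{1..n} - {i, Suc i}. F r)"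
proof -
  have "(\<Sum>r=1..n. F r) = F i + (\<Sum>r\<in>{1..n} - {i}. F r)"
    using assms by (intro sum.remove) auto
  also have "(\<Sum>r\<in>{1..n} - {i}. F r) = F (Suc i) + (\<Sum>r\<in>{1..n} - {i} - {Suc i}. F r)"
    using assms by (intro sum.remove) auto
  also have "{1..n} - {i} - {Suc i} = {1..n} - {i, Suc i}" by auto
  finally show ?thesis by (simp add: add.assoc)
qed

lemma rank_step:
  assumes "1 \<le> i" "i \<le> n"
  shows "rank n \<nu> i m = rank n \<nu> (i - 1) m + of_bool (coord \<nu> i \<le> m)"
proof -
  have "rank n \<nu> j m = max 0 (m + of_bool (i \<le> j) - coord \<nu> i) +
      (\<Sum>r\<in>{1..n} - {i}. max 0 (m + of_bool (r \<le> j) - coord \<nu> r))" for j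
    unfolding rank_def using assms by (intro sum.remove) auto
  moreover have "(\<Sum>r\<in>{1..n} - {i}. max 0 (m + of_bool (r \<le> i) - coord \<nu> r)) =
      (\<Sum>r\<in>{1..n} - {i}. max 0 (m + of_bool (r \<le> i - 1) - coord \<nu> r))"
  proof (rule sum.cong, rule refl)
    fix r assume "r \<in> {1..n} - {i}"
    then have "r \<le> i \<longleftrightarrow> r \<le> i - 1" by auto
    then show "max 0 (m + of_bool (r \<le> i) - coord \<nu> r) = max 0 (m + of_bool (r \<le> i - 1) - coord \<nu> r)"
      by simp
  qed
  ultimately show ?thesis using assms by (auto simp: max_def)
qed

lemma rank_split_adj:
  assumes "1 \<le> i" "i < n" "j \<noteq> i"
  shows "rank n \<nu> j m = max 0 (m + of_bool (i \<le> j) - coord \<nu> i) + max 0 (m + of_bool (i \<le> j) - coord \<nu> (Suc i)) +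
    (\<Sum>r\<in>{1..n} - {i, Suc i}. max 0 (m + of_bool (r \<le> j) - coord \<nu> r))"
proof -
  have "Suc i \<le> j \<longleftrightarrow> i \<le> j" using assms(3) by auto
  then show ?thesis unfolding rank_def by (subst sum_split_adj[OF assms(1,2)]) simp
qed

lemma rank_act_adj:
  assumes "1 \<le> i" "i < n" "j \<noteq> i"
  shows "rank n (act (adj i) \<nu>) j m = rank n \<nu> j m"
  unfolding rank_split_adj[OF assms] coord_act_adj by (simp add: add.commute)

text \<open>The function max 0 is convex, so spreading two entries apart while keeping their sum
  cannot lower the rank.\<close>

lemma rank_root_shift:
  assumes "1 \<le> i" "i < n" "j \<noteq> i" "coord \<nu> i \<ge> coord \<nu> (Suc i)"
  shows "rank n \<nu> j m \<le> rank n (root_shift i 1 \<nu>) j m"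
proof -
  have "(\<Sum>r\<in>{1..n} - {i, Suc i}. max 0 (m + of_bool (r \<le> j) - coord (root_shift i 1 \<nu>) r)) =
    (\<Sum>r\<in>{1..n} - {i, Suc i}. max 0 (m + of_bool (r \<le> j) - coord \<nu> r))"
    by (rule sum.cong) (auto simp: coord_root_shift)
  then show ?thesis
    unfolding rank_split_adj[OF assms(1-3)] using assms(4)
    by (simp add: coord_root_shift max_def)
qed

text \<open>At this level the two old entries contribute 0, while the lowered smaller entry
  contributes 1.\<close>

lemma rank_root_shift_strict:
  assumes "1 \<le> i" "i < n" "coord \<nu> i > coord \<nu> (Suc i)"
  shows "rank n \<nu> 0 (coord \<nu> (Suc i)) < rank n (root_shift i 1 \<nu>) 0 (coord \<nu> (Suc i))"
proof -
  let ?m = "coord \<nu> (Suc i)"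
  have "(\<Sum>r\<in>{1..n} - {i, Suc i}. max 0 (?m + of_bool (r \<le> 0) - coord (root_shift i 1 \<nu>) r)) =
    (\<Sum>r\<in>{1..n} - {i, Suc i}. max 0 (?m + of_bool (r \<le> 0) - coord \<nu> r))"
    by (rule sum.cong) (auto simp: coord_root_shift)
  then show ?thesis
    using assms rank_split_adj[of i n 0 \<nu>] rank_split_adj[of i n 0 "root_shift i 1 \<nu>"]
    by (simp add: coord_root_shift)
qed

text \<open>With the smaller entry moved to the front, the increments between \<open>i - 1\<close>
  and \<open>Suc i\<close> occur as early as possible. The resulting rank attains the bound
  \<open>rank_i_le\<close> valid for every weight.\<close>

lemma rank_act_adj_i:
  assumes "1 \<le> i" "i < n" "coord \<mu> i > coord \<mu> (Suc i)"
  shows "rank n (act (adj i) \<mu>) i m = min (rank n \<mu> (i - 1) m + 1) (rank n \<mu> (Suc i) m)"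
proof -
  have "rank n (act (adj i) \<mu>) i m = rank n \<mu> (i - 1) m + of_bool (coord \<mu> (Suc i) \<le> m)"
    using assms by (subst rank_step) (auto simp: rank_act_adj coord_act_adj)
  moreover have "rank n \<mu> (Suc i) m = rank n \<mu> (i - 1) m + of_bool (coord \<mu> i \<le> m) + of_bool (coord \<mu> (Suc i) \<le> m)"
    using assms rank_step[of "Suc i" n \<mu> m] rank_step[of i n \<mu> m] by simp
  ultimately show ?thesis using assms by (auto simp: min_def)
qed

lemma rank_i_le:
  assumes "1 \<le> i" "i < n"
  shows "rank n \<nu> i m \<le> min (rank n \<nu> (i - 1) m + 1) (rank n \<nu> (Suc i) m)"
  using assms rank_step[of "Suc i" n \<nu> m] rank_step[of i n \<nu> m] by auto

text \<open>Lifting property of the Bruhat order: at index \<open>i\<close> the exchanged weight has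
  the largest rank its neighbours allow, so that index imposes no further condition.\<close>

lemma bruhat_le_adjI:
  assumes i: "1 \<le> i" "i < n" "coord \<mu> i > coord \<mu> (Suc i)"
    and le: "\<And>j m. j \<le> n \<Longrightarrow> j \<noteq> i \<Longrightarrow> rank n \<kappa> j m \<le> rank n \<mu> j m"
  shows "bruhat_le n \<kappa> (act (adj i) \<mu>)"
  unfolding bruhat_le_def
proof (intro allI impI)
  fix j m assume j: "j \<le> n"
  show "rank n \<kappa> j m \<le> rank n (act (adj i) \<mu>) j m"
  proof (cases "j = i")
    case True
    have "i - 1 \<le> n" "i - 1 \<noteq> i" "Suc i \<le> n" "Suc i \<noteq> i" using i by auto
    then show ?thesis
      using rank_i_le[OF i(1,2), of \<kappa> m] rank_act_adj_i[OF i, of m] le[of "i - 1" m] le[of "Suc i" m] True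
      by (simp del: One_nat_def)
  next
    case False
    then show ?thesis using le[OF j False, of m] rank_act_adj[OF i(1,2) False] by simp
  qed
qed

lemma not_bruhat_le_act_adj:
  assumes i: "1 \<le> i" "i < n" "coord \<mu> i > coord \<mu> (Suc i)"
  shows "\<not> bruhat_le n (act (adj i) \<mu>) \<mu>"
proof -
  define m where "m = coord \<mu> (Suc i)"
  have "rank n (act (adj i) \<mu>) i m = rank n \<mu> (i - 1) m + 1"
    using i by (subst rank_step) (auto simp: rank_act_adj coord_act_adj m_def)
  moreover have "rank n \<mu> i m = rank n \<mu> (i - 1) m"
    using i by (subst rank_step) (auto simp: m_def)
  ultimately show ?thesis using i by (auto simp: bruhat_le_def intro!: exI[of _ i] exI[of _ m])
qed

lemma ex_descent: "\<not> weakly_increasing n \<mu> \<Longrightarrow> \<exists>i. 1 \<le> i \<and> i < n \<and> coord \<mu> (Suc i) < coord \<mu> i"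
  using mono_steps[of n "coord \<mu>"] unfolding weakly_increasing_def by (meson not_le)

text \<open>Sorting by exchanging descents raises the weight in each step, so the antidominant
  weight is the maximum of its orbit.\<close>

lemma bruhat_le_weakly_increasing:
  assumes "\<mu> \<in> Zn n" "w \<in> Sym n" "weakly_increasing n (act w \<mu>)"
  shows "bruhat_le n \<mu> (act w \<mu>)"
  using assms
proof (induction "card {(k, l) \<in> pairs n. coord \<mu> k > coord \<mu> l}" arbitrary: \<mu> w rule: less_induct)
  case (less \<mu>)
  show ?case
  proof (cases "weakly_increasing n \<mu>")
    case True
    then show ?thesis using weakly_increasing_unique[of \<mu> n w] less by (simp add: bruhat_le_def)
  next
    case False
    then obtain i where i: "1 \<le> i" "i < n" "coord \<mu> (Suc i) < coord \<mu> i"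
      using ex_descent by blast
    note S = adj_Sym[OF i(1,2)]
    define \<nu> where "\<nu> = act (adj i) \<mu>"
    have act: "act (w \<circ> adj i) \<nu> = act w \<mu>"
      by (simp add: \<nu>_def act_comp[OF less(3) S])
    have "card {(k, l) \<in> pairs n. coord \<mu> k > coord \<mu> l} =
        Suc (card {(k, l) \<in> pairs n. coord \<nu> k > coord \<nu> l})"
      by (rule card_pairs_adj[OF i(1,2)]) (use i in \<open>auto simp: \<nu>_def coord_act_adj\<close>)
    then have "bruhat_le n \<nu> (act (w \<circ> adj i) \<nu>)"
      by (intro less(1) Sym_comp less S) (use less act in \<open>auto simp: \<nu>_def act_Zn[OF S]\<close>)
    moreover have "bruhat_le n \<mu> \<nu>"
      unfolding \<nu>_def by (rule bruhat_le_adjI[OF i]) simp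
    ultimately show ?thesis unfolding act bruhat_le_def by (meson order_trans)
  qed
qed

text \<open>An instance of antisymmetry. A descent of \<mu> would give s_i \<mu> below the maximum
  and hence below \<mu>, contradicting \<open>not_bruhat_le_act_adj\<close>.\<close>

lemma weakly_increasing_bruhat_max:
  assumes \<mu>: "\<mu> \<in> Zn n" and w: "w \<in> Sym n" and inc: "weakly_increasing n (act w \<mu>)"
    and le: "bruhat_le n (act w \<mu>) \<mu>"
  shows "act w \<mu> = \<mu>"
proof (rule weakly_increasing_unique[OF \<mu> w _ inc], rule ccontr)
  assume "\<not> weakly_increasing n \<mu>"
  then obtain i where i: "1 \<le> i" "i < n" "coord \<mu> (Suc i) < coord \<mu> i"
    using ex_descent by blast
  note S = adj_Sym[OF i(1,2)]
  define \<nu> where "\<nu> = act (adj i) \<mu>"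
  have act: "act (w \<circ> adj i) \<nu> = act w \<mu>"
    by (simp add: \<nu>_def act_comp[OF w S])
  have "bruhat_le n \<nu> (act (w \<circ> adj i) \<nu>)"
    by (intro bruhat_le_weakly_increasing Sym_comp w S) (use \<mu> inc act in \<open>auto simp: \<nu>_def act_Zn[OF S]\<close>)
  then have "bruhat_le n \<nu> \<mu>"
    using le unfolding act bruhat_le_def by (meson order_trans)
  then show False using not_bruhat_le_act_adj[OF i] by (simp add: \<nu>_def)
qed

section \<open>The rotation of (E1): the length zero generator of the extended affine symmetric
  group\<close>

definition rot :: "nat \<Rightarrow> expo \<Rightarrow> expo" where
  "rot n \<mu> = vec n (\<lambda>i. if i = 1 then coord \<mu> n + 1 else coord \<mu> (i - 1))"

definition unrot :: "nat \<Rightarrow> expo \<Rightarrow> expo" where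
  "unrot n \<mu> = vec n (\<lambda>i. if i = n then coord \<mu> 1 - 1 else coord \<mu> (Suc i))"

lemma coord_rot:
  "coord (rot n \<mu>) i = (if i \<in> {1..n} then if i = 1 then coord \<mu> n + 1 else coord \<mu> (i - 1) else 0)"
  by (simp add: rot_def coord_vec)

lemma coord_unrot:
  "coord (unrot n \<mu>) i = (if i \<in> {1..n} then if i = n then coord \<mu> 1 - 1 else coord \<mu> (Suc i) else 0)"
  by (simp add: unrot_def coord_vec)

lemma rot_Zn [simp]: "rot n \<mu> \<in> Zn n" and unrot_Zn [simp]: "unrot n \<mu> \<in> Zn n"
  by (simp_all add: rot_def unrot_def)

lemma rot_unrot: "\<mu> \<in> Zn n \<Longrightarrow> rot n (unrot n \<mu>) = \<mu>"
  by (rule Zn_eqI[of _ n]) (auto simp: coord_rot coord_unrot)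

lemma unrot_rot: "\<mu> \<in> Zn n \<Longrightarrow> unrot n (rot n \<mu>) = \<mu>"
  by (rule Zn_eqI[of _ n]) (auto simp: coord_rot coord_unrot)

lemma rot_eq_iff: "\<mu> \<in> Zn n \<Longrightarrow> \<nu> \<in> Zn n \<Longrightarrow> rot n \<mu> = rot n \<nu> \<longleftrightarrow> \<mu> = \<nu>"
  by (metis unrot_rot)

lemma const_power_int: "const (a powi k) = const a powi k"
  by (simp add: power_int_def const_power const_inverse)

lemma prod_split_last:
  fixes F :: "nat \<Rightarrow> 'a::comm_monoid_mult"
  assumes "n \<ge> 1"
  shows "(\<Prod>i=1..n. F i) = F n * (\<Prod>i=1..n-1. F i)"
  using assms by (cases n) (simp_all add: mult.commute)

lemma prod_split_first:
  fixes F :: "nat \<Rightarrow> 'a::comm_monoid_mult"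
  assumes "n \<ge> 1"
  shows "(\<Prod>i=1..n. F i) = F 1 * (\<Prod>i=1..n-1. F (Suc i))"
proof -
  obtain m where n: "n = Suc m" using assms by (cases n) auto
  have "(\<Prod>i=1..n. F i) = F 1 * (\<Prod>i=Suc 1..Suc m. F i)"
    unfolding n by (rule prod.atLeast_Suc_atMost) simp
  also have "(\<Prod>i=Suc 1..Suc m. F i) = (\<Prod>i=1..m. F (Suc i))"
    by (rule prod.shift_bounds_cl_Suc_ivl)
  finally show ?thesis by (simp add: n)
qed

lemma sum_split_last:
  fixes F :: "nat \<Rightarrow> 'a::comm_monoid_add"
  assumes "n \<ge> 1"
  shows "(\<Sum>i=1..n. F i) = F n + (\<Sum>i=1..n-1. F i)"
  using assms by (cases n) (simp_all add: add.commute)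

lemma sum_split_first:
  fixes F :: "nat \<Rightarrow> 'a::comm_monoid_add"
  assumes "n \<ge> 1"
  shows "(\<Sum>i=1..n. F i) = F 1 + (\<Sum>i=1..n-1. F (Suc i))"
proof -
  obtain m where n: "n = Suc m" using assms by (cases n) auto
  have "(\<Sum>i=1..n. F i) = F 1 + (\<Sum>i=Suc 1..Suc m. F i)"
    unfolding n by (rule sum.atLeast_Suc_atMost) simp
  also have "(\<Sum>i=Suc 1..Suc m. F i) = (\<Sum>i=1..m. F (Suc i))"
    by (rule sum.shift_bounds_cl_Suc_ivl)
  finally show ?thesis by (simp add: n)
qed

text \<open>Rotation merely relabels the rank functions, which is why it preserves the Bruhat
  order.\<close>

lemma rank_rot_Suc:
  assumes "i < n"
  shows "rank n (rot n \<nu>) (Suc i) m = rank n \<nu> i m"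
proof -
  have n: "n \<ge> 1" using assms by simp
  show ?thesis
    unfolding rank_def sum_split_first[OF n, where F = "\<lambda>r. max 0 (m + of_bool (r \<le> Suc i) - coord (rot n \<nu>) r)"]
      sum_split_last[OF n, where F = "\<lambda>r. max 0 (m + of_bool (r \<le> i) - coord \<nu> r)"]
    using assms by (auto simp: coord_rot intro!: arg_cong2[of _ _ _ _ "(+)"] sum.cong)
qed

text \<open>Index 0 at level m is index n at level m - 1 in the periodic labelling; this explains
  the drop of the level.\<close>

lemma rank_rot_0:
  assumes "n \<ge> 1"
  shows "rank n (rot n \<nu>) 0 m = rank n \<nu> (n - 1) (m - 1)"
  unfolding rank_def sum_split_first[OF assms, where F = "\<lambda>r. max 0 (m + of_bool (r \<le> 0) - coord (rot n \<nu>) r)"]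
    sum_split_last[OF assms, where F = "\<lambda>r. max 0 (m - 1 + of_bool (r \<le> n - 1) - coord \<nu> r)"]
  using assms by (auto simp: coord_rot intro!: arg_cong2[of _ _ _ _ "(+)"] sum.cong)

lemma bruhat_le_rot:
  assumes "n \<ge> 1" "bruhat_le n \<kappa> \<mu>"
  shows "bruhat_le n (rot n \<kappa>) (rot n \<mu>)"
  unfolding bruhat_le_def
proof (intro allI impI)
  fix i m assume "i \<le> n"
  then show "rank n (rot n \<kappa>) i m \<le> rank n (rot n \<mu>) i m"
    using assms by (cases i) (auto simp: rank_rot_0 rank_rot_Suc bruhat_le_def)
qed

lemma rank_shift: "rank n (vec n (\<lambda>i. coord \<nu> i - 1)) i m = rank n \<nu> i (m + 1)"
  unfolding rank_def by (rule sum.cong) (auto simp: coord_vec algebra_simps)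

text \<open>Together with \<open>wt1\<close> a lexicographic measure on nonnegative weights: undoing
  a rotation lowers the total \<open>wt\<close>, and moving a positive entry left past a zero keeps
  \<open>wt\<close> and lowers \<open>wt1\<close>.\<close>

definition wt :: "nat \<Rightarrow> expo \<Rightarrow> nat" where
  "wt n \<mu> = nat (\<Sum>r=1..n. coord \<mu> r)"

definition wt1 :: "nat \<Rightarrow> expo \<Rightarrow> nat" where
  "wt1 n \<mu> = nat (\<Sum>r=1..n. int r * coord \<mu> r)"

lemma wt_unrot:
  assumes "n \<ge> 1" "\<And>j. coord \<mu> j \<ge> 0" "coord \<mu> 1 > 0"
  shows "wt n (unrot n \<mu>) < wt n \<mu>"
proof -
  have "(\<Sum>r=1..n. coord \<mu> r) = coord \<mu> 1 + (\<Sum>i=1..n-1. coord \<mu> (Suc i))"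
    by (rule sum_split_first[OF assms(1)])
  also have "(\<Sum>i=1..n-1. coord \<mu> (Suc i)) = (\<Sum>i=1..n-1. coord (unrot n \<mu>) i)"
    by (rule sum.cong) (auto simp: coord_unrot)
  finally have "(\<Sum>r=1..n. coord \<mu> r) = (\<Sum>r=1..n. coord (unrot n \<mu>) r) + 1"
    using sum_split_last[OF assms(1), of "coord (unrot n \<mu>)"] assms(1) by (simp add: coord_unrot)
  moreover have "(\<Sum>r=1..n. coord (unrot n \<mu>) r) \<ge> 0"
    using assms by (intro sum_nonneg) (auto simp: coord_unrot order.strict_iff_order)
  ultimately show ?thesis by (simp add: wt_def)
qed

lemma unrot_nonneg:
  assumes "\<And>j. coord \<mu> j \<ge> 0" "coord \<mu> 1 > 0"
  shows "coord (unrot n \<mu>) j \<ge> 0"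
  using assms by (auto simp: coord_unrot)

lemma
  assumes i: "1 \<le> i" "i < n"
  shows wt_act_adj: "wt n (act (adj i) \<mu>) = wt n \<mu>"
    and wt1_act_adj: "(\<And>j. coord \<mu> j \<ge> 0) \<Longrightarrow> coord \<mu> i < coord \<mu> (Suc i) \<Longrightarrow>
      wt1 n (act (adj i) \<mu>) < wt1 n \<mu>"
proof -
  have "(\<Sum>r\<in>{1..n} - {i, Suc i}. coord \<mu> (adj i r)) = (\<Sum>r\<in>{1..n} - {i, Suc i}. coord \<mu> r)"
    by (rule sum.cong) auto
  then show "wt n (act (adj i) \<mu>) = wt n \<mu>"
    unfolding wt_def sum_split_adj[OF i] coord_act_adj by simp
  assume pos: "\<And>j. coord \<mu> j \<ge> 0" and less: "coord \<mu> i < coord \<mu> (Suc i)"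
  have "(\<Sum>r\<in>{1..n} - {i, Suc i}. int r * coord \<mu> (adj i r)) = (\<Sum>r\<in>{1..n} - {i, Suc i}. int r * coord \<mu> r)"
    by (rule sum.cong) auto
  then have "(\<Sum>r=1..n. int r * coord (act (adj i) \<mu>) r) = (\<Sum>r=1..n. int r * coord \<mu> r) - (coord \<mu> (Suc i) - coord \<mu> i)"
    unfolding sum_split_adj[OF i] coord_act_adj by (simp add: algebra_simps)
  moreover have "(\<Sum>r=1..n. int r * coord (act (adj i) \<mu>) r) \<ge> 0"
    using pos by (intro sum_nonneg) (simp add: coord_act_adj)
  ultimately show "wt1 n (act (adj i) \<mu>) < wt1 n \<mu>"
    using less by (simp add: wt1_def)
qed

lemma ex_first_positive:
  assumes "\<mu> \<in> Zn n" "\<mu> \<noteq> 0" "\<And>j. coord \<mu> j \<ge> 0" "coord \<mu> 1 = 0"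
  obtains k where "1 \<le> k" "k < n" "\<And>r. 1 \<le> r \<Longrightarrow> r \<le> k \<Longrightarrow> coord \<mu> r = 0" "coord \<mu> (Suc k) > 0"
proof -
  have "\<exists>j. j \<in> {1..n} \<and> coord \<mu> j \<noteq> 0"
    using assms(2) Zn_eqI[OF assms(1) zero_Zn] by (metis lookup_zero)
  then have ex: "\<exists>j. coord \<mu> j \<noteq> 0" by blast
  define l where "l = (LEAST j. coord \<mu> j \<noteq> 0)"
  have l: "coord \<mu> l \<noteq> 0" unfolding l_def using ex by (rule LeastI_ex)
  then have ln: "l \<in> {1..n}" using assms(1) by (metis Zn_iff)
  have "l \<noteq> 1" using l assms(4) by auto
  then obtain k where k: "l = Suc k" "1 \<le> k" using ln by (cases l) auto
  have "coord \<mu> r = 0" if "r \<le> k" for r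
    using not_less_Least[of r "\<lambda>j. coord \<mu> j \<noteq> 0"] that k by (auto simp flip: l_def)
  then show ?thesis
    using that[of k] k ln l assms(3)[of l] by auto
qed

lemma prod_inverse_X: "(\<Prod>i=1..n. inverse (X i)) = xmon (vec n (\<lambda>_. - 1))"
  by (simp add: vec_def xmon_sum xmon_single)

section \<open>Transport of coefficients along the defining relations\<close>

context macdonald_family
begin

lemma E_of_laurent:
  assumes "\<mu> \<in> Zn n"
  obtains f where "E \<mu> = of_laurent f" "Poly_Mapping.keys f \<subseteq> Zn n"
  using E_KX[OF assms] by (auto simp: KX_def)

lemma cf_E_outside: "\<mu> \<in> Zn n \<Longrightarrow> \<kappa> \<notin> Zn n \<Longrightarrow> cf (E \<mu>) \<kappa> = 0"
  by (rule E_of_laurent[of \<mu>]) (auto simp: in_keys_iff)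

lemma E_rot:
  assumes "\<mu> \<in> Zn n"
  shows "E (rot n \<mu>) = const (qq powi coord \<mu> n) * X 1 *
    rat_eval const (\<lambda>i. if i < n then X (i + 1) else const (inverse qq) * X 1) (E \<mu>)"
  using electronic assms unfolding electronic_macdonald_def rot_def by blast

text \<open>The substitution of (E1), followed by multiplication with x_1, sends each monomial to
  its rotated monomial up to a power of q. That power cancels against the prefactor exactly at the
  leading term.\<close>

lemma cf_rot:
  assumes \<mu>: "\<mu> \<in> Zn n" and \<kappa>: "\<kappa> \<in> Zn n"
  shows "cf (E (rot n \<mu>)) (rot n \<kappa>) = qq powi (coord \<mu> n - coord \<kappa> n) * cf (E \<mu>) \<kappa>"
proof -
  define g where "g = (\<lambda>i. if i < n then X (i + 1) else const (inverse qq) * X 1)"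
  interpret rotation: substitution const g
    by unfold_locales (auto simp: const_add const_mult g_def)
  obtain f where f: "E \<mu> = of_laurent f" "Poly_Mapping.keys f \<subseteq> Zn n" using \<mu> by (rule E_of_laurent)
  have mon: "X 1 * (\<Prod>i\<in>Poly_Mapping.keys \<nu>. g i powi coord \<nu> i) = const (qq powi - coord \<nu> n) * xmon (rot n \<nu>)"
    if "\<nu> \<in> Zn n" for \<nu>
  proof -
    have "(\<Prod>i\<in>Poly_Mapping.keys \<nu>. g i powi coord \<nu> i) = (\<Prod>i=1..n. g i powi coord \<nu> i)"
      by (rule prod.mono_neutral_left) (use that in \<open>auto simp: Zn_def in_keys_iff\<close>)
    also have "\<dots> = g n powi coord \<nu> n * (\<Prod>i=1..n-1. g i powi coord \<nu> i)"
      by (rule prod_split_last[OF n_pos])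
    also have "(\<Prod>i=1..n-1. g i powi coord \<nu> i) = (\<Prod>i=1..n-1. X (Suc i) powi coord (rot n \<nu>) (Suc i))"
      by (rule prod.cong) (auto simp: g_def coord_rot)
    finally have 1: "(\<Prod>i\<in>Poly_Mapping.keys \<nu>. g i powi coord \<nu> i) =
      g n powi coord \<nu> n * (\<Prod>i=1..n-1. X (Suc i) powi coord (rot n \<nu>) (Suc i))" .
    have "xmon (rot n \<nu>) = (\<Prod>i=1..n. X i powi coord (rot n \<nu>) i)"
      unfolding xmon_expand
      by (rule prod.mono_neutral_left) (use rot_Zn[of n \<nu>] in \<open>auto simp: Zn_def in_keys_iff\<close>)
    also have "\<dots> = X 1 powi coord (rot n \<nu>) 1 * (\<Prod>i=1..n-1. X (Suc i) powi coord (rot n \<nu>) (Suc i))"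
      by (rule prod_split_first[OF n_pos])
    finally show ?thesis
      unfolding 1 using n_pos
      by (simp add: g_def coord_rot power_int_mult_distrib power_int_add const_power_int const_inverse
          power_int_minus power_int_inverse)
  qed
  define d where "d = (\<lambda>\<nu>. qq powi (coord \<mu> n - coord \<nu> n) * Poly_Mapping.lookup f \<nu>)"
  have "E (rot n \<mu>) = const (qq powi coord \<mu> n) * X 1 * laurent_eval const g f"
    unfolding E_rot[OF \<mu>] f(1) g_def[symmetric] rotation.rat_eval_of_laurent ..
  also have "\<dots> = (\<Sum>\<nu>\<in>Poly_Mapping.keys f. const (qq powi coord \<mu> n) * const (Poly_Mapping.lookup f \<nu>) *
      (X 1 * (\<Prod>i\<in>Poly_Mapping.keys \<nu>. g i powi coord \<nu> i)))"
    unfolding laurent_eval_def sum_distrib_left by (rule sum.cong) (auto simp: mult_ac)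
  also have "\<dots> = (\<Sum>\<nu>\<in>Poly_Mapping.keys f. const (d \<nu>) * xmon (rot n \<nu>))"
  proof (rule sum.cong, rule refl)
    fix \<nu> assume "\<nu> \<in> Poly_Mapping.keys f"
    then have \<nu>: "\<nu> \<in> Zn n" using f(2) by blast
    show "const (qq powi coord \<mu> n) * const (Poly_Mapping.lookup f \<nu>) *
        (X 1 * (\<Prod>i\<in>Poly_Mapping.keys \<nu>. g i powi coord \<nu> i)) = const (d \<nu>) * xmon (rot n \<nu>)"
      unfolding mon[OF \<nu>] by (simp add: d_def const_mult power_int_diff power_int_minus divide_inverse)
  qed
  also have "\<dots> = of_laurent (\<Sum>\<nu>\<in>Poly_Mapping.keys f. Poly_Mapping.single (rot n \<nu>) (d \<nu>))"
    by (simp add: of_laurent_sum single_eq_const_xmon)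
  finally have "cf (E (rot n \<mu>)) (rot n \<kappa>) = (\<Sum>\<nu>\<in>Poly_Mapping.keys f. if rot n \<nu> = rot n \<kappa> then d \<nu> else 0)"
    by (simp add: lookup_sum lookup_single when_def)
  \<comment> \<open>Rotation is injective on Z^n, so no two monomials merge.\<close>
  also have "\<dots> = (\<Sum>\<nu>\<in>Poly_Mapping.keys f. if \<nu> = \<kappa> then d \<nu> else 0)"
    by (rule sum.cong) (use f(2) \<kappa> in \<open>auto simp: rot_eq_iff\<close>)
  also have "\<dots> = d \<kappa>" by (simp add: d_def in_keys_iff)
  finally show ?thesis by (simp add: d_def f(1))
qed

lemma cf_shift:
  assumes \<mu>: "\<mu> \<in> Zn n"
  shows "cf (E (vec n (\<lambda>i. coord \<mu> i - 1))) \<kappa> = cf (E \<mu>) (\<kappa> - vec n (\<lambda>_. - 1))"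
proof -
  obtain f where f: "E \<mu> = of_laurent f" using \<mu> by (rule E_of_laurent)
  have "E (vec n (\<lambda>i. coord \<mu> i - 1)) = of_laurent (Poly_Mapping.single (vec n (\<lambda>_. - 1)) 1 * f)"
    unfolding E_shift[OF \<mu>] prod_inverse_X f by (simp add: xmon_def)
  then show ?thesis unfolding f by (simp only: cf_of_laurent lookup_single_mult_shift mult_1)
qed

text \<open>A nonzero nonnegative weight is undone by a rotation if its first entry is positive;
  otherwise its first positive entry is exchanged with the zero to its left.\<close>

lemma Zn_induct [consumes 1, case_names zero rot adj shift]:
  assumes "\<mu> \<in> Zn n" and zero: "P 0"
    and rot: "\<And>\<mu>. \<mu> \<in> Zn n \<Longrightarrow> P \<mu> \<Longrightarrow> P (rot n \<mu>)"
    and adj: "\<And>\<mu> i. \<mu> \<in> Zn n \<Longrightarrow> 1 \<le> i \<Longrightarrow> i < n \<Longrightarrow> coord \<mu> i > coord \<mu> (Suc i) \<Longrightarrow> P \<mu> \<Longrightarrow>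
      P (act (adj i) \<mu>)"
    and shift: "\<And>\<mu>. \<mu> \<in> Zn n \<Longrightarrow> P \<mu> \<Longrightarrow> P (vec n (\<lambda>i. coord \<mu> i - 1))"
  shows "P \<mu>"
  using assms(1)
proof (induction rule: shift_induct)
  case (nonneg \<mu>)
  then show ?case
  proof (induction \<mu> rule: wf_induct_rule[OF wf_measures[of "[wt n, wt1 n]"]])
    case (1 \<mu>)
    note \<mu> = 1(2) and pos = 1(3) and IH = 1(1)
    consider "\<mu> = 0" | "coord \<mu> 1 > 0" | "\<mu> \<noteq> 0" "coord \<mu> 1 = 0"
      using pos[of 1] by fastforce
    then show ?case
    proof cases
      case 2
      have "P (unrot n \<mu>)"
        by (rule IH) (use wt_unrot[OF n_pos pos 2] unrot_nonneg[OF pos 2] in auto)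
      then show ?thesis using rot[of "unrot n \<mu>"] rot_unrot[OF \<mu>] by simp
    next
      case 3
      obtain k where k: "1 \<le> k" "k < n" "\<And>r. 1 \<le> r \<Longrightarrow> r \<le> k \<Longrightarrow> coord \<mu> r = 0" "coord \<mu> (Suc k) > 0"
        using ex_first_positive[OF \<mu> 3(1) pos 3(2)] by blast
      have k0: "coord \<mu> k = 0" using k by simp
      have \<nu>: "act (adj k) \<mu> \<in> Zn n" using \<mu> k by (simp add: act_Zn[OF adj_Sym])
      have "P (act (adj k) \<mu>)"
        by (rule IH) (use wt_act_adj[OF k(1,2)] wt1_act_adj[OF k(1,2) pos] k k0 pos \<nu> in \<open>auto simp: coord_act_adj\<close>)
      then show ?thesis
        using adj[OF \<nu> k(1,2)] k(4) k0 by (simp add: coord_act_adj)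
    qed (use zero in simp)
  qed
qed (use shift in auto)

text \<open>Rotation and shift only relabel coefficients, up to powers of q. The exchange step
  carries the content: it needs a set of weights stable under s_i and large enough for the new
  support.\<close>

theorem triangular:
  assumes "\<mu> \<in> Zn n"
  shows "cf (E \<mu>) \<mu> = 1 \<and> (\<forall>\<kappa>. cf (E \<mu>) \<kappa> \<noteq> 0 \<longrightarrow> bruhat_le n \<kappa> \<mu>)"
  using assms
proof (induction rule: Zn_induct)
  case zero
  show ?case by (simp add: E_0 cf_1 bruhat_le_def)
next
  case (rot \<mu>)
  have "bruhat_le n \<kappa> (rot n \<mu>)" if "cf (E (rot n \<mu>)) \<kappa> \<noteq> 0" for \<kappa>
  proof -
    have \<kappa>: "\<kappa> \<in> Zn n" using that cf_E_outside[of "rot n \<mu>" \<kappa>] by auto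
    have "cf (E \<mu>) (unrot n \<kappa>) \<noteq> 0"
      using that cf_rot[OF rot(1), of "unrot n \<kappa>"] by (simp add: rot_unrot[OF \<kappa>])
    then show ?thesis
      using bruhat_le_rot[OF n_pos, of "unrot n \<kappa>" \<mu>] rot(2) by (simp add: rot_unrot[OF \<kappa>])
  qed
  then show ?case using cf_rot[OF rot(1,1)] rot(2) by simp
next
  case (adj \<mu> i)
  note i = adj(2,3) and \<mu> = adj(1) and S = adj_Sym[OF adj(2,3)]
  \<comment> \<open>Dropping the condition at index \<open>i\<close> makes the set s_i-stable, since
    the other ranks do not change under s_i. By \<open>bruhat_le_adjI\<close> it still lies below
    s_i \<mu>.\<close>
  define B where "B = {\<kappa>. \<forall>j\<le>n. j \<noteq> i \<longrightarrow> (\<forall>m. rank n \<kappa> j m \<le> rank n \<mu> j m)}"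
  obtain f where f: "E \<mu> = of_laurent f" using \<mu> by (rule E_of_laurent)
  have s\<mu>: "act (adj i) \<mu> \<in> Zn n" using \<mu> by (simp add: act_Zn[OF S])
  obtain g where g: "E (act (adj i) \<mu>) = of_laurent g" using s\<mu> by (rule E_of_laurent)
  define a where "a = yv n \<mu> i / yv n \<mu> (Suc i)"
  define c where "c = (1 - tt) * a / (1 - a)"
  define h where "h = g - Poly_Mapping.single 0 c * f"
  have h: "of_laurent h = hecke i (of_laurent f)"
    using E_adj[OF \<mu> i adj(4)] f g by (simp add: h_def const_def c_def a_def)
  have gh: "Poly_Mapping.lookup g \<kappa> = Poly_Mapping.lookup h \<kappa> + c * Poly_Mapping.lookup f \<kappa>" for \<kappa>
    by (simp add: h_def lookup_minus lookup_single_mult_shift)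
  have B: "\<kappa> \<in> B \<Longrightarrow> act (adj i) \<kappa> \<in> B"
    "\<kappa> \<notin> B \<Longrightarrow> coord \<kappa> i \<ge> coord \<kappa> (Suc i) \<Longrightarrow> root_shift i 1 \<kappa> \<notin> B"
    "\<kappa> \<notin> B \<Longrightarrow> Poly_Mapping.lookup f \<kappa> = 0" for \<kappa>
  proof -
    show "\<kappa> \<in> B \<Longrightarrow> act (adj i) \<kappa> \<in> B" by (simp add: B_def rank_act_adj[OF i])
    show "\<kappa> \<notin> B \<Longrightarrow> coord \<kappa> i \<ge> coord \<kappa> (Suc i) \<Longrightarrow> root_shift i 1 \<kappa> \<notin> B"
      unfolding B_def using rank_root_shift[OF i, of _ \<kappa>] by (blast intro: order_trans)
    have "cf (E \<mu>) \<kappa> \<noteq> 0 \<longrightarrow> bruhat_le n \<kappa> \<mu>" using adj(5) by blast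
    then show "\<kappa> \<notin> B \<Longrightarrow> Poly_Mapping.lookup f \<kappa> = 0"
      unfolding f by (auto simp: B_def bruhat_le_def)
  qed
  \<comment> \<open>\<mu> sits at the end of its root string inside \<open>B\<close>, as
    \<open>hecke_leading\<close> demands.\<close>
  have "root_shift i 1 \<mu> \<notin> B"
  proof
    assume "root_shift i 1 \<mu> \<in> B"
    then have "rank n (root_shift i 1 \<mu>) 0 m \<le> rank n \<mu> 0 m" for m
      using i by (simp add: B_def)
    then show False using rank_root_shift_strict[OF i adj(4)] by (meson not_le)
  qed
  then have "Poly_Mapping.lookup h (act (adj i) \<mu>) = Poly_Mapping.lookup f \<mu>"
    using hecke_leading[OF i h B, of \<mu>] by simp
  \<comment> \<open>The scalar multiple of E_\<mu> in (E2) thus contributes nothing to the leading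
    coefficient.\<close>
  moreover have "Poly_Mapping.lookup f (act (adj i) \<mu>) = 0"
    using adj(5) not_bruhat_le_act_adj[OF i adj(4)] unfolding f by auto
  moreover have "Poly_Mapping.lookup f \<mu> = 1"
    using adj(5) unfolding f by simp
  ultimately have 1: "cf (E (act (adj i) \<mu>)) (act (adj i) \<mu>) = 1"
    by (simp add: g gh)
  have "bruhat_le n \<kappa> (act (adj i) \<mu>)" if "cf (E (act (adj i) \<mu>)) \<kappa> \<noteq> 0" for \<kappa>
  proof -
    have "\<kappa> \<in> B"
      using that B(3)[of \<kappa>] hecke_support[OF i h B, of \<kappa>] unfolding g
      by (cases "\<kappa> \<in> B") (auto simp: gh)
    then show ?thesis by (intro bruhat_le_adjI[OF i adj(4)]) (auto simp: B_def)
  qed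
  then show ?case using 1 by blast
next
  case (shift \<mu>)
  let ?one = "vec n (\<lambda>_. - 1)"
  let ?\<mu> = "vec n (\<lambda>i. coord \<mu> i - 1)"
  have \<mu>: "?\<mu> - ?one = \<mu>"
  proof (rule poly_mapping_eqI)
    fix k show "coord (?\<mu> - ?one) k = coord \<mu> k"
      using shift(1) by (cases "k \<in> {1..n}") (simp_all add: lookup_minus coord_vec Zn_iff del: atLeastAtMost_iff)
  qed
  have "bruhat_le n \<kappa> ?\<mu>" if "cf (E ?\<mu>) \<kappa> \<noteq> 0" for \<kappa>
  proof -
    define \<kappa>' where "\<kappa>' = \<kappa> - ?one"
    have 0: "cf (E \<mu>) \<kappa>' \<noteq> 0" using that by (simp add: cf_shift[OF shift(1)] \<kappa>'_def)
    have "rank n \<kappa> i m = rank n \<kappa>' i (m + 1)" for i m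
      unfolding rank_def by (rule sum.cong) (auto simp: \<kappa>'_def lookup_minus coord_vec algebra_simps)
    then show ?thesis using 0 shift(2) by (auto simp: bruhat_le_def rank_shift)
  qed
  then show ?case using shift(2) by (simp add: cf_shift[OF shift(1)] \<mu>)
qed

end

section \<open>Symmetry of \<open>E\<^sub>\<mu>\<close> when two neighbouring entries agree\<close>

text \<open>The right sides are the coefficients of f after two successive steps of (E2). The left
  sides are the factored forms that a transposition of two variables turns into the coefficient of
  the translate of f.\<close>

lemma demazure_lusztig_identities:
  fixes x y z t ca cb :: "'a::field"
  assumes "x \<noteq> y" "y \<noteq> z" "x \<noteq> z" and c: "ca * (1 + cb) = t * cb"
  defines "\<alpha> \<equiv> \<lambda>u v. (1 - t) * u / (u - v)" and "\<beta> \<equiv> \<lambda>u v. (t * u - v) / (u - v)"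
  shows "(\<alpha> x z + cb) * \<beta> z y = (\<alpha> x y + cb) * (\<alpha> y z + ca) + \<beta> x y * (\<alpha> x z + ca)"
    and "(\<alpha> x z + cb) * \<beta> y x = (\<alpha> y z + cb) * (\<alpha> x y + ca) + \<beta> y z * (\<alpha> x z + ca)"
proof -
  have one: "\<alpha> u v + \<beta> u v = 1" if "u \<noteq> v" for u v
    using that by (simp add: \<alpha>_def \<beta>_def flip: add_divide_distrib) (simp add: algebra_simps)
  have swap: "\<beta> v u = t + \<alpha> u v" if "u \<noteq> v" for u v
    using that by (simp add: \<alpha>_def \<beta>_def divide_simps) (simp add: algebra_simps)
  have cancel: "u - v \<noteq> 0" if "u \<noteq> v" for u v :: 'a using that by simp
  \<comment> \<open>The part free of \<open>ca\<close> and \<open>cb\<close>; the terms with these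
    constants are settled by the hypothesis relating them.\<close>
  have r1: "\<alpha> x z * \<beta> z y = \<alpha> x y * \<alpha> y z + \<beta> x y * \<alpha> x z"
    using assms(1-3) by (simp add: \<alpha>_def \<beta>_def divide_simps) (simp add: algebra_simps)
  have r2: "\<alpha> x z * \<beta> y x = \<alpha> y z * \<alpha> x y + \<beta> y z * \<alpha> x z"
    using assms(1-3) by (simp add: \<alpha>_def \<beta>_def divide_simps) (simp add: algebra_simps)
  have c': "ca + ca * cb = t * cb" using c by (simp add: algebra_simps)
  have "(\<alpha> x y + cb) * (\<alpha> y z + ca) + \<beta> x y * (\<alpha> x z + ca) =
      (\<alpha> x y * \<alpha> y z + \<beta> x y * \<alpha> x z) + (ca * (\<alpha> x y + \<beta> x y) + ca * cb) + cb * \<alpha> y z"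
    by (simp add: algebra_simps)
  also have "\<dots> = \<alpha> x z * \<beta> z y + t * cb + cb * \<alpha> y z"
    by (simp add: one assms(1) r1 c')
  also have "\<dots> = (\<alpha> x z + cb) * \<beta> z y"
    by (simp add: swap assms(2) algebra_simps)
  finally show "(\<alpha> x z + cb) * \<beta> z y = (\<alpha> x y + cb) * (\<alpha> y z + ca) + \<beta> x y * (\<alpha> x z + ca)" ..
  have "(\<alpha> y z + cb) * (\<alpha> x y + ca) + \<beta> y z * (\<alpha> x z + ca) =
      (\<alpha> y z * \<alpha> x y + \<beta> y z * \<alpha> x z) + (ca * (\<alpha> y z + \<beta> y z) + ca * cb) + cb * \<alpha> x y"
    by (simp add: algebra_simps)
  also have "\<dots> = \<alpha> x z * \<beta> y x + t * cb + cb * \<alpha> x y"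
    by (simp add: one assms(2) r2 c')
  also have "\<dots> = (\<alpha> x z + cb) * \<beta> y x"
    by (simp add: swap assms(1) algebra_simps)
  finally show "(\<alpha> x z + cb) * \<beta> y x = (\<alpha> y z + cb) * (\<alpha> x y + ca) + \<beta> y z * (\<alpha> x z + ca)" ..
qed

lemma adj_braid: "adj k \<circ> adj (Suc k) \<circ> adj k = adj (Suc k) \<circ> adj k \<circ> adj (Suc k)"
  by (rule ext) (simp add: transpose_def)

lemma adj_commute: "Suc i < k \<or> Suc k < i \<Longrightarrow> adj i \<circ> adj k = adj k \<circ> adj i"
  by (rule ext) (auto simp: transpose_def)

lemma sX_braid:
  assumes "1 \<le> k" "Suc k < n"
  shows "sX k (sX (Suc k) (sX k f)) = sX (Suc k) (sX k (sX (Suc k) f))"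
proof -
  have S: "adj k \<in> Sym n" "adj (Suc k) \<in> Sym n" using assms by (auto intro!: adj_Sym)
  show ?thesis
    using adj_braid[of k] by (simp add: actX_comp[of _ n] S Sym_comp o_assoc)
qed

lemma hecke_commute:
  assumes "1 \<le> i" "i < n" "1 \<le> k" "k < n" "Suc i < k \<or> Suc k < i"
  shows "sX i (hecke k f) = hecke k (sX i f)"
proof -
  have S: "adj i \<in> Sym n" "adj k \<in> Sym n" using assms by (auto intro!: adj_Sym)
  have "sX i (sX k f) = sX k (sX i f)"
    using adj_commute[OF assms(5)] by (simp add: actX_comp[of _ n] S)
  moreover have "adj i k = k" "adj i (Suc k) = Suc k"
    using assms(5) by (auto simp: transpose_def)
  ultimately show ?thesis
    by (simp add: hecke_eq[OF assms(3)] actX_add[OF S(1)] actX_mult[OF S(1)] actX_diff[OF S(1)] actX_divide[OF S(1)])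
qed

lemma adj_numeral:
  "adj k k = Suc k" "adj k (Suc k) = k" "adj k (Suc (Suc k)) = Suc (Suc k)"
  "adj (Suc k) k = k" "adj (Suc k) (Suc k) = Suc (Suc k)" "adj (Suc k) (Suc (Suc k)) = Suc k"
  by (simp_all add: transpose_def)

text \<open>The weights pass through (c,c,0), (c,0,c), (0,c,c) in the first case and (c,0,0),
  (0,c,0), (0,0,c) in the second. Everything is expanded in the three translates f, G, H of f; the
  reflection in question exchanges the terms of f and G and fixes that of H.\<close>

lemma
  assumes k: "1 \<le> k" "Suc k < n" and c: "ca * (1 + cb) = tt * cb"
  shows sX_hecke_hecke_down: "sX k f = f \<Longrightarrow>
      h = hecke (Suc k) f + const ca * f \<Longrightarrow> g = hecke k h + const cb * h \<Longrightarrow> sX (Suc k) g = g"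
    and sX_hecke_hecke_up: "sX (Suc k) f = f \<Longrightarrow>
      h = hecke k f + const ca * f \<Longrightarrow> g = hecke (Suc k) h + const cb * h \<Longrightarrow> sX k g = g"
proof -
  have S: "adj k \<in> Sym n" "adj (Suc k) \<in> Sym n" using k by (auto intro!: adj_Sym)
  define \<alpha> where "\<alpha> = (\<lambda>u v. (1 - const tt) * u / (u - v))"
  define \<beta> where "\<beta> = (\<lambda>u v. (const tt * u - v) / (u - v))"
  let ?x = "X k" and ?y = "X (Suc k)" and ?z = "X (Suc (Suc k))"
  note hom = actX_add actX_mult
  have ab: "actX w (\<alpha> u v) = \<alpha> (actX w u) (actX w v)" "actX w (\<beta> u v) = \<beta> (actX w u) (actX w v)"
    if "w \<in> Sym n" for w u v
    using that by (simp_all add: \<alpha>_def \<beta>_def actX_divide[OF that] actX_diff[OF that] actX_mult[OF that])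
  have hk: "hecke j u = \<alpha> (X j) (X (Suc j)) * u + \<beta> (X j) (X (Suc j)) * sX j u" if "1 \<le> j" for j u
    using hecke_eq[OF that] by (simp add: \<alpha>_def \<beta>_def)
  have c': "const ca * (1 + const cb) = const tt * const cb"
    using c by (metis const_1 const_add const_mult)
  note s = hom[OF S(1)] hom[OF S(2)] ab[OF S(1)] ab[OF S(2)] adj_numeral
  have kn: "k < n" "1 \<le> Suc k" using k by auto
  {
    assume f: "sX k f = f" and h: "h = hecke (Suc k) f + const ca * f" and g: "g = hecke k h + const cb * h"
    define G where "G = sX (Suc k) f"
    define H where "H = sX k G"
    have act: "sX (Suc k) G = f" "sX (Suc k) f = G" "sX k f = f" "sX k G = H" "sX (Suc k) H = H"
      using sX_braid[OF k, of f] k by (simp_all add: f G_def H_def)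
    have h': "h = (\<alpha> ?y ?z + const ca) * f + \<beta> ?y ?z * G"
      unfolding h hk[OF kn(2)] act by (simp add: algebra_simps)
    have kh: "sX k h = (\<alpha> ?x ?z + const ca) * f + \<beta> ?x ?z * H"
      unfolding h' by (simp add: s act)
    have g': "g = ((\<alpha> ?x ?y + const cb) * (\<alpha> ?y ?z + const ca) + \<beta> ?x ?y * (\<alpha> ?x ?z + const ca)) * f +
        (\<alpha> ?x ?y + const cb) * \<beta> ?y ?z * G + \<beta> ?x ?y * \<beta> ?x ?z * H"
      unfolding g hk[OF k(1)] kh unfolding h' by (simp add: algebra_simps)
    have "((\<alpha> ?x ?y + const cb) * (\<alpha> ?y ?z + const ca) + \<beta> ?x ?y * (\<alpha> ?x ?z + const ca)) =
        (\<alpha> ?x ?z + const cb) * \<beta> ?z ?y"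
      unfolding \<alpha>_def \<beta>_def by (rule demazure_lusztig_identities(1)[OF _ _ _ c', symmetric]) simp_all
    then have g'': "g = (\<alpha> ?x ?z + const cb) * \<beta> ?z ?y * f + (\<alpha> ?x ?y + const cb) * \<beta> ?y ?z * G + \<beta> ?x ?y * \<beta> ?x ?z * H"
      unfolding g' by simp
    show "sX (Suc k) g = g"
      unfolding g'' by (simp add: s act mult.commute)
  }
  {
    assume f: "sX (Suc k) f = f" and h: "h = hecke k f + const ca * f" and g: "g = hecke (Suc k) h + const cb * h"
    define G where "G = sX k f"
    define H where "H = sX (Suc k) G"
    have act: "sX k G = f" "sX k f = G" "sX (Suc k) f = f" "sX (Suc k) G = H" "sX k H = H"
      using sX_braid[OF k, of f] k by (simp_all add: f G_def H_def sX_sX[OF k(1) kn(1)])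
    have h': "h = (\<alpha> ?x ?y + const ca) * f + \<beta> ?x ?y * G"
      unfolding h hk[OF k(1)] act by (simp add: algebra_simps)
    have kh: "sX (Suc k) h = (\<alpha> ?x ?z + const ca) * f + \<beta> ?x ?z * H"
      unfolding h' by (simp add: s act)
    have g': "g = ((\<alpha> ?y ?z + const cb) * (\<alpha> ?x ?y + const ca) + \<beta> ?y ?z * (\<alpha> ?x ?z + const ca)) * f +
        (\<alpha> ?y ?z + const cb) * \<beta> ?x ?y * G + \<beta> ?y ?z * \<beta> ?x ?z * H"
      unfolding g hk[OF kn(2)] kh unfolding h' by (simp add: algebra_simps)
    have "((\<alpha> ?y ?z + const cb) * (\<alpha> ?x ?y + const ca) + \<beta> ?y ?z * (\<alpha> ?x ?z + const ca)) =
        (\<alpha> ?x ?z + const cb) * \<beta> ?y ?x"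
      unfolding \<alpha>_def \<beta>_def by (rule demazure_lusztig_identities(2)[OF _ _ _ c', symmetric]) simp_all
    then have g'': "g = (\<alpha> ?x ?z + const cb) * \<beta> ?y ?x * f + (\<alpha> ?y ?z + const cb) * \<beta> ?x ?y * G + \<beta> ?y ?z * \<beta> ?x ?z * H"
      unfolding g' by simp
    show "sX k g = g"
      unfolding g'' by (simp add: s act mult.commute)
  }
qed

text \<open>Translates the ratio t between the parameters of the two steps into the hypothesis of
  the preceding lemma.\<close>

lemma hecke_coefficient_relation:
  assumes "a = tt * b" "a \<noteq> 1" "b \<noteq> 1"
  shows "(1 - tt) * a / (1 - a) * (1 + (1 - tt) * b / (1 - b)) = tt * ((1 - tt) * b / (1 - b))"
proof -
  have "1 + (1 - tt) * b / (1 - b) = (1 - a) / (1 - b)"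
    using assms by (simp add: divide_simps) (simp add: algebra_simps)
  then show ?thesis using assms by simp
qed

section \<open>Transport of symmetry along rotations\<close>

lemma act_adj_rot: "1 \<le> i \<Longrightarrow> Suc i < n \<Longrightarrow> act (adj (Suc i)) (rot n \<kappa>) = rot n (act (adj i) \<kappa>)"
  by (rule poly_mapping_eqI) (auto simp: coord_act_adj coord_rot transpose_def)

lemma act_adj_rot_rot:
  assumes "n = Suc p" "1 \<le> p"
  shows "act (adj 1) (rot n (rot n \<kappa>)) = rot n (rot n (act (adj p) \<kappa>))"
proof (rule poly_mapping_eqI)
  fix k
  consider "k = 0" | "k = 1" | "k = 2" | l where "k = Suc (Suc l)" "l \<ge> 1"
    by (cases k; cases "k - 1"; cases "k - 2") auto
  then show "coord (act (adj 1) (rot n (rot n \<kappa>))) k = coord (rot n (rot n (act (adj p) \<kappa>))) k"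
    by cases (use assms in \<open>auto simp: coord_act_adj coord_rot transpose_def\<close>)
qed

context macdonald_family
begin

lemma sX_E_eq_iff:
  assumes "\<mu> \<in> Zn n" "1 \<le> i" "i < n"
  shows "sX i (E \<mu>) = E \<mu> \<longleftrightarrow> (\<forall>\<kappa>\<in>Zn n. cf (E \<mu>) (act (adj i) \<kappa>) = cf (E \<mu>) \<kappa>)"
proof -
  obtain f where f: "E \<mu> = of_laurent f" using assms(1) by (rule E_of_laurent)
  have "cf (E \<mu>) (act (adj i) \<kappa>) = cf (E \<mu>) \<kappa>" if "\<kappa> \<notin> Zn n" for \<kappa>
    using that cf_E_outside[OF assms(1)] act_Zn[OF adj_Sym[OF assms(2,3)]] by metis
  then show ?thesis
    using of_laurent_actX_eq_iff[OF assms(2,3), of f] unfolding f cf_of_laurent by blast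
qed

lemma E_symmetric_rot:
  assumes "\<mu> \<in> Zn n" "1 \<le> i" "Suc i < n" "sX i (E \<mu>) = E \<mu>"
  shows "sX (Suc i) (E (rot n \<mu>)) = E (rot n \<mu>)"
proof -
  have i: "i < n" "1 \<le> Suc i" using assms by auto
  note S = adj_Sym[OF assms(2) i(1)]
  have "cf (E (rot n \<mu>)) (act (adj (Suc i)) \<kappa>') = cf (E (rot n \<mu>)) \<kappa>'" if "\<kappa>' \<in> Zn n" for \<kappa>'
  proof -
    define \<kappa> where "\<kappa> = unrot n \<kappa>'"
    have \<kappa>: "\<kappa> \<in> Zn n" "\<kappa>' = rot n \<kappa>" "act (adj i) \<kappa> \<in> Zn n"
      by (simp_all add: \<kappa>_def rot_unrot[OF that] act_Zn[OF S])
    have "coord (act (adj i) \<kappa>) n = coord \<kappa> n"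
      using assms by (auto simp: coord_act_adj transpose_def)
    moreover have "cf (E \<mu>) (act (adj i) \<kappa>) = cf (E \<mu>) \<kappa>"
      using assms(4) \<kappa>(1) unfolding sX_E_eq_iff[OF assms(1,2) i(1)] by blast
    ultimately show ?thesis
      unfolding \<kappa>(2) act_adj_rot[OF assms(2,3)] cf_rot[OF assms(1) \<kappa>(1)] cf_rot[OF assms(1) \<kappa>(3)] by simp
  qed
  then show ?thesis unfolding sX_E_eq_iff[OF rot_Zn i(2) assms(3)] by blast
qed

text \<open>A single rotation never creates the pair at positions 1, 2 from a neighbouring pair, but
  two rotations bring the last pair there. Because \<mu>_p = \<mu>_n, the accumulated power of q is
  symmetric in the last two exponents.\<close>

lemma E_symmetric_rot_rot:
  assumes "\<mu> \<in> Zn n" "n = Suc p" "1 \<le> p" "sX p (E \<mu>) = E \<mu>" "coord \<mu> p = coord \<mu> n"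
  shows "sX 1 (E (rot n (rot n \<mu>))) = E (rot n (rot n \<mu>))"
proof -
  have i: "1 \<le> p" "p < n" "1 < n" using assms by auto
  note S = adj_Sym[OF i(1,2)]
  have cf2: "cf (E (rot n (rot n \<mu>))) (rot n (rot n \<kappa>)) =
      qq powi (coord \<mu> p - coord \<kappa> p) * (qq powi (coord \<mu> n - coord \<kappa> n) * cf (E \<mu>) \<kappa>)"
    if "\<kappa> \<in> Zn n" for \<kappa>
    using cf_rot[OF rot_Zn rot_Zn, of \<mu> \<kappa>] cf_rot[OF assms(1) that] assms(2,3) by (simp add: coord_rot)
  have "cf (E (rot n (rot n \<mu>))) (act (adj 1) \<kappa>') = cf (E (rot n (rot n \<mu>))) \<kappa>'" if "\<kappa>' \<in> Zn n" for \<kappa>'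
  proof -
    define \<kappa> where "\<kappa> = unrot n (unrot n \<kappa>')"
    have \<kappa>: "\<kappa> \<in> Zn n" "\<kappa>' = rot n (rot n \<kappa>)" "act (adj p) \<kappa> \<in> Zn n"
      using rot_unrot[OF that] act_Zn[OF S] by (simp_all add: \<kappa>_def rot_unrot)
    have "coord (act (adj p) \<kappa>) n = coord \<kappa> p" "coord (act (adj p) \<kappa>) p = coord \<kappa> n"
      using assms(2) by (simp_all add: coord_act_adj)
    moreover have "cf (E \<mu>) (act (adj p) \<kappa>) = cf (E \<mu>) \<kappa>"
      using assms(4) \<kappa>(1) unfolding sX_E_eq_iff[OF assms(1) i(1,2)] by blast
    ultimately show ?thesis
      unfolding \<kappa>(2) act_adj_rot_rot[OF assms(2,3)] cf2[OF \<kappa>(1)] cf2[OF \<kappa>(3)] assms(5)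
      by (simp add: mult_ac)
  qed
  then show ?thesis unfolding sX_E_eq_iff[OF rot_Zn order_refl i(3)] by blast
qed

text \<open>
  Induction along (E1) and (E2). The only difficult case is that (E2) has to be applied to
  one of three neighbouring entries \<open>0, c, c\<close> or \<open>0, 0, c\<close>, where two steps of (E2) are
  undone at once; the parameters \<open>a\<close> and \<open>b\<close> of the two steps then satisfy \<open>a = t b\<close>.
\<close>

theorem E_symmetric:
  assumes "\<mu> \<in> Zn n" "1 \<le> i" "i < n" "coord \<mu> i = coord \<mu> (Suc i)"
  shows "sX i (E \<mu>) = E \<mu>"
  using assms
proof (induction arbitrary: i rule: shift_induct)
  case (shift \<mu>)
  have "coord \<mu> i = coord \<mu> (Suc i)" using shift by (simp add: coord_vec)
  then show ?case
    using shift sX_prod_X[OF shift(3,4)] by (simp add: E_shift actX_mult[OF adj_Sym[OF shift(3,4)]])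
next
  case (nonneg \<mu>)
  then show ?case
  proof (induction \<mu> arbitrary: i rule: wf_induct_rule[OF wf_measures[of "[wt n, wt1 n]"]])
    case (1 \<mu>)
    note \<mu> = 1(2) and pos = 1(3) and i = 1(4,5) and eq = 1(6)
    note IH = 1(1)
    \<comment> \<open>A positive first entry allows a rotation to be undone, two of them when the
      pair starts at position 1. Otherwise an exchange is undone.\<close>
    consider "\<mu> = 0" | "coord \<mu> 1 > 0" "i = 1" | i' where "coord \<mu> 1 > 0" "i = Suc i'" "1 \<le> i'" |
      "\<mu> \<noteq> 0" "coord \<mu> 1 = 0"
    proof (cases "coord \<mu> 1 > 0 \<and> i \<noteq> 1")
      case True
      moreover obtain i' where "i = Suc i'" using i(1) by (cases i) auto
      ultimately show ?thesis using that(3)[of i'] i(1) by simp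
    next
      case False
      then show ?thesis
        using pos[of 1] that(1,2,4) by (cases "\<mu> = 0"; cases "coord \<mu> 1 = 0") force+
    qed
    then show ?case
    proof cases
      case 1
      then show ?thesis by (simp add: E_0)
    next
      case 2
      define \<nu> where "\<nu> = unrot n (unrot n \<mu>)"
      have n: "1 < n" using i 2 by simp
      obtain p where p: "n = Suc p" "1 \<le> p" using n by (cases n) auto
      have c2: "coord (unrot n \<mu>) 1 > 0"
        using 2 eq n by (simp add: coord_unrot)
      have \<nu>: "\<nu> \<in> Zn n" "rot n (rot n \<nu>) = \<mu>" by (simp_all add: \<nu>_def rot_unrot[OF \<mu>] rot_unrot)
      have e: "coord \<nu> p = coord \<nu> n" using p 2 eq by (simp add: \<nu>_def coord_unrot)
      have "sX p (E \<nu>) = E \<nu>"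
      proof (rule IH)
        show "(\<nu>, \<mu>) \<in> measures [wt n, wt1 n]"
          using wt_unrot[OF n_pos pos 2(1)] wt_unrot[OF n_pos unrot_nonneg[OF pos 2(1)] c2] by (simp add: \<nu>_def)
        show "coord \<nu> j \<ge> 0" for j
          unfolding \<nu>_def by (intro unrot_nonneg pos 2 c2)
        show "coord \<nu> p = coord \<nu> (Suc p)" using e p by simp
      qed (use p \<nu> in auto)
      then show ?thesis using E_symmetric_rot_rot[OF \<nu>(1) p _ e] 2(2) by (simp add: \<nu>(2))
    next
      case 3
      define \<nu> where "\<nu> = unrot n \<mu>"
      have "sX i' (E \<nu>) = E \<nu>"
      proof (rule IH)
        show "(\<nu>, \<mu>) \<in> measures [wt n, wt1 n]"
          using wt_unrot[OF n_pos pos 3(1)] by (simp add: \<nu>_def)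
        show "coord \<nu> j \<ge> 0" for j
          unfolding \<nu>_def by (intro unrot_nonneg pos 3)
        show "coord \<nu> i' = coord \<nu> (Suc i')" using 3 i eq by (simp add: \<nu>_def coord_unrot)
      qed (use 3 i in \<open>auto simp: \<nu>_def\<close>)
      then show ?thesis
        using E_symmetric_rot[of \<nu> i'] 3 i by (simp add: \<nu>_def rot_unrot[OF \<mu>])
    next
      case 4
      obtain k where k: "1 \<le> k" "k < n" "\<And>r. 1 \<le> r \<Longrightarrow> r \<le> k \<Longrightarrow> coord \<mu> r = 0" "coord \<mu> (Suc k) > 0"
        using ex_first_positive[OF \<mu> 4(1) pos 4(2)] by blast
      have k0: "coord \<mu> k = 0" using k by simp
      note Sk = adj_Sym[OF k(1,2)]
      define \<nu> where "\<nu> = act (adj k) \<mu>"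
      have \<nu>: "\<nu> \<in> Zn n" "act (adj k) \<nu> = \<mu>" using \<mu> by (simp_all add: \<nu>_def act_Zn[OF Sk])
      have \<nu>pos: "coord \<nu> j \<ge> 0" for j using pos by (simp add: \<nu>_def coord_act_adj)
      have \<nu>less: "wt n \<nu> = wt n \<mu>" "wt1 n \<nu> < wt1 n \<mu>"
        using wt_act_adj[OF k(1,2)] wt1_act_adj[OF k(1,2) pos] k k0 by (simp_all add: \<nu>_def)
      have \<nu>k: "coord \<nu> (Suc k) < coord \<nu> k" using k k0 by (simp add: \<nu>_def coord_act_adj)
      define b where "b = yv n \<nu> k / yv n \<nu> (Suc k)"
      define cb where "cb = (1 - tt) * b / (1 - b)"
      have b1: "b \<noteq> 1" using \<nu>k by (simp add: b_def yv_eq_iff)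
      have E\<mu>: "E \<mu> = hecke k (E \<nu>) + const cb * E \<nu>"
        using E_adj[OF \<nu>(1) k(1,2) \<nu>k] by (simp add: \<nu>(2) cb_def b_def)
      \<comment> \<open>The pair at \<open>i\<close> is not the exchanged pair, since \<mu>_k = 0 <
        \<mu>_(k+1). It is either disjoint from it, so that the operators commute, or overlaps it in
        one position.\<close>
      consider "Suc i < k \<or> Suc k < i" | "i = Suc k" | "k = Suc i"
        using eq k(3)[of i] k(4) i(1) by (cases "i = k") (auto, linarith)
      then show ?thesis
      proof cases
        case 1
        have "sX i (E \<nu>) = E \<nu>"
          by (rule IH) (use 1 i k eq \<nu> \<nu>pos \<nu>less in \<open>auto simp: \<nu>_def coord_act_adj transpose_def\<close>)
        then show ?thesis
          unfolding E\<mu> by (simp add: actX_add[OF adj_Sym[OF i]] actX_mult[OF adj_Sym[OF i]] hecke_commute[OF i k(1,2) 1])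
      next
        case 2
        have kn: "1 \<le> Suc k" "Suc k < n" using 2 i by auto
        define \<nu>' where "\<nu>' = act (adj (Suc k)) \<nu>"
        have \<nu>': "\<nu>' \<in> Zn n" "act (adj (Suc k)) \<nu>' = \<nu>" using \<nu> by (simp_all add: \<nu>'_def act_Zn[OF adj_Sym[OF kn]])
        have co: "coord \<nu>' k = coord \<mu> (Suc k)" "coord \<nu>' (Suc k) = coord \<mu> (Suc k)" "coord \<nu>' (Suc (Suc k)) = 0"
          "coord \<nu> (Suc k) = 0" "coord \<nu> (Suc (Suc k)) = coord \<mu> (Suc k)"
          using eq k0 2 by (simp_all add: \<nu>'_def \<nu>_def coord_act_adj adj_numeral)
        have "wt n \<nu>' = wt n \<nu>" "wt1 n \<nu>' < wt1 n \<nu>"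
          using wt_act_adj[OF kn] wt1_act_adj[OF kn \<nu>pos] co k(4) by (simp_all add: \<nu>'_def)
        then have "sX k (E \<nu>') = E \<nu>'"
          by (intro IH) (use \<nu>less \<nu>' \<nu>pos k co in \<open>auto simp: \<nu>'_def coord_act_adj\<close>)
        moreover define a where "a = yv n \<nu>' (Suc k) / yv n \<nu>' (Suc (Suc k))"
        have less: "coord \<nu>' (Suc (Suc k)) < coord \<nu>' (Suc k)" using co k(4) by simp
        have "E \<nu> = hecke (Suc k) (E \<nu>') + const ((1 - tt) * a / (1 - a)) * E \<nu>'"
          using E_adj[OF \<nu>'(1) kn less] by (simp add: \<nu>'(2) a_def)
        \<comment> \<open>Relabelled by the exchange, \<open>b\<close> is the ratio of the spectral
          values of \<nu>' at k and k + 2. Replacing k by k + 1, where the entry is the same,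
          multiplies it by t.\<close>
        moreover have "a = tt * b"
          using yv_act_adj[OF kn, of \<nu>'] yv_Suc[OF k(1,2), of \<nu>'] co less
          by (simp add: a_def b_def \<nu>'(2) adj_numeral)
        moreover have "a \<noteq> 1" using less by (simp add: a_def yv_eq_iff)
        ultimately have "sX (Suc k) (E \<mu>) = E \<mu>"
          using sX_hecke_hecke_down[OF k(1) kn(2) hecke_coefficient_relation _ _ E\<mu>[unfolded cb_def]] b1 by blast
        then show ?thesis using 2 by simp
      next
        case 3
        have kn: "1 \<le> i" "i < n" "Suc i < n" using 3 i k by auto
        define \<nu>' where "\<nu>' = act (adj i) \<nu>"
        have \<nu>': "\<nu>' \<in> Zn n" "act (adj i) \<nu>' = \<nu>" using \<nu> by (simp_all add: \<nu>'_def act_Zn[OF adj_Sym[OF i]])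
        have i0: "coord \<mu> i = 0" using k(3)[of i] 3 i by simp
        have co: "coord \<nu>' i = coord \<mu> (Suc k)" "coord \<nu>' (Suc i) = 0" "coord \<nu>' (Suc (Suc i)) = 0"
          "coord \<nu> i = 0" "coord \<nu> (Suc i) = coord \<mu> (Suc k)" "coord \<nu> (Suc (Suc i)) = 0"
          using i0 k0 3 by (simp_all add: \<nu>'_def \<nu>_def coord_act_adj adj_numeral)
        have "wt n \<nu>' = wt n \<nu>" "wt1 n \<nu>' < wt1 n \<nu>"
          using wt_act_adj[OF i] wt1_act_adj[OF i \<nu>pos] co k(4) by (simp_all add: \<nu>'_def)
        then have "sX (Suc i) (E \<nu>') = E \<nu>'"
          by (intro IH) (use \<nu>less \<nu>' \<nu>pos k co kn in \<open>auto simp: \<nu>'_def coord_act_adj\<close>)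
        moreover define a where "a = yv n \<nu>' i / yv n \<nu>' (Suc i)"
        have less: "coord \<nu>' (Suc i) < coord \<nu>' i" using co k(4) by simp
        have "E \<nu> = hecke i (E \<nu>') + const ((1 - tt) * a / (1 - a)) * E \<nu>'"
          using E_adj[OF \<nu>'(1) i less] by (simp add: \<nu>'(2) a_def)
        moreover have "a = tt * b"
          using yv_act_adj[OF i, of \<nu>'] yv_Suc[of "Suc i" n \<nu>'] co less kn
          by (simp add: a_def b_def \<nu>'(2) adj_numeral 3)
        moreover have "a \<noteq> 1" using less by (simp add: a_def yv_eq_iff)
        ultimately show ?thesis
          using sX_hecke_hecke_up[OF kn(1,3) hecke_coefficient_relation _ _ E\<mu>[unfolded cb_def 3]] b1 by blast
      qed
    qed
  qed
qed

end

section \<open>A symmetrization identity\<close>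

lemma degree_coeff_prod_linear:
  fixes a b :: "'b \<Rightarrow> 'a::comm_ring_1"
  assumes "finite V"
  shows "degree (\<Prod>z\<in>V. [:a z, b z:]) \<le> card V"
    and "coeff (\<Prod>z\<in>V. [:a z, b z:]) (card V) = (\<Prod>z\<in>V. b z)"
proof -
  have "degree (\<Prod>z\<in>V. [:a z, b z:]) \<le> card V \<and> coeff (\<Prod>z\<in>V. [:a z, b z:]) (card V) = (\<Prod>z\<in>V. b z)"
    using assms
  proof (induction V)
    case (insert x V)
    let ?P = "\<Prod>z\<in>V. [:a z, b z:]"
    have "degree ([:a x, b x:] * ?P) \<le> degree [:a x, b x:] + degree ?P"
      by (rule degree_mult_le)
    moreover have "degree [:a x, b x:] \<le> 1" by simp
    moreover have "coeff ?P (Suc (card V)) = 0"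
      using insert by (intro coeff_eq_0) auto
    ultimately show ?case using insert by simp
  qed simp
  then show "degree (\<Prod>z\<in>V. [:a z, b z:]) \<le> card V"
    "coeff (\<Prod>z\<in>V. [:a z, b z:]) (card V) = (\<Prod>z\<in>V. b z)" by auto
qed

text \<open>Comparison of top coefficients in the Lagrange interpolation formula at card V + 1
  nodes; the unnormalized basis polynomials are monic.\<close>

lemma lagrange_leading_coeff:
  fixes Q :: "'a::field poly"
  assumes V: "finite V" "x0 \<notin> V" and Q: "degree Q \<le> card V"
  shows "coeff Q (card V) =
    (\<Sum>x\<in>insert x0 V. poly Q x / (\<Prod>z\<in>insert x0 V - {x}. x - z))"
proof -
  let ?W = "insert x0 V"
  define c where "c x = poly Q x / (\<Prod>z\<in>?W - {x}. x - z)" for x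
  define L where "L x = (\<Prod>z\<in>?W - {x}. [:- z, 1:])" for x
  have card: "card (?W - {x}) = card V" if "x \<in> ?W" for x
    using that V by (simp add: card_Diff_singleton)
  have L: "degree (L x) \<le> card V" "coeff (L x) (card V) = 1" if "x \<in> ?W" for x
    using degree_coeff_prod_linear[of "?W - {x}" uminus "\<lambda>_. 1"] V unfolding card[OF that] L_def by auto
  have Leval: "poly (L x) y = (if y = x then \<Prod>z\<in>?W - {x}. x - z else 0)" if "y \<in> ?W" for x y
    using that V by (auto simp: L_def poly_prod intro!: prod_zero)
  have nz: "(\<Prod>z\<in>?W - {x}. x - z) \<noteq> 0" for x
    using V by auto
  have "Q = (\<Sum>x\<in>?W. smult (c x) (L x))"
  proof (rule poly_eqI_degree[of ?W])
    fix y assume y: "y \<in> ?W"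
    have "poly (\<Sum>x\<in>?W. smult (c x) (L x)) y =
        (\<Sum>x\<in>?W. if x = y then c x * (\<Prod>z\<in>?W - {x}. x - z) else 0)"
      unfolding poly_sum by (rule sum.cong) (auto simp: Leval[OF y])
    also have "\<dots> = c y * (\<Prod>z\<in>?W - {y}. y - z)"
      using y V by simp
    also have "\<dots> = poly Q y"
      using nz[of y] by (simp add: c_def)
    finally show "poly Q y = poly (\<Sum>x\<in>?W. smult (c x) (L x)) y" ..
  next
    have "degree (\<Sum>x\<in>?W. smult (c x) (L x)) \<le> card V"
      using V L(1) by (intro degree_sum_le) (auto intro: order_trans[OF degree_smult_le])
    then show "degree (\<Sum>x\<in>?W. smult (c x) (L x)) < card ?W" "degree Q < card ?W"
      using V Q by auto
  qed
  then have "coeff Q (card V) = (\<Sum>x\<in>?W. c x * coeff (L x) (card V))"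
    by (metis (no_types, lifting) coeff_smult coeff_sum sum.cong)
  also have "\<dots> = (\<Sum>x\<in>?W. c x)"
    by (rule sum.cong) (auto simp: L(2))
  finally show ?thesis by (simp add: c_def)
qed

text \<open>Interpolates the polynomial with factors p X - r z at V and the extra node 0. The node 0
  contributes r ^ card V, and at x in V the factor z = x splits off (p - r) x.\<close>

lemma lagrange_sum:
  fixes p r :: "'a::field"
  assumes V: "finite V" "0 \<notin> V"
  shows "(p - r) * (\<Sum>x\<in>V. \<Prod>z\<in>V - {x}. (p * x - r * z) / (x - z)) = p ^ card V - r ^ card V"
proof -
  define Q where "Q = (\<Prod>z\<in>V. [:- r * z, p:])"
  note Q = degree_coeff_prod_linear[OF V(1), of "\<lambda>z. - r * z" "\<lambda>_. p", folded Q_def]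
  have ev: "poly Q x = (\<Prod>z\<in>V. p * x - r * z)" for x
    by (simp add: Q_def poly_prod algebra_simps)
  have nz: "(\<Prod>z\<in>V. - z) \<noteq> 0" using V by auto
  have "(\<Prod>z\<in>V. - (r * z)) = r ^ card V * (\<Prod>z\<in>V. - z)"
    by (simp flip: prod_constant prod.distrib)
  then have zero: "poly Q 0 / (\<Prod>z\<in>insert 0 V - {0}. 0 - z) = r ^ card V"
    using nz V by (simp add: ev)
  have "p ^ card V = coeff Q (card V)" using Q(2) by simp
  also have "\<dots> = r ^ card V + (\<Sum>x\<in>V. poly Q x / (\<Prod>z\<in>insert 0 V - {x}. x - z))"
    unfolding lagrange_leading_coeff[OF V Q(1)] using V zero by simp
  also have "(\<Sum>x\<in>V. poly Q x / (\<Prod>z\<in>insert 0 V - {x}. x - z)) =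
      (\<Sum>x\<in>V. (p - r) * (\<Prod>z\<in>V - {x}. (p * x - r * z) / (x - z)))"
  proof (rule sum.cong)
    fix x assume x: "x \<in> V"
    then have x0: "x \<noteq> 0" using V by auto
    have "poly Q x = ((p - r) * x) * (\<Prod>z\<in>V - {x}. p * x - r * z)"
      unfolding ev using x V by (subst prod.remove[of _ x]) (auto simp: algebra_simps)
    moreover have "insert 0 V - {x} = insert 0 (V - {x})" using x0 by auto
    then have "(\<Prod>z\<in>insert 0 V - {x}. x - z) = x * (\<Prod>z\<in>V - {x}. x - z)"
      using V by simp
    ultimately show "poly Q x / (\<Prod>z\<in>insert 0 V - {x}. x - z) =
        (p - r) * (\<Prod>z\<in>V - {x}. (p * x - r * z) / (x - z))"
      using x0 by (simp add: prod_dividef)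
  qed simp
  finally show ?thesis by (simp add: sum_distrib_left)
qed

section \<open>Sums over permutations, peeled off at their first entry\<close>

primrec ordered_prod :: "('b \<Rightarrow> 'b \<Rightarrow> 'a::comm_monoid_mult) \<Rightarrow> 'b list \<Rightarrow> 'a" where
  "ordered_prod F [] = 1"
| "ordered_prod F (x # xs) = (\<Prod>z\<in>set xs. F x z) * ordered_prod F xs"

text \<open>The inner sum over arrangements of the remaining elements depends only on their number,
  so it factors out and \<open>lagrange_sum\<close> handles the choice of the first entry.\<close>

lemma sum_permutations_of_set:
  fixes p r :: "'a::field" and y :: "'b \<Rightarrow> 'a"
  assumes "finite A" "inj_on y A" "\<And>x. x \<in> A \<Longrightarrow> y x \<noteq> 0"
  shows "(p - r) ^ card A * (\<Sum>xs\<in>permutations_of_set A.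
      ordered_prod (\<lambda>i j. (p * y i - r * y j) / (y i - y j)) xs) = (\<Prod>k=1..card A. p ^ k - r ^ k)"
  using assms
proof (induction "card A" arbitrary: A)
  case 0
  then show ?case by simp
next
  case (Suc m)
  define F where "F = (\<lambda>i j. (p * y i - r * y j) / (y i - y j))"
  have A: "A \<noteq> {}" "finite A" using Suc by auto
  have card: "card (A - {x}) = m" if "x \<in> A" for x using that Suc(2) A by simp
  have "(\<Sum>xs\<in>permutations_of_set A. ordered_prod F xs) =
      (\<Sum>x\<in>A. \<Sum>xs\<in>(#) x ` permutations_of_set (A - {x}). ordered_prod F xs)"
    unfolding permutations_of_set_nonempty[OF A(1)] using A
    by (intro sum.UNION_disjoint) (auto simp: finite_permutations_of_set)
  also have "\<dots> = (\<Sum>x\<in>A. \<Sum>xs\<in>permutations_of_set (A - {x}). (\<Prod>z\<in>A - {x}. F x z) * ordered_prod F xs)"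
  proof (rule sum.cong, rule refl)
    fix x
    have "(\<Sum>xs\<in>(#) x ` permutations_of_set (A - {x}). ordered_prod F xs) =
        (\<Sum>xs\<in>permutations_of_set (A - {x}). ordered_prod F (x # xs))"
      by (subst sum.reindex) auto
    also have "\<dots> = (\<Sum>xs\<in>permutations_of_set (A - {x}). (\<Prod>z\<in>A - {x}. F x z) * ordered_prod F xs)"
      by (intro sum.cong) (auto dest: permutations_of_setD)
    finally show "(\<Sum>xs\<in>(#) x ` permutations_of_set (A - {x}). ordered_prod F xs) = \<dots>" .
  qed
  finally have "(p - r) ^ card A * (\<Sum>xs\<in>permutations_of_set A. ordered_prod F xs) =
      (p - r) * (\<Sum>x\<in>A. (\<Prod>z\<in>A - {x}. F x z) *
        ((p - r) ^ m * (\<Sum>xs\<in>permutations_of_set (A - {x}). ordered_prod F xs)))"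
    unfolding Suc(2)[symmetric] by (simp add: sum_distrib_left mult_ac)
  also have "(\<Sum>x\<in>A. (\<Prod>z\<in>A - {x}. F x z) *
        ((p - r) ^ m * (\<Sum>xs\<in>permutations_of_set (A - {x}). ordered_prod F xs))) =
      (\<Sum>x\<in>A. (\<Prod>z\<in>A - {x}. F x z) * (\<Prod>k=1..m. p ^ k - r ^ k))"
  proof (intro sum.cong refl)
    fix x assume x: "x \<in> A"
    have "(p - r) ^ card (A - {x}) * (\<Sum>xs\<in>permutations_of_set (A - {x}). ordered_prod F xs) =
        (\<Prod>k=1..card (A - {x}). p ^ k - r ^ k)"
      unfolding F_def by (rule Suc(1)) (use Suc card x in \<open>auto intro: inj_on_subset\<close>)
    then show "(\<Prod>z\<in>A - {x}. F x z) * ((p - r) ^ m * (\<Sum>xs\<in>permutations_of_set (A - {x}). ordered_prod F xs)) =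
        (\<Prod>z\<in>A - {x}. F x z) * (\<Prod>k=1..m. p ^ k - r ^ k)"
      using card[OF x] by simp
  qed
  also have "(p - r) * (\<Sum>x\<in>A. (\<Prod>z\<in>A - {x}. F x z) * (\<Prod>k=1..m. p ^ k - r ^ k)) =
      ((p - r) * (\<Sum>x\<in>A. \<Prod>z\<in>A - {x}. F x z)) * (\<Prod>k=1..m. p ^ k - r ^ k)"
    by (simp add: sum_distrib_right mult.assoc)
  also have "(\<Sum>x\<in>A. \<Prod>z\<in>A - {x}. F x z) = (\<Sum>v\<in>y ` A. \<Prod>u\<in>y ` A - {v}. (p * v - r * u) / (v - u))"
  proof -
    have "(\<Prod>z\<in>A - {x}. F x z) = (\<Prod>u\<in>y ` A - {y x}. (p * y x - r * u) / (y x - u))" if "x \<in> A" for x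
    proof -
      have "y ` A - {y x} = y ` (A - {x})" using Suc(4) that by (auto simp: inj_on_def)
      moreover have "inj_on y (A - {x})" using Suc(4) by (rule inj_on_subset) auto
      ultimately show ?thesis by (simp add: prod.reindex F_def)
    qed
    then show ?thesis using Suc(4) by (simp add: sum.reindex)
  qed
  also have "(p - r) * \<dots> = p ^ card A - r ^ card A"
  proof -
    have "0 \<notin> y ` A" using Suc(5) by (metis imageE)
    then show ?thesis
      using lagrange_sum[of "y ` A" p r] Suc(3) card_image[OF Suc(4)] by simp
  qed
  finally show ?case
    unfolding F_def Suc(2)[symmetric] by (simp add: mult.commute)
qed

lemma ordered_prod_map_upt:
  assumes "inj w" "m \<le> n"
  shows "ordered_prod F (map w [m..<n]) = (\<Prod>(i, j)\<in>{(i, j). m \<le> i \<and> i < j \<and> j < n}. F (w i) (w j))"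
  using assms(2)
proof (induction m rule: inc_induct)
  case (step m)
  have fin: "finite {(i, j). Suc m \<le> i \<and> i < j \<and> j < n}"
    by (rule finite_subset[of _ "{..n} \<times> {..n}"]) auto
  have "{(i, j). m \<le> i \<and> i < j \<and> j < n} = Pair m ` {Suc m..<n} \<union> {(i, j). Suc m \<le> i \<and> i < j \<and> j < n}"
    by (auto simp: image_iff)
  then have "(\<Prod>(i, j)\<in>{(i, j). m \<le> i \<and> i < j \<and> j < n}. F (w i) (w j)) =
      (\<Prod>(i, j)\<in>Pair m ` {Suc m..<n}. F (w i) (w j)) *
      (\<Prod>(i, j)\<in>{(i, j). Suc m \<le> i \<and> i < j \<and> j < n}. F (w i) (w j))"
    using fin by (simp only:) (rule prod.union_disjoint, auto)
  also have "(\<Prod>(i, j)\<in>Pair m ` {Suc m..<n}. F (w i) (w j)) = (\<Prod>j\<in>{Suc m..<n}. F (w m) (w j))"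
    by (subst prod.reindex) (auto simp: inj_on_def)
  also have "\<dots> = (\<Prod>z\<in>set (map w [Suc m..<n]). F (w m) z)"
    using assms(1) by (simp add: prod.reindex inj_on_subset)
  finally show ?case
    using step by (simp add: upt_conv_Cons)
next
  case base
  have "{(i, j). n \<le> i \<and> i < j \<and> j < n} = {}" by auto
  then show ?case by (simp only:) simp
qed

lemma sum_Sym_eq_permutations_of_set:
  "(\<Sum>w\<in>Sym n. G (map w [1..<Suc n])) = (\<Sum>xs\<in>permutations_of_set {1..n}. G xs)"
proof (rule sum.reindex_bij_betw)
  have inj: "inj_on (\<lambda>w. map w [1..<Suc n]) (Sym n)"
  proof (rule inj_onI)
    fix u w assume u: "u \<in> Sym n" and w: "w \<in> Sym n" and eq: "map u [1..<Suc n] = map w [1..<Suc n]"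
    show "u = w"
    proof
      fix i show "u i = w i"
      proof (cases "i \<in> {1..n}")
        case True
        then show ?thesis using eq by (auto simp: map_eq_conv)
      next
        case False
        then show ?thesis using u w by (metis Sym_permutes permutes_not_in)
      qed
    qed
  qed
  have "map w [1..<Suc n] \<in> permutations_of_set {1..n}" if w: "w \<in> Sym n" for w
  proof
    show "set (map w [1..<Suc n]) = {1..n}"
      using permutes_image[OF Sym_permutes[OF w]] by (simp add: atLeastLessThanSuc_atLeastAtMost del: upt_Suc)
    show "distinct (map w [1..<Suc n])"
      using Sym_eq_iff[OF w] by (simp add: distinct_map inj_on_def del: upt_Suc)
  qed
  then have "(\<lambda>w. map w [1..<Suc n]) ` Sym n \<subseteq> permutations_of_set {1..n}" by blast
  \<comment> \<open>Surjectivity by counting: both sets have n! elements.\<close>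
  moreover have "card ((\<lambda>w. map w [1..<Suc n]) ` Sym n) = card (permutations_of_set {1..n})"
  proof -
    have "card (Sym n) = fact n" by (simp add: Sym_def card_permutations)
    then show ?thesis unfolding card_image[OF inj] by simp
  qed
  ultimately have "(\<lambda>w. map w [1..<Suc n]) ` Sym n = permutations_of_set {1..n}"
    by (intro card_subset_eq) auto
  then show "bij_betw (\<lambda>w. map w [1..<Suc n]) (Sym n) (permutations_of_set {1..n})"
    using inj by (simp add: bij_betw_def)
qed

text \<open>For p = 1 and r = t this is the classical formula for the Poincare polynomial of the
  symmetric group. It is stated at an arbitrary point because it is applied both to the variables
  and to the spectral vector.\<close>

theorem symmetrization_identity:
  fixes p r :: "'a::field" and y :: "nat \<Rightarrow> 'a"
  assumes "inj_on y {1..n}" "\<And>i. i \<in> {1..n} \<Longrightarrow> y i \<noteq> 0"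
  shows "(p - r) ^ n * (\<Sum>w\<in>Sym n. \<Prod>(i, j)\<in>pairs n.
      (p * y (w i) - r * y (w j)) / (y (w i) - y (w j))) = (\<Prod>k=1..n. p ^ k - r ^ k)"
proof -
  let ?F = "\<lambda>i j. (p * y i - r * y j) / (y i - y j)"
  have pairs: "pairs n = {(i, j). 1 \<le> i \<and> i < j \<and> j < Suc n}" by (auto simp: pairs_def)
  have "(\<Sum>w\<in>Sym n. \<Prod>(i, j)\<in>pairs n. ?F (w i) (w j)) = (\<Sum>w\<in>Sym n. ordered_prod ?F (map w [1..<Suc n]))"
  proof (rule sum.cong)
    fix w assume "w \<in> Sym n"
    then have "inj w" using Sym_permutes permutes_inj by blast
    then show "(\<Prod>(i, j)\<in>pairs n. ?F (w i) (w j)) = ordered_prod ?F (map w [1..<Suc n])"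
      unfolding pairs by (rule ordered_prod_map_upt[symmetric]) simp
  qed simp
  then show ?thesis
    unfolding sum_Sym_eq_permutations_of_set using sum_permutations_of_set[of "{1..n}" y p r] assms by simp
qed

section \<open>Sums over orbits and over the symmetric group\<close>

text \<open>The coefficients of both claimed expansions, with the factor of a single inversion as
  parameter.\<close>

definition inversion_prod :: "nat \<Rightarrow> (K \<Rightarrow> K) \<Rightarrow> expo \<Rightarrow> K" where
  "inversion_prod n h \<mu> =
    (\<Prod>(k, l)\<in>pairs n. if coord \<mu> k > coord \<mu> l then h (yv n \<mu> k / yv n \<mu> l) else 1)"

text \<open>Collects the factors met along a chain of (E2) steps from the dominant weight to \<mu>;
  this form shows that the chain does not matter.\<close>

definition noninversion_prod :: "nat \<Rightarrow> (K \<Rightarrow> K) \<Rightarrow> expo \<Rightarrow> K" where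
  "noninversion_prod n h \<mu> =
    (\<Prod>(k, l)\<in>pairs n. if coord \<mu> k < coord \<mu> l then h (yv n \<mu> l / yv n \<mu> k) else 1)"

text \<open>Only the pair (i, i+1) changes its status. The other pairs are permuted by s_i, and the
  spectral values are permuted along with them.\<close>

lemma
  assumes i: "1 \<le> i" "i < n" "coord \<mu> i > coord \<mu> (Suc i)"
  defines "a \<equiv> yv n \<mu> i / yv n \<mu> (Suc i)"
  shows inversion_prod_adj: "inversion_prod n h \<mu> = h a * inversion_prod n h (act (adj i) \<mu>)"
    and noninversion_prod_adj: "noninversion_prod n h (act (adj i) \<mu>) = h a * noninversion_prod n h \<mu>"
proof -
  have ne: "coord \<mu> i \<noteq> coord \<mu> (Suc i)" using i(3) by simp
  let ?S = "pairs n - {(i, Suc i)}"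
  have "inversion_prod n h \<mu> =
      h a * (\<Prod>(k, l)\<in>?S. if coord \<mu> k > coord \<mu> l then h (yv n \<mu> k / yv n \<mu> l) else 1)"
    unfolding inversion_prod_def by (subst prod_pairs_remove[OF i(1,2)]) (use i(3) in \<open>simp add: a_def\<close>)
  moreover have "inversion_prod n h (act (adj i) \<mu>) =
      (\<Prod>(k, l)\<in>?S. if coord \<mu> k > coord \<mu> l then h (yv n \<mu> k / yv n \<mu> l) else 1)"
    unfolding inversion_prod_def coord_act_adj yv_act_adj[OF i(1,2) ne]
    by (subst prod_pairs_adj[OF i(1,2)]) (use i(3) in \<open>simp cong: if_cong\<close>)
  ultimately show "inversion_prod n h \<mu> = h a * inversion_prod n h (act (adj i) \<mu>)" by simp
  have "noninversion_prod n h \<mu> =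
      (\<Prod>(k, l)\<in>?S. if coord \<mu> k < coord \<mu> l then h (yv n \<mu> l / yv n \<mu> k) else 1)"
    unfolding noninversion_prod_def by (subst prod_pairs_remove[OF i(1,2)]) (use i(3) in simp)
  moreover have "noninversion_prod n h (act (adj i) \<mu>) =
      h a * (\<Prod>(k, l)\<in>?S. if coord \<mu> k < coord \<mu> l then h (yv n \<mu> l / yv n \<mu> k) else 1)"
    unfolding noninversion_prod_def coord_act_adj yv_act_adj[OF i(1,2) ne]
    by (subst prod_pairs_adj[OF i(1,2)]) (use i(3) in \<open>simp add: a_def cong: if_cong\<close>)
  ultimately show "noninversion_prod n h (act (adj i) \<mu>) = h a * noninversion_prod n h \<mu>" by simp
qed

lemma sum_orbit_adj:
  fixes f :: "expo \<Rightarrow> 'a::comm_monoid_add"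
  assumes "1 \<le> i" "i < n"
  shows "(\<Sum>\<mu>\<in>orbit n lam. f \<mu>) =
    (\<Sum>\<mu>\<in>{\<mu> \<in> orbit n lam. coord \<mu> i = coord \<mu> (Suc i)}. f \<mu>) +
    (\<Sum>\<mu>\<in>{\<mu> \<in> orbit n lam. coord \<mu> i > coord \<mu> (Suc i)}. f \<mu> + f (act (adj i) \<mu>))"
proof -
  let ?E = "{\<mu> \<in> orbit n lam. coord \<mu> i = coord \<mu> (Suc i)}"
  let ?G = "{\<mu> \<in> orbit n lam. coord \<mu> i > coord \<mu> (Suc i)}"
  let ?L = "{\<mu> \<in> orbit n lam. coord \<mu> i < coord \<mu> (Suc i)}"
  note S = adj_Sym[OF assms]
  have "(\<Sum>\<mu>\<in>orbit n lam. f \<mu>) = (\<Sum>\<mu>\<in>?E \<union> (?G \<union> ?L). f \<mu>)"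
    by (rule sum.cong) auto
  also have "\<dots> = (\<Sum>\<mu>\<in>?E. f \<mu>) + ((\<Sum>\<mu>\<in>?G. f \<mu>) + (\<Sum>\<mu>\<in>?L. f \<mu>))"
    by (subst sum.union_disjoint, simp_all, force, subst sum.union_disjoint, auto)
  also have "(\<Sum>\<mu>\<in>?L. f \<mu>) = (\<Sum>\<mu>\<in>?G. f (act (adj i) \<mu>))"
    by (rule sum.reindex_bij_witness[of _ "act (adj i)" "act (adj i)"])
       (auto simp: coord_act_adj act_orbit[OF S])
  finally show ?thesis by (simp add: sum.distrib)
qed

lemma sum_Sym_comp_adj:
  assumes "1 \<le> i" "i < n"
  shows "(\<Sum>w\<in>Sym n. f (w \<circ> adj i)) = (\<Sum>w\<in>Sym n. f w)"
  by (rule sum.reindex_bij_witness[of _ "\<lambda>w. w \<circ> adj i" "\<lambda>w. w \<circ> adj i"])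
     (auto simp: comp_assoc Sym_comp adj_Sym[OF assms])

lemma sum_Sym_inv: "(\<Sum>w\<in>Sym n. f (inv w)) = (\<Sum>w\<in>Sym n. f w)"
  by (rule sum.reindex_bij_witness[of _ inv inv]) (auto simp: Sym_inv Sym_inv_simps(5))

lemma sign_comp_adj:
  assumes "w \<in> Sym n" "1 \<le> i" "i < n"
  shows "(- 1 :: 'a::ring_1) ^ len n (w \<circ> adj i) = - ((- 1) ^ len n w)"
proof -
  have "w i \<noteq> w (Suc i)" using Sym_eq_iff[OF assms(1)] by simp
  then show ?thesis
    using len_comp_adj_ascent[OF assms(2,3), of w] len_comp_adj_descent[OF assms(2,3), of w]
    by (cases "w i < w (Suc i)") auto
qed

text \<open>The two choices \<open>(1, t)\<close> and \<open>(- t, - 1)\<close> of \<open>(p, r)\<close> give the kernels of \<open>P\<close> and \<open>A\<close>.\<close>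

definition cfun :: "K \<Rightarrow> K \<Rightarrow> nat \<Rightarrow> nat \<Rightarrow> ratfun" where
  "cfun p r k l = (const p * X k - const r * X l) / (X k - X l)"

definition cprod :: "nat \<Rightarrow> K \<Rightarrow> K \<Rightarrow> ratfun" where
  "cprod n p r = (\<Prod>(k, l)\<in>pairs n. cfun p r k l)"

lemma actX_cfun: "w \<in> Sym n \<Longrightarrow> actX w (cfun p r k l) = cfun p r (w k) (w l)"
  by (simp add: cfun_def actX_divide actX_diff actX_mult)

lemma actX_cprod: "w \<in> Sym n \<Longrightarrow> actX w (cprod n p r) = (\<Prod>(k, l)\<in>pairs n. cfun p r (w k) (w l))"
  by (simp add: cprod_def actX_prod case_prod_beta actX_cfun)

lemma cfun_nonzero:
  assumes "k \<noteq> l" "p \<noteq> 0"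
  shows "cfun p r k l \<noteq> 0"
proof -
  let ?f = "Poly_Mapping.single (Poly_Mapping.single k (1::int)) p - Poly_Mapping.single (Poly_Mapping.single l (1::int)) r"
  have ne: "Poly_Mapping.single l (1::int) \<noteq> Poly_Mapping.single k 1"
    using assms(1) by (metis lookup_single_eq lookup_single_not_eq zero_neq_one)
  have "Poly_Mapping.lookup ?f (Poly_Mapping.single k 1) = p"
    using ne by (simp add: lookup_minus lookup_single)
  then have "?f \<noteq> 0" using assms(2) by (metis lookup_zero)
  then have "of_laurent ?f \<noteq> 0" by (metis of_laurent_eq_iff of_laurent_hom(1))
  moreover have "of_laurent ?f = const p * X k - const r * X l"
    by (simp only: of_laurent_hom single_eq_const_xmon xmon_single_1)
  ultimately have "const p * X k - const r * X l \<noteq> 0" by (simp only: not_False_eq_True)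
  then show ?thesis using assms(1) by (simp add: cfun_def)
qed

lemma cprod_nonzero: "p \<noteq> 0 \<Longrightarrow> cprod n p r \<noteq> 0"
  unfolding cprod_def prod_zero_iff[OF finite_pairs] by (auto simp: pairs_def cfun_nonzero)

text \<open>Isolates the only factor of the kernel that is not permuted among the others by
  s_i.\<close>

lemma cprod_split:
  assumes "1 \<le> i" "i < n"
  obtains c where "cprod n p r = cfun p r i (Suc i) * c" "sX i c = c"
proof
  let ?S = "pairs n - {(i, Suc i)}"
  show "cprod n p r = cfun p r i (Suc i) * (\<Prod>(k, l)\<in>?S. cfun p r k l)"
    unfolding cprod_def by (rule prod_pairs_remove[OF assms])
  have "sX i (\<Prod>(k, l)\<in>?S. cfun p r k l) = (\<Prod>(k, l)\<in>?S. cfun p r (adj i k) (adj i l))"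
    by (simp add: actX_prod[OF adj_Sym[OF assms]] case_prod_beta actX_cfun[OF adj_Sym[OF assms]])
  also have "\<dots> = (\<Prod>(k, l)\<in>?S. cfun p r k l)"
    by (subst prod.reindex_bij_betw[OF bij_betw_adj_pairs[OF assms], symmetric]) (simp add: case_prod_beta)
  finally show "sX i (\<Prod>(k, l)\<in>?S. cfun p r k l) = (\<Prod>(k, l)\<in>?S. cfun p r k l)" .
qed

lemma sum_actX_cprod:
  assumes "p \<noteq> r"
  shows "(\<Sum>w\<in>Sym n. actX w (cprod n p r)) = const ((\<Prod>k=1..n. p ^ k - r ^ k) / (p - r) ^ n)"
proof -
  have "(const p - const r) ^ n * (\<Sum>w\<in>Sym n. \<Prod>(i, j)\<in>pairs n.
      (const p * X (w i) - const r * X (w j)) / (X (w i) - X (w j))) = (\<Prod>k=1..n. const p ^ k - const r ^ k)"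
    by (rule symmetrization_identity) (auto simp: inj_on_def)
  moreover have "(\<Sum>w\<in>Sym n. \<Prod>(i, j)\<in>pairs n.
      (const p * X (w i) - const r * X (w j)) / (X (w i) - X (w j))) = (\<Sum>w\<in>Sym n. actX w (cprod n p r))"
    by (rule sum.cong) (auto simp: actX_cprod cfun_def)
  ultimately have "const ((p - r) ^ n) * (\<Sum>w\<in>Sym n. actX w (cprod n p r)) = const (\<Prod>k=1..n. p ^ k - r ^ k)"
    by (simp add: const_power const_diff const_prod)
  moreover have "const ((p - r) ^ n) \<noteq> 0" using assms by simp
  ultimately show ?thesis by (simp add: const_divide nonzero_eq_divide_eq mult.commute)
qed

section \<open>Symmetrization and antisymmetrization of Hecke operators\<close>

lemma symm_sum_eq: "symm_sum n f = (\<Sum>w\<in>Sym n. actX w (f * cprod n 1 tt))"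
  by (simp add: symm_sum_def cprod_def cfun_def)

lemma symm_sum_add: "symm_sum n (f + g) = symm_sum n f + symm_sum n g"
  by (simp add: symm_sum_eq distrib_right actX_add[of _ n] sum.distrib)

lemma symm_sum_const: "symm_sum n (const c * f) = const c * symm_sum n f"
  by (simp add: symm_sum_eq mult.assoc actX_mult[of _ n] sum_distrib_left)

lemma symm_sum_sum: "symm_sum n (\<Sum>x\<in>A. f x) = (\<Sum>x\<in>A. symm_sum n (f x))"
  by (induction A rule: infinite_finite_induct) (auto simp: symm_sum_add, simp_all add: symm_sum_eq)

text \<open>The factor s_i - 1 is what symmetrization annihilates, and its prefactor is what later
  splits off from the antisymmetric sum.\<close>

lemma hecke_minus_self:
  assumes "1 \<le> i"
  shows "hecke i f - f = cfun tt 1 i (Suc i) * (sX i f - f)"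
  unfolding hecke_eq[OF assms] cfun_def by (simp add: divide_simps) (simp add: algebra_simps)

text \<open>Multiplied by the kernel, (T_i - 1) f becomes s_i (G f) - G f with an s_i-invariant G,
  and such differences sum to zero over the group.\<close>

lemma symm_sum_hecke:
  assumes "1 \<le> i" "i < n"
  shows "symm_sum n (hecke i f) = symm_sum n f"
proof -
  note S = adj_Sym[OF assms]
  obtain c where c: "cprod n 1 tt = cfun 1 tt i (Suc i) * c" "sX i c = c"
    using assms by (rule cprod_split)
  define G where "G = cfun tt 1 i (Suc i) * cprod n 1 tt"
  have flip: "cfun 1 tt (Suc i) i = cfun tt 1 i (Suc i)" "cfun tt 1 (Suc i) i = cfun 1 tt i (Suc i)"
    by (simp_all add: cfun_def divide_simps) (simp_all add: algebra_simps)
  have "sX i G = G"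
    by (simp add: G_def c actX_mult[OF S] actX_cfun[OF S] flip)
  then have G: "(hecke i f - f) * cprod n 1 tt = sX i (G * f) - G * f"
    by (simp add: hecke_minus_self[OF assms(1)] actX_mult[OF S]) (simp add: G_def algebra_simps)
  have "symm_sum n (hecke i f) = symm_sum n f + symm_sum n (hecke i f - f)"
    by (simp flip: symm_sum_add)
  also have "symm_sum n (hecke i f - f) = (\<Sum>w\<in>Sym n. actX w (sX i (G * f)) - actX w (G * f))"
    unfolding symm_sum_eq G by (rule sum.cong) (auto simp: actX_diff)
  also have "\<dots> = (\<Sum>w\<in>Sym n. actX (w \<circ> adj i) (G * f)) - (\<Sum>w\<in>Sym n. actX w (G * f))"
    by (simp add: sum_subtractf actX_comp[OF _ S])
  also have "\<dots> = 0" by (simp add: sum_Sym_comp_adj[OF assms, of "\<lambda>w. actX w (G * f)"])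
  finally show ?thesis by simp
qed

definition alt_sum :: "nat \<Rightarrow> ratfun \<Rightarrow> ratfun" where
  "alt_sum n f = (\<Sum>w\<in>Sym n. (- 1) ^ len n w * actX w f)"

lemma alt_sum_add: "alt_sum n (f + g) = alt_sum n f + alt_sum n g"
  by (simp add: alt_sum_def distrib_left actX_add[of _ n] sum.distrib)

lemma alt_sum_const: "alt_sum n (const c * f) = const c * alt_sum n f"
  by (simp add: alt_sum_def mult.left_commute actX_mult[of _ n] sum_distrib_left)

lemma alt_sum_sum: "alt_sum n (\<Sum>x\<in>A. f x) = (\<Sum>x\<in>A. alt_sum n (f x))"
  by (induction A rule: infinite_finite_induct) (auto simp: alt_sum_add, simp_all add: alt_sum_def)

lemma alt_sum_sX:
  assumes "1 \<le> i" "i < n"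
  shows "alt_sum n (sX i f) = - alt_sum n f"
proof -
  note S = adj_Sym[OF assms]
  have "alt_sum n (sX i f) = (\<Sum>w\<in>Sym n. - ((- 1) ^ len n (w \<circ> adj i) * actX (w \<circ> adj i) f))"
    unfolding alt_sum_def by (rule sum.cong) (auto simp: actX_comp[OF _ S] sign_comp_adj[OF _ assms])
  also have "\<dots> = - alt_sum n f"
    by (simp add: sum_negf alt_sum_def sum_Sym_comp_adj[OF assms, of "\<lambda>w. (- 1) ^ len n w * actX w f"])
  finally show ?thesis .
qed

text \<open>T_i f equals \<alpha> f plus s_i applied to (t + \<alpha>) f. Antisymmetrization
  reverses the sign of the second part, and the \<alpha> terms cancel.\<close>

lemma alt_sum_hecke:
  assumes "1 \<le> i" "i < n"
  shows "alt_sum n (hecke i f) = - const tt * alt_sum n f"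
proof -
  note S = adj_Sym[OF assms]
  define \<alpha> where "\<alpha> = (1 - const tt) * X i / (X i - X (Suc i))"
  have \<alpha>: "cfun tt 1 (Suc i) i = const tt + \<alpha>"
    by (simp add: cfun_def \<alpha>_def divide_simps) (simp add: algebra_simps)
  have "hecke i f = \<alpha> * f + sX i ((const tt + \<alpha>) * f)"
    unfolding hecke_eq[OF assms(1)] \<alpha>[symmetric] actX_mult[OF S] actX_cfun[OF S]
    by (simp add: \<alpha>_def cfun_def)
  then have "alt_sum n (hecke i f) = alt_sum n (\<alpha> * f) - alt_sum n (const tt * f + \<alpha> * f)"
    by (simp add: alt_sum_add alt_sum_sX[OF assms] distrib_right)
  then show ?thesis by (simp add: alt_sum_add alt_sum_const)
qed

lemma actX_symmetric:
  assumes "\<And>i. 1 \<le> i \<Longrightarrow> i < n \<Longrightarrow> sX i z = z" "w \<in> Sym n"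
  shows "actX w z = z"
  using assms(2)
proof (induction rule: Sym_induct)
  case (adj w i)
  show ?case
    unfolding actX_comp[OF adj(1) adj_Sym[OF adj(2,3)], symmetric] assms(1)[OF adj(2,3)] by (rule adj(5))
qed (simp only: actX_id)

lemma actX_antisymmetric:
  assumes "\<And>i. 1 \<le> i \<Longrightarrow> i < n \<Longrightarrow> sX i z = - z" "w \<in> Sym n"
  shows "actX w z = (- 1) ^ len n w * z"
  using assms(2)
proof (induction rule: Sym_induct)
  case id
  have "Inv n id = {}" by (auto simp: Inv_def)
  then show ?case unfolding len_def by (simp only: actX_id card.empty power_0 mult_1)
next
  case (adj w i)
  show ?case
    unfolding actX_comp[OF adj(1) adj_Sym[OF adj(2,3)], symmetric] assms(1)[OF adj(2,3)]
      actX_uminus[OF adj(1)] len_comp_adj_ascent[of i n w, OF adj(2-4)] adj(5) by simp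
qed

section \<open>The symmetric expansion\<close>

locale dominant_weight = macdonald_family +
  fixes lam :: expo
  assumes lam: "lam \<in> Zn n" "weakly_decreasing n lam"
begin

lemma E_adj_orbit:
  assumes "\<mu> \<in> orbit n lam" "1 \<le> i" "i < n" "coord \<mu> i > coord \<mu> (Suc i)"
  defines "a \<equiv> yv n \<mu> i / yv n \<mu> (Suc i)"
  shows "E (act (adj i) \<mu>) = hecke i (E \<mu>) + const ((1 - tt) * a / (1 - a)) * E \<mu>" and "a \<noteq> 1"
  using E_adj[OF orbit_Zn[OF lam(1) assms(1)] assms(2-4)] assms(4) by (simp_all add: a_def yv_eq_iff)

text \<open>The factor is forced: added to the scalar (1 - t) a / (1 - a) of (E2) it gives t, so
  that the terms at \<mu> and s_i \<mu> combine into T_i + t.\<close>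

definition "P_coeff = inversion_prod n (\<lambda>a. (tt - a) / (1 - a))"

text \<open>Here the factor and the scalar of (E2) add up to -1, which produces T_i - 1.\<close>

definition "A_coeff = inversion_prod n (\<lambda>a. - (1 - tt * a) / (1 - a))"

definition "P_expansion = (\<Sum>\<mu>\<in>orbit n lam. const (P_coeff \<mu>) * E \<mu>)"

definition "A_expansion = (\<Sum>\<mu>\<in>orbit n lam. const (A_coeff \<mu>) * E \<mu>)"

lemma sX_P_expansion:
  assumes i: "1 \<le> i" "i < n"
  shows "sX i P_expansion = P_expansion"
proof -
  note S = adj_Sym[OF i]
  have eq: "sX i (const (P_coeff \<mu>) * E \<mu>) = const (P_coeff \<mu>) * E \<mu>"
    if "\<mu> \<in> {\<mu> \<in> orbit n lam. coord \<mu> i = coord \<mu> (Suc i)}" for \<mu>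
    using that E_symmetric[OF orbit_Zn[OF lam(1)] i] by (simp add: actX_mult[OF S])
  \<comment> \<open>T_i + t is multiplication by a rational function followed by 1 + s_i.\<close>
  have sym: "sX i (hecke i f + const tt * f) = hecke i f + const tt * f" for f
  proof -
    have "cfun tt 1 (Suc i) i = const tt + (1 - const tt) * X i / (X i - X (Suc i))"
      by (simp add: cfun_def divide_simps) (simp add: algebra_simps)
    then have "hecke i f + const tt * f = cfun tt 1 (Suc i) i * f + cfun tt 1 i (Suc i) * sX i f"
      unfolding hecke_eq[OF i(1)] by (simp add: cfun_def algebra_simps)
    then show ?thesis by (simp add: actX_add[OF S] actX_mult[OF S] actX_cfun[OF S] sX_sX[OF i])
  qed
  have gt: "const (P_coeff \<mu>) * E \<mu> + const (P_coeff (act (adj i) \<mu>)) * E (act (adj i) \<mu>) =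
      const (P_coeff (act (adj i) \<mu>)) * (hecke i (E \<mu>) + const tt * E \<mu>)"
    if \<mu>: "\<mu> \<in> orbit n lam" "coord \<mu> i > coord \<mu> (Suc i)" for \<mu>
  proof -
    define a where "a = yv n \<mu> i / yv n \<mu> (Suc i)"
    have a: "a \<noteq> 1" "E (act (adj i) \<mu>) = hecke i (E \<mu>) + const ((1 - tt) * a / (1 - a)) * E \<mu>"
      using E_adj_orbit[OF \<mu>(1) i \<mu>(2)] by (simp_all add: a_def)
    define b where "b = (tt - a) / (1 - a)"
    define c where "c = (1 - tt) * a / (1 - a)"
    have P: "P_coeff \<mu> = b * P_coeff (act (adj i) \<mu>)"
      unfolding P_coeff_def inversion_prod_adj[OF i \<mu>(2)] by (simp add: a_def b_def)
    have "b + c = tt"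
      using a(1) by (simp add: b_def c_def divide_simps) (simp add: algebra_simps)
    then have t: "const tt = const b + const c" by (simp flip: const_add)
    show ?thesis
      unfolding a(2) c_def[symmetric] P t const_mult by (simp add: algebra_simps)
  qed
  have gt': "sX i (const (P_coeff \<mu>) * E \<mu> + const (P_coeff (act (adj i) \<mu>)) * E (act (adj i) \<mu>)) =
      const (P_coeff \<mu>) * E \<mu> + const (P_coeff (act (adj i) \<mu>)) * E (act (adj i) \<mu>)"
    if "\<mu> \<in> {\<mu> \<in> orbit n lam. coord \<mu> (Suc i) < coord \<mu> i}" for \<mu>
    using that by (simp only: mem_Collect_eq gt actX_mult[OF S] actX_const sym)
  show ?thesis
    unfolding P_expansion_def sum_orbit_adj[OF i]
    by (subst actX_add[OF S], subst (1 2) actX_sum[OF S]) (simp only: eq gt' cong: sum.cong)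
qed

end

context dominant_weight
begin

lemma P_expansion_of_laurent:
  obtains F where "P_expansion = of_laurent F"
    and "\<And>\<kappa>. Poly_Mapping.lookup F \<kappa> = (\<Sum>\<mu>\<in>orbit n lam. P_coeff \<mu> * cf (E \<mu>) \<kappa>)"
proof -
  have "\<exists>f. \<forall>\<mu>\<in>orbit n lam. E \<mu> = of_laurent (f \<mu>)"
    by (rule bchoice) (use E_of_laurent orbit_Zn[OF lam(1)] in metis)
  then obtain f where f: "\<And>\<mu>. \<mu> \<in> orbit n lam \<Longrightarrow> E \<mu> = of_laurent (f \<mu>)" by blast
  define F where "F = (\<Sum>\<mu>\<in>orbit n lam. Poly_Mapping.single 0 (P_coeff \<mu>) * f \<mu>)"
  have "P_expansion = of_laurent F"
    by (simp add: P_expansion_def F_def of_laurent_sum f const_def)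
  moreover have "Poly_Mapping.lookup F \<kappa> = (\<Sum>\<mu>\<in>orbit n lam. P_coeff \<mu> * cf (E \<mu>) \<kappa>)" for \<kappa>
    by (simp add: F_def lookup_sum lookup_single_mult_shift f)
  ultimately show ?thesis by (rule that)
qed

text \<open>By symmetry the coefficient may be read at the antidominant weight instead.
  Triangularity leaves only E at that weight, and its coefficient is a product over no
  inversions.\<close>

lemma cf_P_expansion_lam: "cf P_expansion lam = 1"
proof -
  obtain F where F: "P_expansion = of_laurent F"
    "\<And>\<kappa>. Poly_Mapping.lookup F \<kappa> = (\<Sum>\<mu>\<in>orbit n lam. P_coeff \<mu> * cf (E \<mu>) \<kappa>)"
    by (rule P_expansion_of_laurent) blast
  define v where "v = vperm n lam"
  define anti where "anti = act v lam"
  have v: "v \<in> Sym n" by (simp add: v_def vperm_Sym)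
  have anti: "anti \<in> orbit n lam" unfolding anti_def by (intro act_orbit v self_orbit)
  have inc: "weakly_increasing n anti" by (simp add: anti_def v_def weakly_increasing_vperm)
  have "of_laurent (permL (inv v) F) = of_laurent F"
    unfolding actX_of_laurent[symmetric] F(1)[symmetric]
    by (rule actX_symmetric[OF sX_P_expansion Sym_inv[OF v]])
  then have "Poly_Mapping.lookup F lam = Poly_Mapping.lookup (permL (inv v) F) lam" by simp
  also have "\<dots> = Poly_Mapping.lookup F anti"
    unfolding lookup_permL[OF Sym_inv[OF v]] Sym_inv_simps(5)[OF v] anti_def ..
  also have "\<dots> = (\<Sum>\<mu>\<in>orbit n lam. if \<mu> = anti then P_coeff \<mu> else 0)"
    unfolding F(2)
  proof (rule sum.cong, rule refl)
    fix \<mu> assume \<mu>: "\<mu> \<in> orbit n lam"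
    have \<mu>Z: "\<mu> \<in> Zn n" using orbit_Zn[OF lam(1) \<mu>] .
    show "P_coeff \<mu> * cf (E \<mu>) anti = (if \<mu> = anti then P_coeff \<mu> else 0)"
    proof (cases "\<mu> = anti")
      case True
      then show ?thesis using triangular[OF \<mu>Z] by simp
    next
      case False
      have a: "anti = act (vperm n \<mu>) \<mu>"
        using act_vperm_orbit[OF \<mu> lam(1)] by (simp add: anti_def v_def)
      have "\<not> bruhat_le n anti \<mu>"
        using weakly_increasing_bruhat_max[OF \<mu>Z vperm_Sym] weakly_increasing_vperm False a by metis
      then have "cf (E \<mu>) anti = 0" using triangular[OF \<mu>Z] by blast
      then show ?thesis using False by simp
    qed
  qed
  also have "\<dots> = P_coeff anti" using anti by simp
  also have "\<dots> = 1"
  proof -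
    have "\<not> coord anti l < coord anti k" if "(k, l) \<in> pairs n" for k l
      using inc that by (auto simp: weakly_increasing_def pairs_def not_less)
    then show ?thesis by (auto simp: P_coeff_def inversion_prod_def intro!: prod.neutral)
  qed
  finally show ?thesis by (simp add: F(1))
qed

text \<open>The scalar is left implicit, because the normalization of P absorbs it.\<close>

lemma symm_sum_E_orbit:
  assumes "\<mu> \<in> orbit n lam"
  shows "\<exists>k. symm_sum n (E \<mu>) = const k * symm_sum n (E lam)"
  using assms lam
proof (induction rule: orbit_induct)
  case dominant
  show ?case by (rule exI[of _ 1]) simp
next
  case (adj \<mu> i)
  then obtain k where k: "symm_sum n (E \<mu>) = const k * symm_sum n (E lam)" by blast
  define c where "c = (1 - tt) * (yv n \<mu> i / yv n \<mu> (Suc i)) / (1 - yv n \<mu> i / yv n \<mu> (Suc i))"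
  have "symm_sum n (E (act (adj i) \<mu>)) = const ((1 + c) * k) * symm_sum n (E lam)"
    unfolding E_adj_orbit(1)[OF adj(1-4)] symm_sum_add symm_sum_const symm_sum_hecke[OF adj(2,3)] c_def[symmetric]
    by (simp add: k const_mult const_add algebra_simps)
  then show ?case by blast
qed

theorem macP_eq_P_expansion: "macP n E lam = P_expansion"
proof -
  let ?U = "symm_sum n (E lam)"
  obtain F where F: "P_expansion = of_laurent F" by (rule P_expansion_of_laurent) blast
  have F1: "Poly_Mapping.lookup F lam = 1" using cf_P_expansion_lam by (simp add: F)
  define s where "s = (\<Prod>k=1..n. 1 ^ k - tt ^ k) / (1 - tt) ^ n"
  have "tt ^ k \<noteq> 1" if "k \<in> {1..n}" for k using tt_power_neq_1[of k] that by simp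
  then have s: "s \<noteq> 0" by (auto simp: s_def)
  \<comment> \<open>First evaluation: a symmetric function passes through the symmetrizer and leaves
    the symmetrized kernel, a constant.\<close>
  have "symm_sum n P_expansion = (\<Sum>w\<in>Sym n. P_expansion * actX w (cprod n 1 tt))"
    unfolding symm_sum_eq
    by (rule sum.cong) (auto simp: actX_mult actX_symmetric[OF sX_P_expansion])
  also have "\<dots> = const s * P_expansion"
    unfolding sum_distrib_left[symmetric] s_def using sum_actX_cprod[of 1 tt n] by (simp add: mult.commute)
  finally have U1: "symm_sum n P_expansion = const s * P_expansion" .
  have "\<exists>k. \<forall>\<mu>\<in>orbit n lam. symm_sum n (E \<mu>) = const (k \<mu>) * ?U"
    using symm_sum_E_orbit by (intro bchoice) blast
  then obtain k where k: "\<And>\<mu>. \<mu> \<in> orbit n lam \<Longrightarrow> symm_sum n (E \<mu>) = const (k \<mu>) * ?U" by blast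
  define c where "c = (\<Sum>\<mu>\<in>orbit n lam. P_coeff \<mu> * k \<mu>)"
  have "symm_sum n P_expansion = const c * ?U"
    by (simp add: P_expansion_def symm_sum_sum symm_sum_const k c_def const_sum const_mult sum_distrib_right mult.assoc)
  then have U2: "const s * P_expansion = const c * ?U" using U1 by simp
  have "F \<noteq> 0" using F1 by auto
  then have "P_expansion \<noteq> 0" unfolding F by (metis of_laurent_eq_iff of_laurent_hom(1))
  then have c: "c \<noteq> 0" using U2 s by auto
  define r where "r = s / c"
  have r: "r \<noteq> 0" "?U = const r * P_expansion"
    using U2 c s by (simp_all add: r_def const_divide field_simps)
  \<comment> \<open>Uniqueness of the normalizing constant includes d = 0: there 1 / d is 0, and the
    coefficient is 0 instead of 1.\<close>
  have coeff: "has_coeff (const (1 / d) * ?U) lam 1 \<longleftrightarrow> d = r" for d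
  proof -
    have "const (1 / d) * ?U = const (r / d) * P_expansion"
      unfolding r(2) by (simp add: const_divide)
    also have "\<dots> = of_laurent (Poly_Mapping.single 0 (r / d) * F)"
      by (simp add: F const_def)
    finally have "has_coeff (const (1 / d) * ?U) lam 1 \<longleftrightarrow> r / d = 1"
      by (simp add: has_coeff_def lookup_single_mult_shift F1 del: of_laurent_hom)
    then show ?thesis using r(1) by (cases "d = 0") auto
  qed
  have "Wconst n E lam = r" unfolding Wconst_def coeff by simp
  then show ?thesis using r by (simp add: macP_def const_divide)
qed

end

section \<open>The antisymmetric expansion at a regular weight\<close>

locale regular_weight = dominant_weight +
  assumes regular: "\<And>i j. 1 \<le> i \<Longrightarrow> i < j \<Longrightarrow> j \<le> n \<Longrightarrow> coord lam j < coord lam i"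
begin

lemma coord_lam_eq_iff: "i \<in> {1..n} \<Longrightarrow> j \<in> {1..n} \<Longrightarrow> coord lam i = coord lam j \<longleftrightarrow> i = j"
  using regular[of i j] regular[of j i] by (metis atLeastAtMost_iff less_irrefl linorder_neqE_nat)

lemma coord_orbit_eq_iff:
  assumes "\<mu> \<in> orbit n lam" "i \<in> {1..n}" "j \<in> {1..n}"
  shows "coord \<mu> i = coord \<mu> j \<longleftrightarrow> i = j"
proof -
  obtain w where w: "w \<in> Sym n" "\<mu> = act w lam" using assms(1) by (rule orbitE)
  have "inv w i \<in> {1..n}" "inv w j \<in> {1..n}"
    using Sym_in_range[OF Sym_inv[OF w(1)], where i = i] Sym_in_range[OF Sym_inv[OF w(1)], where i = j] assms by auto
  then show ?thesis
    by (simp add: w coord_act_inv[OF w(1)] coord_lam_eq_iff Sym_eq_iff[OF Sym_inv[OF w(1)]])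
qed

lemma level_increasing_Sym: "level_increasing n lam z"
  using regular by (fastforce simp: level_increasing_def pairs_def)

lemma bij_betw_Sym_orbit: "bij_betw (\<lambda>z. act z lam) (Sym n) (orbit n lam)"
proof (rule bij_betw_imageI)
  show "inj_on (\<lambda>z. act z lam) (Sym n)"
  proof (rule inj_onI)
    fix u w assume u: "u \<in> Sym n" and w: "w \<in> Sym n" and eq: "act u lam = act w lam"
    have "vperm n (act u lam) \<circ> u = vperm n (act w lam) \<circ> w"
      using vperm_act_comp[OF u level_increasing_Sym] vperm_act_comp[OF w level_increasing_Sym] by simp
    then show "u = w"
      unfolding eq using Sym_inv_simps(4)[OF vperm_Sym] by (metis comp_assoc id_o)
  qed
qed (simp add: orbit_def)

text \<open>The entries are distinct, so sorting commutes with every permutation and the spectral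
  vectors of the orbit are the rearrangements of a single one. Orbit sums thereby become
  symmetrizations.\<close>

lemma yv_act: "z \<in> Sym n \<Longrightarrow> yv n (act z lam) k = yv n lam (inv z k)"
  using vperm_act_comp[OF _ level_increasing_Sym, of z]
  by (simp add: yv_def coord_act_inv) (metis Sym_inv_simps(1) comp_apply)

text \<open>A regular orbit has no equal neighbours, so the whole sum consists of pairs, and each
  pair is a multiple of (T_i - 1) E_\<mu>.\<close>

lemma A_expansion_split:
  assumes i: "1 \<le> i" "i < n"
  obtains Q where "A_expansion = cfun tt 1 i (Suc i) * Q" "sX i Q = - Q"
proof
  note S = adj_Sym[OF i]
  let ?G = "{\<mu> \<in> orbit n lam. coord \<mu> (Suc i) < coord \<mu> i}"
  define Q where "Q = (\<Sum>\<mu>\<in>?G. const (A_coeff (act (adj i) \<mu>)) * (sX i (E \<mu>) - E \<mu>))"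
  have empty: "{\<mu> \<in> orbit n lam. coord \<mu> i = coord \<mu> (Suc i)} = {}"
    using coord_orbit_eq_iff[of _ i "Suc i"] i by auto
  have gt: "const (A_coeff \<mu>) * E \<mu> + const (A_coeff (act (adj i) \<mu>)) * E (act (adj i) \<mu>) =
      cfun tt 1 i (Suc i) * (const (A_coeff (act (adj i) \<mu>)) * (sX i (E \<mu>) - E \<mu>))"
    if "\<mu> \<in> ?G" for \<mu>
  proof -
    have \<mu>: "\<mu> \<in> orbit n lam" "coord \<mu> i > coord \<mu> (Suc i)" using that by auto
    define a where "a = yv n \<mu> i / yv n \<mu> (Suc i)"
    have a: "a \<noteq> 1" "E (act (adj i) \<mu>) = hecke i (E \<mu>) + const ((1 - tt) * a / (1 - a)) * E \<mu>"
      using E_adj_orbit[OF \<mu>(1) i \<mu>(2)] by (simp_all add: a_def)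
    define b where "b = - (1 - tt * a) / (1 - a)"
    define c where "c = (1 - tt) * a / (1 - a)"
    have A: "A_coeff \<mu> = b * A_coeff (act (adj i) \<mu>)"
      unfolding A_coeff_def inversion_prod_adj[OF i \<mu>(2)] by (simp add: a_def b_def)
    have "b = - 1 - c"
      using a(1) by (simp add: b_def c_def divide_simps) (simp add: algebra_simps)
    then have b: "const b = - 1 - const c" by (simp add: const_uminus const_diff)
    have "const (A_coeff \<mu>) * E \<mu> + const (A_coeff (act (adj i) \<mu>)) * E (act (adj i) \<mu>) =
        const (A_coeff (act (adj i) \<mu>)) * (hecke i (E \<mu>) - E \<mu>)"
      unfolding a(2) c_def[symmetric] A const_mult b by (simp add: algebra_simps)
    then show ?thesis by (simp add: hecke_minus_self[OF i(1)])
  qed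
  show "A_expansion = cfun tt 1 i (Suc i) * Q"
    unfolding A_expansion_def sum_orbit_adj[OF i] empty Q_def sum_distrib_left sum.empty add_0_left
    by (rule sum.cong[OF refl gt])
  show "sX i Q = - Q"
    unfolding Q_def actX_sum[OF S] sum_negf[symmetric]
    by (rule sum.cong) (simp_all add: actX_mult[OF S] actX_diff[OF S] sX_sX[OF i] algebra_simps)
qed

text \<open>Under antisymmetrization T_i acts as -t; adding the scalar of (E2) gives (a - t) / (1 -
  a).\<close>

definition "E_alternant_coeff = noninversion_prod n (\<lambda>a. (a - tt) / (1 - a))"

lemma alt_sum_E_orbit:
  assumes "\<mu> \<in> orbit n lam"
  shows "alt_sum n (E \<mu>) = const (E_alternant_coeff \<mu>) * alt_sum n (E lam)"
  using assms lam
proof (induction rule: orbit_induct)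
  case dominant
  have "\<not> coord lam k < coord lam l" if "(k, l) \<in> pairs n" for k l
    using lam that by (auto simp: weakly_decreasing_def pairs_def not_less)
  then have "E_alternant_coeff lam = 1"
    by (auto simp: E_alternant_coeff_def noninversion_prod_def intro!: prod.neutral)
  then show ?case by simp
next
  case (adj \<mu> i)
  define a where "a = yv n \<mu> i / yv n \<mu> (Suc i)"
  define c where "c = (1 - tt) * a / (1 - a)"
  have a: "a \<noteq> 1" "E (act (adj i) \<mu>) = hecke i (E \<mu>) + const c * E \<mu>"
    using E_adj_orbit[OF adj(1-4)] by (simp_all add: a_def c_def)
  have "(a - tt) / (1 - a) = - tt + c"
    using a(1) by (simp add: c_def divide_simps) (simp add: algebra_simps)
  then have e: "E_alternant_coeff (act (adj i) \<mu>) = (- tt + c) * E_alternant_coeff \<mu>"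
    unfolding E_alternant_coeff_def noninversion_prod_adj[OF adj(2-4)] by (simp add: a_def)
  show ?case
    unfolding a(2) e alt_sum_add alt_sum_const alt_sum_hecke[OF adj(2,3)] adj(5) const_mult const_add const_uminus
    by (simp add: algebra_simps)
qed

text \<open>For each pair exactly one of the two products has a factor. Either one equals the kernel
  with p = -t and r = -1 at the spectral values, since the latter appear inverted in the
  noninversion product.\<close>

lemma A_coeff_mult_E_alternant_coeff:
  assumes "\<mu> \<in> orbit n lam"
  shows "A_coeff \<mu> * E_alternant_coeff \<mu> =
    (\<Prod>(k, l)\<in>pairs n. (- tt * yv n \<mu> k - - 1 * yv n \<mu> l) / (yv n \<mu> k - yv n \<mu> l))"
  unfolding A_coeff_def E_alternant_coeff_def inversion_prod_def noninversion_prod_def prod.distrib[symmetric]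
proof (rule prod.cong, rule refl, clarify)
  fix k l assume "(k, l) \<in> pairs n"
  then have kl: "k \<in> {1..n}" "l \<in> {1..n}" "k \<noteq> l" by (auto simp: pairs_def)
  define u where "u = yv n \<mu> k"
  define v where "v = yv n \<mu> l"
  have ne: "coord \<mu> k \<noteq> coord \<mu> l" using coord_orbit_eq_iff[OF assms kl(1,2)] kl(3) by simp
  then have uv: "u \<noteq> v" "u \<noteq> 0" "v \<noteq> 0" by (simp_all add: u_def v_def yv_eq_iff)
  have "- (1 - tt * (u / v)) / (1 - u / v) = (- tt * u - - 1 * v) / (u - v)"
    "(v / u - tt) / (1 - v / u) = (- tt * u - - 1 * v) / (u - v)"
    using uv by (simp_all add: divide_simps) (simp_all add: algebra_simps)
  then show "(if coord \<mu> l < coord \<mu> k then - (1 - tt * (yv n \<mu> k / yv n \<mu> l)) / (1 - yv n \<mu> k / yv n \<mu> l) else 1) *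
      (if coord \<mu> k < coord \<mu> l then (yv n \<mu> l / yv n \<mu> k - tt) / (1 - yv n \<mu> l / yv n \<mu> k) else 1) =
      (- tt * yv n \<mu> k - - 1 * yv n \<mu> l) / (yv n \<mu> k - yv n \<mu> l)"
    using ne unfolding u_def v_def by (cases "coord \<mu> l < coord \<mu> k") auto
qed

lemma sum_A_coeff_mult_E_alternant_coeff:
  "(\<Sum>\<mu>\<in>orbit n lam. A_coeff \<mu> * E_alternant_coeff \<mu>) = (\<Prod>k=1..n. (- tt) ^ k - (- 1) ^ k) / (- tt - - 1) ^ n"
proof -
  let ?f = "\<lambda>w. \<Prod>(k, l)\<in>pairs n. (- tt * yv n lam (w k) - - 1 * yv n lam (w l)) / (yv n lam (w k) - yv n lam (w l))"
  have "(\<Sum>\<mu>\<in>orbit n lam. A_coeff \<mu> * E_alternant_coeff \<mu>) =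
      (\<Sum>z\<in>Sym n. A_coeff (act z lam) * E_alternant_coeff (act z lam))"
    by (rule sum.reindex_bij_betw[OF bij_betw_Sym_orbit, symmetric])
  also have "\<dots> = (\<Sum>z\<in>Sym n. ?f (inv z))"
    by (rule sum.cong) (simp_all add: A_coeff_mult_E_alternant_coeff act_orbit self_orbit yv_act)
  also have "\<dots> = (\<Sum>w\<in>Sym n. ?f w)" by (rule sum_Sym_inv)
  finally have *: "(\<Sum>\<mu>\<in>orbit n lam. A_coeff \<mu> * E_alternant_coeff \<mu>) = (\<Sum>w\<in>Sym n. ?f w)" .
  have "inj_on (yv n lam) {1..n}"
    by (rule inj_onI) (auto simp: yv_eq_iff coord_lam_eq_iff)
  then have sum: "(- tt - - 1) ^ n * (\<Sum>w\<in>Sym n. ?f w) = (\<Prod>k=1..n. (- tt) ^ k - (- 1) ^ k)"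
    by (rule symmetrization_identity) simp
  have nz: "(- tt - - 1) ^ n \<noteq> 0" by simp
  show ?thesis
    unfolding * nonzero_eq_divide_eq[OF nz] by (subst mult.commute) (rule sum)
qed

theorem macA_eq_A_expansion: "macA n E lam = A_expansion"
proof -
  define D where "D = cprod n (- tt) (- 1)"
  have D: "D \<noteq> 0" by (simp add: D_def cprod_nonzero)
  define g where "g = A_expansion / D"
  define s where "s = (\<Prod>k=1..n. (- tt) ^ k - (- 1) ^ k) / (- tt - - 1) ^ n"
  have "(- tt) ^ k - (- 1) ^ k \<noteq> 0" if "k \<in> {1..n}" for k
  proof -
    have "(- tt) ^ k - (- 1) ^ k = (- 1) ^ k * (tt ^ k - 1)"
      by (simp add: power_minus[of tt] right_diff_distrib)
    then show ?thesis using tt_power_neq_1[of k] that by simp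
  qed
  then have s: "s \<noteq> 0" by (auto simp: s_def)
  \<comment> \<open>The i-th factor of \<open>D\<close> cancels, up to sign, the one split off from
    the sum. What remains is an antisymmetric function over a symmetric one.\<close>
  have "sX i g = - g" if i: "1 \<le> i" "i < n" for i
  proof -
    note S = adj_Sym[OF i]
    obtain c where c: "D = cfun (- tt) (- 1) i (Suc i) * c" "sX i c = c"
      unfolding D_def using i by (rule cprod_split)
    obtain Q where Q: "A_expansion = cfun tt 1 i (Suc i) * Q" "sX i Q = - Q"
      using i by (rule A_expansion_split)
    have "cfun (- tt) (- 1) i (Suc i) = - cfun tt 1 i (Suc i)"
      by (simp add: cfun_def const_uminus minus_divide_left)
    moreover have "cfun tt 1 i (Suc i) \<noteq> 0" by (simp add: cfun_nonzero)
    ultimately have "g = - Q / c" unfolding g_def c Q(1) by simp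
    then show ?thesis by (simp add: actX_divide[OF S] actX_uminus[OF S] Q(2) c(2))
  qed
  then have g: "actX w g = (- 1) ^ len n w * g" if "w \<in> Sym n" for w
    using that by (rule actX_antisymmetric)
  \<comment> \<open>The sign of \<open>g\<close> cancels that of the alternating sum, leaving the
    plain symmetrization of \<open>D\<close>.\<close>
  have "alt_sum n A_expansion = (\<Sum>w\<in>Sym n. g * actX w D)"
    unfolding alt_sum_def
  proof (rule sum.cong, rule refl)
    fix w assume w: "w \<in> Sym n"
    have "A_expansion = g * D" using D by (simp add: g_def)
    then have "actX w A_expansion = (- 1) ^ len n w * g * actX w D"
      by (simp add: actX_mult[OF w] g[OF w])
    then have "(- 1) ^ len n w * actX w A_expansion = ((- 1) ^ len n w * (- 1) ^ len n w) * (g * actX w D)"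
      by (simp only: mult.assoc)
    moreover have "(- 1 :: ratfun) ^ len n w * (- 1) ^ len n w = 1"
      by (simp flip: power_mult_distrib)
    ultimately show "(- 1) ^ len n w * actX w A_expansion = g * actX w D"
      by (simp only: mult_1)
  qed
  also have "\<dots> = const s * g"
    unfolding sum_distrib_left[symmetric] D_def s_def using sum_actX_cprod[of "- tt" "- 1" n]
    by (simp add: mult.commute)
  finally have 1: "alt_sum n A_expansion = const s * g" .
  \<comment> \<open>Second evaluation, term by term. The kernel symmetrized at the spectral vector
    gives the same constant \<open>s\<close>, so cancelling it yields an exact equality.\<close>
  have "alt_sum n A_expansion = (\<Sum>\<mu>\<in>orbit n lam. const (A_coeff \<mu> * E_alternant_coeff \<mu>)) * alt_sum n (E lam)"
    unfolding A_expansion_def alt_sum_sum alt_sum_const sum_distrib_right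
    by (rule sum.cong) (auto simp: alt_sum_E_orbit const_mult)
  then have "alt_sum n A_expansion = const s * alt_sum n (E lam)"
    by (simp add: sum_A_coeff_mult_E_alternant_coeff s_def flip: const_sum)
  then have "g = alt_sum n (E lam)" using 1 s by simp
  moreover have "macA n E lam = D * alt_sum n (E lam)"
    unfolding macA_def alt_sum_def D_def cprod_def cfun_def by (simp add: const_uminus add.commute)
  moreover have "D * g = A_expansion" using D by (simp add: g_def)
  ultimately show ?thesis by simp
qed

end

section \<open>The c-functions\<close>

interpretation evt: substitution "\<lambda>c. c"
  "\<lambda>i. qq powi (- coord \<mu> i) * th powi (- 2 * (int (vperm n \<mu> i) - 1) + (int n - 1))" for n \<mu>
  by unfold_locales auto

text \<open>The c-functions involve only ratios of the Y_i, so the common power of t^(1/2) drops out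
  and \<open>yv\<close> suffices.\<close>

lemma evt_point:
  "qq powi (- coord \<mu> i) * th powi (- 2 * (int (vperm n \<mu> i) - 1) + (int n - 1)) =
    th powi (int n + 1) / yv n \<mu> i"
proof -
  have "th powi (- 2 * (int (vperm n \<mu> i) - 1) + (int n - 1)) = th powi ((int n + 1) - 2 * int (vperm n \<mu> i))"
    by (rule arg_cong) simp
  also have "\<dots> = th powi (int n + 1) / th powi (2 * int (vperm n \<mu> i))"
    by (rule power_int_diff) simp
  finally show ?thesis
    unfolding yv_def tt_powi by (simp only: power_int_minus divide_inverse inverse_mult_distrib mult_ac)
qed

lemma evaluates_Y_ratio:
  "evt.evaluates \<mu> n (Y i * inverse (Y j)) (yv n \<mu> j / yv n \<mu> i)"
proof -
  have "evt.evaluates \<mu> n (Y i * inverse (Y j))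
      ((th powi (int n + 1) / yv n \<mu> i) * inverse (th powi (int n + 1) / yv n \<mu> j))"
    unfolding evt_point[symmetric] by (intro evt.evaluates_mult evt.evaluates_inverse evt.evaluates_X) simp
  then show ?thesis by (simp add: field_simps)
qed

lemma evaluates_Y_ratio': "evt.evaluates \<mu> n (inverse (Y i) * Y j) (yv n \<mu> i / yv n \<mu> j)"
  using evaluates_Y_ratio[of \<mu> n j i] by (simp only: mult.commute)

lemma inversion_prod_eq:
  "inversion_prod n h \<mu> = (\<Prod>(i, j)\<in>{(i, j) \<in> pairs n. coord \<mu> i > coord \<mu> j}. h (yv n \<mu> i / yv n \<mu> j))"
proof -
  have "{(i, j) \<in> pairs n. coord \<mu> i > coord \<mu> j} = {p \<in> pairs n. coord \<mu> (fst p) > coord \<mu> (snd p)}"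
    by auto
  then show ?thesis
    by (simp only: prod.inter_filter[OF finite_pairs] inversion_prod_def case_prod_unfold)
qed

lemma power_card_mult_prod:
  fixes c :: "'a::comm_monoid_mult"
  shows "c ^ card I * (\<Prod>(i, j)\<in>I. f i j) = (\<Prod>(i, j)\<in>I. c * f i j)"
  by (simp add: case_prod_beta prod.distrib)

text \<open>The power of t^(1/2) supplies one factor per inversion. The ratio Y_i / Y_j evaluates to
  the inverse of the parameter a, which explains the shape (t - a) / (1 - a).\<close>

lemma evt_cYw:
  "th ^ len n (vperm n \<mu>) * evt n \<mu> (cYw n (vperm n \<mu>)) = inversion_prod n (\<lambda>a. (tt - a) / (1 - a)) \<mu>"
proof -
  let ?I = "{(i, j) \<in> pairs n. coord \<mu> i > coord \<mu> j}"
  let ?c = "\<lambda>b. (inverse th - th * b) / (1 - b)"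
  have "evt.evaluates \<mu> n (cYw n (vperm n \<mu>)) (\<Prod>(i, j)\<in>?I. ?c (yv n \<mu> j / yv n \<mu> i))"
    unfolding cYw_def Inv_vperm
  proof (rule evt.evaluates_prod, clarify)
    fix i j assume "coord \<mu> j < coord \<mu> i"
    then have "yv n \<mu> j / yv n \<mu> i \<noteq> 1" by (simp add: yv_eq_iff)
    then show "evt.evaluates \<mu> n (cY i j) (?c (yv n \<mu> j / yv n \<mu> i))"
      unfolding cY_def mult.assoc
      by (intro evt.evaluates_divide evt.evaluates_diff evt.evaluates_mult[OF evt.evaluates_const]
          evt.evaluates_const evt.evaluates_1 evaluates_Y_ratio) simp
  qed
  then have "evt n \<mu> (cYw n (vperm n \<mu>)) = (\<Prod>(i, j)\<in>?I. ?c (yv n \<mu> j / yv n \<mu> i))"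
    unfolding evt_def by (rule evt.rat_eval_eqI)
  then have "th ^ len n (vperm n \<mu>) * evt n \<mu> (cYw n (vperm n \<mu>)) =
      (\<Prod>(i, j)\<in>?I. th * ?c (yv n \<mu> j / yv n \<mu> i))"
    by (simp only: len_def Inv_vperm power_card_mult_prod)
  also have "\<dots> = (\<Prod>(i, j)\<in>?I. (tt - yv n \<mu> i / yv n \<mu> j) / (1 - yv n \<mu> i / yv n \<mu> j))"
  proof (rule prod.cong, rule refl, clarify)
    fix i j assume "coord \<mu> j < coord \<mu> i"
    then have "yv n \<mu> i \<noteq> yv n \<mu> j" by (simp add: yv_eq_iff)
    moreover define u v where "u = yv n \<mu> i" and "v = yv n \<mu> j"
    moreover have "u \<noteq> 0" "v \<noteq> 0" by (simp_all add: u_def v_def)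
    ultimately show "th * ?c (yv n \<mu> j / yv n \<mu> i) = (tt - yv n \<mu> i / yv n \<mu> j) / (1 - yv n \<mu> i / yv n \<mu> j)"
      by (simp add: tt_def power2_eq_square divide_simps) (simp add: algebra_simps)
  qed
  finally show ?thesis unfolding inversion_prod_eq .
qed

text \<open>With inverted variables the ratio evaluates to a itself, so distributing the factors
  -t^(1/2) over the inversions suffices.\<close>

lemma evt_cYinvw:
  "(- th) ^ len n (vperm n \<mu>) * evt n \<mu> (cYinvw n (vperm n \<mu>)) =
    inversion_prod n (\<lambda>a. - (1 - tt * a) / (1 - a)) \<mu>"
proof -
  let ?I = "{(i, j) \<in> pairs n. coord \<mu> i > coord \<mu> j}"
  let ?c = "\<lambda>b. (inverse th - th * b) / (1 - b)"
  have "evt.evaluates \<mu> n (cYinvw n (vperm n \<mu>)) (\<Prod>(i, j)\<in>?I. ?c (yv n \<mu> i / yv n \<mu> j))"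
    unfolding cYinvw_def Inv_vperm
  proof (rule evt.evaluates_prod, clarify)
    fix i j assume "coord \<mu> j < coord \<mu> i"
    then have "yv n \<mu> i / yv n \<mu> j \<noteq> 1" by (simp add: yv_eq_iff)
    then show "evt.evaluates \<mu> n (cYinv i j) (?c (yv n \<mu> i / yv n \<mu> j))"
      unfolding cYinv_def mult.assoc
      by (intro evt.evaluates_divide evt.evaluates_diff evt.evaluates_mult[OF evt.evaluates_const]
          evt.evaluates_const evt.evaluates_1 evaluates_Y_ratio') simp
  qed
  then have "evt n \<mu> (cYinvw n (vperm n \<mu>)) = (\<Prod>(i, j)\<in>?I. ?c (yv n \<mu> i / yv n \<mu> j))"
    unfolding evt_def by (rule evt.rat_eval_eqI)
  then have "(- th) ^ len n (vperm n \<mu>) * evt n \<mu> (cYinvw n (vperm n \<mu>)) =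
      (\<Prod>(i, j)\<in>?I. - th * ?c (yv n \<mu> i / yv n \<mu> j))"
    by (simp only: len_def Inv_vperm power_card_mult_prod)
  also have "\<dots> = (\<Prod>(i, j)\<in>?I. - (1 - tt * (yv n \<mu> i / yv n \<mu> j)) / (1 - yv n \<mu> i / yv n \<mu> j))"
  proof (rule prod.cong, rule refl, clarify)
    fix i j
    have "- th * (inverse th - th * b) = - (1 - tt * b)" for b
      by (simp add: tt_def power2_eq_square right_diff_distrib)
    then have "- th * ?c b = - (1 - tt * b) / (1 - b)" for b
      by (simp only: times_divide_eq_right)
    then show "- th * ?c (yv n \<mu> i / yv n \<mu> j) =
        - (1 - tt * (yv n \<mu> i / yv n \<mu> j)) / (1 - yv n \<mu> i / yv n \<mu> j)" .
  qed
  finally show ?thesis unfolding inversion_prod_eq .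
qed

lemma inversion_prod_explicit:
  "inversion_prod n (\<lambda>a. (tt - a) / (1 - a)) \<mu> =
    (\<Prod>(i, j)\<in>{(i, j) \<in> pairs n. coord \<mu> i > coord \<mu> j}.
      tt * ((1 - qq powi (coord \<mu> i - coord \<mu> j) * tt powi (int (vperm n \<mu> i) - int (vperm n \<mu> j) - 1)) /
            (1 - qq powi (coord \<mu> i - coord \<mu> j) * tt powi (int (vperm n \<mu> i) - int (vperm n \<mu> j)))))"
  "inversion_prod n (\<lambda>a. - (1 - tt * a) / (1 - a)) \<mu> =
    (\<Prod>(i, j)\<in>{(i, j) \<in> pairs n. coord \<mu> i > coord \<mu> j}.
      (- 1) * ((1 - qq powi (coord \<mu> i - coord \<mu> j) * tt powi (int (vperm n \<mu> i) - int (vperm n \<mu> j) + 1)) /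
            (1 - qq powi (coord \<mu> i - coord \<mu> j) * tt powi (int (vperm n \<mu> i) - int (vperm n \<mu> j)))))"
proof -
  have 1: "(tt - a * b) / (1 - a * b) = tt * ((1 - a * (b / tt)) / (1 - a * b))" for a b :: K
    by (simp add: right_diff_distrib)
  have 2: "- (1 - tt * (a * b)) / (1 - a * b) = (- 1) * ((1 - a * (b * tt)) / (1 - a * b))" for a b :: K
    by (simp add: mult_ac)
  have p: "tt powi (k - 1) = tt powi k / tt" "tt powi (k + 1) = tt powi k * tt" for k
    by (simp_all add: power_int_diff power_int_add)
  show "inversion_prod n (\<lambda>a. (tt - a) / (1 - a)) \<mu> =
    (\<Prod>(i, j)\<in>{(i, j) \<in> pairs n. coord \<mu> i > coord \<mu> j}.
      tt * ((1 - qq powi (coord \<mu> i - coord \<mu> j) * tt powi (int (vperm n \<mu> i) - int (vperm n \<mu> j) - 1)) /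
            (1 - qq powi (coord \<mu> i - coord \<mu> j) * tt powi (int (vperm n \<mu> i) - int (vperm n \<mu> j)))))"
    unfolding inversion_prod_eq yv_divide p 1 ..
  show "inversion_prod n (\<lambda>a. - (1 - tt * a) / (1 - a)) \<mu> =
    (\<Prod>(i, j)\<in>{(i, j) \<in> pairs n. coord \<mu> i > coord \<mu> j}.
      (- 1) * ((1 - qq powi (coord \<mu> i - coord \<mu> j) * tt powi (int (vperm n \<mu> i) - int (vperm n \<mu> j) + 1)) /
            (1 - qq powi (coord \<mu> i - coord \<mu> j) * tt powi (int (vperm n \<mu> i) - int (vperm n \<mu> j)))))"
    unfolding inversion_prod_eq yv_divide p 2 ..
qed

lemma (in regular_weight) vperm_eq_w0: "vperm n lam = w0 n"
proof -
  have sets: "{r' \<in> {1..<r}. coord lam r' \<le> coord lam r} = {}" "{r' \<in> {r<..n}. coord lam r' < coord lam r} = {r<..n}"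
    if "r \<in> {1..n}" for r
    using regular[of _ r] regular[of r] that by (force simp: not_le)+
  show ?thesis
  proof
    fix r
    show "vperm n lam r = w0 n r"
    proof (cases "r \<in> {1..n}")
      case True
      then show ?thesis unfolding vperm_explicit w0_explicit sets[OF True] by (simp add: Suc_diff_le)
    next
      case False
      then show ?thesis unfolding vperm_explicit w0_explicit by (simp only: if_False)
    qed
  qed
qed

lemma coord_rho: "coord (rho n) i = (if i \<in> {1..n} then int n - int i else 0)"
  by (simp add: rho_def coord_vec)

context dominant_weight
begin

lemma P_expansion_explicit:
  "P_expansion = (\<Sum>\<mu>\<in>orbit n lam.
    const (\<Prod>(i, j)\<in>{(i, j) \<in> pairs n. coord \<mu> i > coord \<mu> j}.
      tt * ((1 - qq powi (coord \<mu> i - coord \<mu> j) * tt powi (int (vperm n \<mu> i) - int (vperm n \<mu> j) - 1)) /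
            (1 - qq powi (coord \<mu> i - coord \<mu> j) * tt powi (int (vperm n \<mu> i) - int (vperm n \<mu> j))))) * E \<mu>)"
  unfolding P_expansion_def P_coeff_def inversion_prod_explicit ..

lemma A_expansion_explicit:
  "A_expansion = (\<Sum>\<mu>\<in>orbit n lam.
    const (\<Prod>(i, j)\<in>{(i, j) \<in> pairs n. coord \<mu> i > coord \<mu> j}.
      (- 1) * ((1 - qq powi (coord \<mu> i - coord \<mu> j) * tt powi (int (vperm n \<mu> i) - int (vperm n \<mu> j) + 1)) /
            (1 - qq powi (coord \<mu> i - coord \<mu> j) * tt powi (int (vperm n \<mu> i) - int (vperm n \<mu> j))))) * E \<mu>)"
  unfolding A_expansion_def A_coeff_def inversion_prod_explicit ..

lemma vperm_comp_inv_min_rep: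
  assumes "z \<in> min_reps n lam"
  shows "vperm n lam \<circ> inv z = vperm n (act z lam)"
proof -
  have "z \<in> Sym n" using assms by (simp add: min_reps_def)
  then show ?thesis
    unfolding vperm_act_min_rep[OF assms lam, symmetric] comp_assoc by (simp add: Sym_inv_simps)
qed

lemma P_expansion_min_reps:
  "P_expansion = (\<Sum>z\<in>min_reps n lam.
    const (th ^ len n (vperm n lam \<circ> inv z) *
           evt n (act z lam) (cYw n (vperm n lam \<circ> inv z))) * E (act z lam))"
  unfolding P_expansion_def P_coeff_def evt_cYw[symmetric]
    sum.reindex_bij_betw[OF bij_betw_min_reps[OF lam], symmetric]
  by (rule sum.cong) (simp_all only: vperm_comp_inv_min_rep)

end

lemma (in regular_weight) A_expansion_Sym:
  "A_expansion = (\<Sum>z\<in>Sym n.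
    const ((- th) ^ len n (w0 n \<circ> inv z) *
           evt n (act z lam) (cYinvw n (w0 n \<circ> inv z))) * E (act z lam))"
proof -
  have "w0 n \<circ> inv z = vperm n (act z lam)" if "z \<in> Sym n" for z
    unfolding vperm_eq_w0[symmetric] vperm_act_comp[OF that level_increasing_Sym, symmetric] comp_assoc
    using that by (simp add: Sym_inv_simps)
  then show ?thesis
    unfolding A_expansion_def A_coeff_def evt_cYinvw[symmetric]
      sum.reindex_bij_betw[OF bij_betw_Sym_orbit, symmetric]
    by (intro sum.cong) (simp_all only:)
qed

theorem proposition4p7:
  fixes n :: nat and lam :: expo and E :: "expo \<Rightarrow> ratfun"
  assumes "n \<ge> 1"
    and "electronic_macdonald n E"
    and "lam \<in> Zn n"
    and "weakly_decreasing n lam"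
  shows
    "macP n E lam =
       (\<Sum>z\<in>min_reps n lam.
          const (th ^ len n (vperm n lam \<circ> inv z) *
                 evt n (act z lam) (cYw n (vperm n lam \<circ> inv z))) * E (act z lam)) \<and>
     macA n E (lam + rho n) =
       (\<Sum>z\<in>Sym n.
          const ((- th) ^ len n (w0 n \<circ> inv z) *
                 evt n (act z (lam + rho n)) (cYinvw n (w0 n \<circ> inv z))) *
          E (act z (lam + rho n))) \<and>
     macP n E lam =
       (\<Sum>\<mu>\<in>orbit n lam.
          const (\<Prod>(i, j)\<in>{(i, j) \<in> pairs n. coord \<mu> i > coord \<mu> j}.
            tt * ((1 - qq powi (coord \<mu> i - coord \<mu> j) *
                       tt powi (int (vperm n \<mu> i) - int (vperm n \<mu> j) - 1)) /
                  (1 - qq powi (coord \<mu> i - coord \<mu> j) *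
                       tt powi (int (vperm n \<mu> i) - int (vperm n \<mu> j))))) * E \<mu>) \<and>
     macA n E (lam + rho n) =
       (\<Sum>\<mu>\<in>orbit n (lam + rho n).
          const (\<Prod>(i, j)\<in>{(i, j) \<in> pairs n. coord \<mu> i > coord \<mu> j}.
            (- 1) * ((1 - qq powi (coord \<mu> i - coord \<mu> j) *
                          tt powi (int (vperm n \<mu> i) - int (vperm n \<mu> j) + 1)) /
                     (1 - qq powi (coord \<mu> i - coord \<mu> j) *
                          tt powi (int (vperm n \<mu> i) - int (vperm n \<mu> j))))) * E \<mu>)"
proof -
  interpret P: dominant_weight n E lam
    by unfold_locales (use assms in auto)
  have less: "coord (lam + rho n) j < coord (lam + rho n) i" if "1 \<le> i" "i < j" "j \<le> n" for i j
  proof -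
    have "coord lam j \<le> coord lam i" using assms(4) that by (simp add: weakly_decreasing_def)
    then show ?thesis using that by (simp add: lookup_add coord_rho)
  qed
  interpret A: regular_weight n E "lam + rho n"
  proof unfold_locales
    show "lam + rho n \<in> Zn n" using assms(3) by (simp add: Zn_iff lookup_add coord_rho)
    show "weakly_decreasing n (lam + rho n)"
      unfolding weakly_decreasing_def using less by (metis le_less less_imp_le)
  qed (rule less)
  show ?thesis
    using P.macP_eq_P_expansion P.P_expansion_min_reps P.P_expansion_explicit
      A.macA_eq_A_expansion A.A_expansion_Sym A.A_expansion_explicit
    by (intro conjI) (simp_all only:)
qed

end
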